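(* Let $\mathfrak{g}$ be a Lie algebra over $\mathbf{C}$, and regard $\mathbf{C}$ as a trivial $\mathfrak{g}$-module. Let $\mathfrak{s}=\mathfrak{s}(\mathfrak{g},\mathbf{C})$ be the corresponding souped-up Lie algebra, and let $I(\mathfrak{s})\subset F(\mathfrak{s})$ be the souped-up vertex algebra ideal formed with $N(s,t)\equiv 1$ on $\mathfrak{s}\times\mathfrak{s}$. Then the map taking $\mathfrak{s}$ to its image in $V(\mathfrak{s})=F(\mathfrak{s})/I(\mathfrak{s})$ is injective; equivalently, $I(\mathfrak{s})\cap\mathfrak{s}=\{0\}$.
   Context: Conventions. Vector spaces are over $\mathbf{C}$ and are $\mathbf{Z}/2$-graded, with parity $p$; "commutative", "Lie algebra", etc. are meant in the super sense. For a vector space $\mathfrak{v}$ with a distinguished even nonzero vector $\mathbf{1}$, $F(\mathfrak{v})$ is the free nonassociative algebra on the vector space $\mathfrak{v}$ with bilinear products $x\circ_n y=x_ny$, $n\in\mathbf{Z}$ (no relations other than bilinearity; $p(x_ny)=p(x)+p(y)$); $\mathfrak{v}\subset F(\mathfrak{v})$. A monomial is an iterated product of elements of $\mathfrak{v}$. Ideals are closed under left and right multiplication by all elements for all $\circ_n$. Put $Dx=x_{-2}\mathbf{1}$. Vertex algebra ideal. Given $N(u,v)\ge 0$ on $\mathfrak{v}\times\mathfrak{v}$, $I(\mathfrak{v})$ is the ideal of $F(\mathfrak{v})$ generated, for $u,v\in\mathfrak{v}$ and (parity-homogeneous) $x,y,z\in F(\mathfrak{v})$, by - $\mathbf{1}_nx-\delta_{n,-1}x$;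 - $u_nv$ for all $n\ge N(u,v)$; - $D(x_ny)-(Dx)_ny-x_n(Dy)$; - $(Dx)_ny+n\,x_{n-1}y$ for all $n\in\mathbf{Z}$; - $x_ny+(-1)^{p(x)p(y)}\sum_{k\ge0}\frac{(-1)^{n+k}}{k!}D^k(y_{n+k}x)$; - $(x_my)_nz-\sum_{k\ge0}\binom{m}{k}(-1)^k\big(x_{m-k}(y_{n+k}z)-(-1)^{m+p(x)p(y)}y_{m+n-k}(x_kz)\big)$; where, unless indicated otherwise, each of $m,n$ ranges over $-1$ and all sufficiently large integers (threshold independent of $x,y,z$). The infinite sums are read modulo the ideal: for each $x,y$ one has $x_ny\in I(\mathfrak{v})$ for all large $n$, and terms lying in the ideal for this reason are dropped, so that each sum is finite. Souped-up Lie algebra $\mathfrak{s}=\mathfrak{s}(\mathfrak{g},\mathfrak{a})$: $\mathfrak{a}$ is an associative commutative unital algebra ($\mathbf{1}\ne0$), $\mathfrak{g}$ a Lie algebra which is a left $\mathfrak{a}$-module, $\mathfrak{a}$ is a $\mathfrak{g}$-module on which $\mathfrak{g}$ acts by derivations, written $[g,a]=-[a,g]$ (up to super signs), and $[g,ah]=[g,a]h+a[g,h]$. $\mathfrak{s}$ is the semidirect sum Lie algebra $\mathfrak{g}\oplus\mathfrak{a}$ ($\mathfrak{a}$ abelian) together with left multiplication by $\mathfrak{a}$; its distinguished vector is $\mathbf{1}\in\mathfrak{a}$. (For $\mathfrak{s}(\mathfrak{g},\mathbf{C})$: $\mathfrak{a}=\mathbf{C}\mathbf{1}$ acts on $\mathfrak{g}$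 by scalars and $[\mathfrak{g},\mathbf{C}]=0$.) The souped-up vertex algebra ideal $I(\mathfrak{s})\subset F(\mathfrak{s})$ is generated by the generators above (for the unital vector space underlying $\mathfrak{s}$, with the function $N(s,t)$ on $\mathfrak{s}\times\mathfrak{s}$) and by $s_0t-[s,t]$, $a_{-1}s-as$, $(ab)_{-1}x-a_{-1}(b_{-1}x)$ for $a,b\in\mathfrak{a}$, $s,t\in\mathfrak{s}$, monomials $x\in F(\mathfrak{s})$. *)

theory Defs
  imports Complex_Main "HOL-Library.Z2" "HOL-Library.Product_Plus"
begin

section \<open>Complex vector spaces and Z/2-gradings\<close>

class complex_vector = ab_group_add +
  fixes scaleC :: "complex \<Rightarrow> 'a \<Rightarrow> 'a" (infixr "*\<^sub>C" 75)
  assumes scaleC_add_right: "a *\<^sub>C (x + y) = a *\<^sub>C x + a *\<^sub>C y"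
    and scaleC_add_left: "(a + b) *\<^sub>C x = a *\<^sub>C x + b *\<^sub>C x"
    and scaleC_scaleC: "a *\<^sub>C (b *\<^sub>C x) = (a * b) *\<^sub>C x"
    and scaleC_one: "1 *\<^sub>C x = x"

global_interpretation cvec: vector_space "scaleC :: complex \<Rightarrow> 'a \<Rightarrow> 'a::complex_vector"
  by unfold_locales (fact scaleC_add_right scaleC_add_left scaleC_scaleC scaleC_one)+

instantiation complex :: complex_vector
begin
definition scaleC_complex :: "complex \<Rightarrow> complex \<Rightarrow> complex" where
  "scaleC_complex a x = a * x"
instance by standard (simp_all add: scaleC_complex_def algebra_simps)
end

instantiation prod :: (complex_vector, complex_vector) complex_vector
begin
definition scaleC_prod :: "complex \<Rightarrow> 'a \<times> 'b \<Rightarrow> 'a \<times> 'b" where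
  "scaleC_prod c x = (c *\<^sub>C fst x, c *\<^sub>C snd x)"
instance
  by standard
    (simp_all add: scaleC_prod_def scaleC_add_right scaleC_add_left scaleC_scaleC scaleC_one)
end

abbreviation clinear :: "('a::complex_vector \<Rightarrow> 'b::complex_vector) \<Rightarrow> bool" where
  "clinear \<equiv> Vector_Spaces.linear scaleC scaleC"

lemma clinear_zero: "clinear f \<Longrightarrow> f 0 = 0"
  unfolding Vector_Spaces.linear_iff by (metis add_cancel_right_right)

definition cbilinear ::
  "('a::complex_vector \<Rightarrow> 'b::complex_vector \<Rightarrow> 'c::complex_vector) \<Rightarrow> bool" where
  "cbilinear f \<longleftrightarrow> (\<forall>x. clinear (f x)) \<and> (\<forall>y. clinear (\<lambda>x. f x y))"

text \<open>Parities live in the field \<^typ>\<open>bit\<close> with two elements. A grading of a vector space is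
  given by its even part \<open>G 0\<close> and its odd part \<open>G 1\<close>, of which it is the direct sum.\<close>

definition super_grading :: "(bit \<Rightarrow> 'v::complex_vector set) \<Rightarrow> bool" where
  "super_grading G \<longleftrightarrow>
     (\<forall>p. cvec.subspace (G p)) \<and> (\<forall>x. \<exists>!y. y \<in> G 0 \<and> x - y \<in> G 1)"

definition component :: "(bit \<Rightarrow> 'v::complex_vector set) \<Rightarrow> bit \<Rightarrow> 'v \<Rightarrow> 'v" where
  "component G p x = (THE y. y \<in> G p \<and> x - y \<in> G (p + 1))"

text \<open>The sign \<open>(-1)\<^bsup>pq\<^esup>\<close>.\<close>

definition koszul :: "bit \<Rightarrow> bit \<Rightarrow> complex" where
  "koszul p q = (if p = 1 \<and> q = 1 then -1 else 1)"

definition even_map ::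
  "(bit \<Rightarrow> 'a set) \<Rightarrow> (bit \<Rightarrow> 'b set) \<Rightarrow> (bit \<Rightarrow> 'c set) \<Rightarrow> ('a \<Rightarrow> 'b \<Rightarrow> 'c) \<Rightarrow> bool" where
  "even_map A B C f \<longleftrightarrow> (\<forall>p q. \<forall>x\<in>A p. \<forall>y\<in>B q. f x y \<in> C (p + q))"


section \<open>Lie superalgebras and souped-up Lie algebras\<close>

locale lie_superalgebra =
  fixes G :: "bit \<Rightarrow> 'g::complex_vector set" and br :: "'g \<Rightarrow> 'g \<Rightarrow> 'g"
  assumes grading: "super_grading G"
    and bilinear: "cbilinear br"
    and even: "even_map G G G br"
    and skew: "x \<in> G p \<Longrightarrow> y \<in> G q \<Longrightarrow> br x y = - koszul p q *\<^sub>C br y x"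
    and jacobi: "x \<in> G p \<Longrightarrow> y \<in> G q \<Longrightarrow> z \<in> G r \<Longrightarrow>
      br x (br y z) = br (br x y) z + koszul p q *\<^sub>C br y (br x z)"

text \<open>The data of a souped-up Lie algebra: the Lie superalgebra \<open>\<gg>\<close>, the commutative
  superalgebra \<open>\<aa>\<close>, the module structure \<open>\<aa> \<times> \<gg> \<rightarrow> \<gg>\<close>, and the action
  \<open>\<gg> \<times> \<aa> \<rightarrow> \<aa>\<close> by derivations.\<close>

record ('g, 'a) souped_up =
  g_part :: "bit \<Rightarrow> 'g set"
  g_br :: "'g \<Rightarrow> 'g \<Rightarrow> 'g"
  a_part :: "bit \<Rightarrow> 'a set"
  a_mult :: "'a \<Rightarrow> 'a \<Rightarrow> 'a"
  a_one :: 'a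
  a_act :: "'a \<Rightarrow> 'g \<Rightarrow> 'g"
  g_act :: "'g \<Rightarrow> 'a \<Rightarrow> 'a"

locale souped_up_lie_algebra =
  fixes S :: "('g::complex_vector, 'a::complex_vector) souped_up"
  assumes g_lie: "lie_superalgebra (g_part S) (g_br S)"
    and a_grading: "super_grading (a_part S)"
    and a_bilinear: "cbilinear (a_mult S)"
    and a_even: "even_map (a_part S) (a_part S) (a_part S) (a_mult S)"
    and a_assoc: "a_mult S (a_mult S a b) c = a_mult S a (a_mult S b c)"
    and a_commute: "a \<in> a_part S p \<Longrightarrow> b \<in> a_part S q \<Longrightarrow>
      a_mult S a b = koszul p q *\<^sub>C a_mult S b a"
    and a_one_even: "a_one S \<in> a_part S 0"
    and a_one_nonzero: "a_one S \<noteq> 0"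
    and a_unit: "a_mult S (a_one S) a = a"
    and act_bilinear: "cbilinear (a_act S)"
    and act_even: "even_map (a_part S) (g_part S) (g_part S) (a_act S)"
    and act_mult: "a_act S (a_mult S a b) g = a_act S a (a_act S b g)"
    and act_unit: "a_act S (a_one S) g = g"
    and der_bilinear: "cbilinear (g_act S)"
    and der_even: "even_map (g_part S) (a_part S) (a_part S) (g_act S)"
    and der_bracket: "g \<in> g_part S p \<Longrightarrow> h \<in> g_part S q \<Longrightarrow>
      g_act S (g_br S g h) a = g_act S g (g_act S h a) - koszul p q *\<^sub>C g_act S h (g_act S g a)"
    and der_mult: "g \<in> g_part S p \<Longrightarrow> a \<in> a_part S q \<Longrightarrow>
      g_act S g (a_mult S a b) =
        a_mult S (g_act S g a) b + koszul p q *\<^sub>C a_mult S a (g_act S g b)"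
    and br_act: "g \<in> g_part S p \<Longrightarrow> a \<in> a_part S q \<Longrightarrow>
      g_br S g (a_act S a h) =
        a_act S (g_act S g a) h + koszul p q *\<^sub>C a_act S a (g_br S g h)"

text \<open>The underlying space of \<open>\<ss> = \<gg> \<oplus> \<aa>\<close> is the product type.\<close>

definition s_part :: "('g, 'a) souped_up \<Rightarrow> bit \<Rightarrow> ('g \<times> 'a) set" where
  "s_part S p = g_part S p \<times> a_part S p"

definition s_one :: "('g::zero, 'a) souped_up \<Rightarrow> 'g \<times> 'a" where
  "s_one S = (0, a_one S)"

text \<open>\<open>[a, h] = - (-1)\<^bsup>p(a)p(h)\<^esup> [h, a]\<close> for homogeneous \<open>a \<in> \<aa>\<close> and \<open>h \<in> \<gg>\<close>, extended
  bilinearly.\<close>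

definition a_br_g ::
  "('g::complex_vector, 'a::complex_vector) souped_up \<Rightarrow> 'a \<Rightarrow> 'g \<Rightarrow> 'a" where
  "a_br_g S a h = - (\<Sum>p\<in>{0,1}. \<Sum>q\<in>{0,1}.
     koszul p q *\<^sub>C g_act S (component (g_part S) q h) (component (a_part S) p a))"

definition s_br :: "('g::complex_vector, 'a::complex_vector) souped_up
    \<Rightarrow> 'g \<times> 'a \<Rightarrow> 'g \<times> 'a \<Rightarrow> 'g \<times> 'a" where
  "s_br S s t = (g_br S (fst s) (fst t), g_act S (fst s) (snd t) + a_br_g S (snd s) (fst t))"

definition s_act :: "('g, 'a) souped_up \<Rightarrow> 'a \<Rightarrow> 'g \<times> 'a \<Rightarrow> 'g \<times> 'a" where
  "s_act S a s = (a_act S a (fst s), a_mult S a (snd s))"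

text \<open>The data of \<open>\<ss>(\<gg>, \<complex>)\<close>.\<close>

definition souped_up_const ::
  "(bit \<Rightarrow> 'g::complex_vector set) \<Rightarrow> ('g \<Rightarrow> 'g \<Rightarrow> 'g) \<Rightarrow> ('g, complex) souped_up" where
  "souped_up_const G br =
     \<lparr> g_part = G, g_br = br,
       a_part = (\<lambda>p. if p = 0 then UNIV else {0}), a_mult = (*), a_one = 1,
       a_act = (\<lambda>c g. c *\<^sub>C g), g_act = (\<lambda>g c. 0) \<rparr>"

lemma souped_up_const_souped_up:
  assumes "lie_superalgebra G br"
  shows "souped_up_lie_algebra (souped_up_const G br)"
proof -
  have gr: "cvec.subspace (G p)" for p
    using lie_superalgebra.grading[OF assms] by (simp add: super_grading_def)
  have b: "br g (c *\<^sub>C x) = c *\<^sub>C br g x" for g c x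
    using lie_superalgebra.bilinear[OF assms]
    by (simp add: cbilinear_def Vector_Spaces.linear_iff)
  have gr': "super_grading (\<lambda>p::bit. if p = 0 then UNIV else {0::complex})"
    unfolding super_grading_def by (auto simp: cvec.subspace_def)
  have bil: "cbilinear ((*) :: complex \<Rightarrow> complex \<Rightarrow> complex)"
    "cbilinear (\<lambda>(c::complex) (g::'a). c *\<^sub>C g)" "cbilinear (\<lambda>(g::'a) (c::complex). 0::complex)"
    unfolding cbilinear_def Vector_Spaces.linear_iff
    by (simp_all add: cvec.vector_space_axioms scaleC_complex_def distrib_left distrib_right
        scaleC_add_right scaleC_add_left scaleC_scaleC mult.left_commute mult.commute)
  show ?thesis
    by (rule souped_up_lie_algebra.intro)
      (auto simp: souped_up_const_def assms gr' bil b even_map_def koszul_def scaleC_complex_def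
        scaleC_scaleC scaleC_one cvec.subspace_scale[OF gr] cvec.subspace_0[OF gr] split: if_splits)
qed


section \<open>The free nonassociative algebra with products indexed by the integers\<close>

text \<open>\<open>F(\<vv>)\<close> is the set of terms in the operations of a vector space and in the products,
  modulo the congruence generated by the vector space axioms, bilinearity of the products,
  and linearity of the inclusion of \<open>\<vv>\<close>.\<close>

datatype 'v fterm =
    Gen 'v
  | Zero
  | Plus "'v fterm" "'v fterm"
  | Scale complex "'v fterm"
  | Prod "'v fterm" int "'v fterm"

inductive feq :: "'v::complex_vector fterm \<Rightarrow> 'v fterm \<Rightarrow> bool" where
  refl: "feq s s"
| sym: "feq s t \<Longrightarrow> feq t s"
| trans: "feq s t \<Longrightarrow> feq t u \<Longrightarrow> feq s u"
| Plus_cong: "feq s s' \<Longrightarrow> feq t t' \<Longrightarrow> feq (Plus s t) (Plus s' t')"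
| Scale_cong: "feq s s' \<Longrightarrow> feq (Scale c s) (Scale c s')"
| Prod_cong: "feq s s' \<Longrightarrow> feq t t' \<Longrightarrow> feq (Prod s n t) (Prod s' n t')"
| Plus_assoc: "feq (Plus (Plus s t) u) (Plus s (Plus t u))"
| Plus_commute: "feq (Plus s t) (Plus t s)"
| Plus_Zero: "feq (Plus Zero s) s"
| Plus_minus: "feq (Plus (Scale (-1) s) s) Zero"
| Scale_Plus: "feq (Scale c (Plus s t)) (Plus (Scale c s) (Scale c t))"
| Scale_add: "feq (Scale (c + d) s) (Plus (Scale c s) (Scale d s))"
| Scale_Scale: "feq (Scale c (Scale d s)) (Scale (c * d) s)"
| Scale_one: "feq (Scale 1 s) s"
| Prod_Plus_left: "feq (Prod (Plus s t) n u) (Plus (Prod s n u) (Prod t n u))"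
| Prod_Plus_right: "feq (Prod u n (Plus s t)) (Plus (Prod u n s) (Prod u n t))"
| Prod_Scale_left: "feq (Prod (Scale c s) n u) (Scale c (Prod s n u))"
| Prod_Scale_right: "feq (Prod u n (Scale c s)) (Scale c (Prod u n s))"
| Gen_add: "feq (Gen (v + w)) (Plus (Gen v) (Gen w))"
| Gen_scale: "feq (Gen (c *\<^sub>C v)) (Scale c (Gen v))"

quotient_type (overloaded) 'v free_alg = "'v::complex_vector fterm" / feq
  by (intro equivpI reflpI sympI transpI) (blast intro: feq.intros)+

instantiation free_alg :: (complex_vector) complex_vector
begin
lift_definition zero_free_alg :: "'a free_alg" is Zero .
lift_definition plus_free_alg :: "'a free_alg \<Rightarrow> 'a free_alg \<Rightarrow> 'a free_alg" is Plus
  by (rule feq.Plus_cong)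
lift_definition scaleC_free_alg :: "complex \<Rightarrow> 'a free_alg \<Rightarrow> 'a free_alg" is Scale
  by (rule feq.Scale_cong)
definition uminus_free_alg :: "'a free_alg \<Rightarrow> 'a free_alg" where
  "uminus_free_alg x = (-1) *\<^sub>C x"
definition minus_free_alg :: "'a free_alg \<Rightarrow> 'a free_alg \<Rightarrow> 'a free_alg" where
  "minus_free_alg x y = x + (-1) *\<^sub>C y"
instance
proof
  fix x y z :: "'a free_alg" and a b :: complex
  show "x + y + z = x + (y + z)" by transfer (rule feq.Plus_assoc)
  show "x + y = y + x" by transfer (rule feq.Plus_commute)
  show "0 + x = x" by transfer (rule feq.Plus_Zero)
  show "- x + x = 0" unfolding uminus_free_alg_def by transfer (rule feq.Plus_minus)
  show "x - y = x + - y" by (simp add: uminus_free_alg_def minus_free_alg_def)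
  show "a *\<^sub>C (x + y) = a *\<^sub>C x + a *\<^sub>C y" by transfer (rule feq.Scale_Plus)
  show "(a + b) *\<^sub>C x = a *\<^sub>C x + b *\<^sub>C x" by transfer (rule feq.Scale_add)
  show "a *\<^sub>C b *\<^sub>C x = (a * b) *\<^sub>C x" by transfer (rule feq.Scale_Scale)
  show "1 *\<^sub>C x = x" by transfer (rule feq.Scale_one)
qed
end

lift_definition gen :: "'v::complex_vector \<Rightarrow> 'v free_alg" is Gen .

lift_definition fmult :: "'v::complex_vector free_alg \<Rightarrow> int \<Rightarrow> 'v free_alg \<Rightarrow> 'v free_alg"
    ("_ \<star>\<^bsub>_\<^esub> _" [76, 0, 76] 75) is Prod
  by (rule feq.Prod_cong)

lemma clinear_gen: "clinear gen"
  unfolding Vector_Spaces.linear_iff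
  by (intro conjI allI cvec.vector_space_axioms; transfer; rule feq.intros)

lemma cbilinear_fmult: "cbilinear (\<lambda>x y. x \<star>\<^bsub>n\<^esub> y)"
  unfolding cbilinear_def Vector_Spaces.linear_iff
  by (intro conjI allI cvec.vector_space_axioms; transfer; rule feq.intros)

primrec eval_fterm :: "('v \<Rightarrow> 'w::complex_vector) \<Rightarrow> ('w \<Rightarrow> int \<Rightarrow> 'w \<Rightarrow> 'w) \<Rightarrow> 'v fterm \<Rightarrow> 'w"
  where
  "eval_fterm f m (Gen v) = f v"
| "eval_fterm f m Zero = 0"
| "eval_fterm f m (Plus s t) = eval_fterm f m s + eval_fterm f m t"
| "eval_fterm f m (Scale c s) = c *\<^sub>C eval_fterm f m s"
| "eval_fterm f m (Prod s n t) = m (eval_fterm f m s) n (eval_fterm f m t)"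

lemma eval_fterm_feq:
  assumes "feq s t" "clinear f" "\<And>n. cbilinear (\<lambda>x y. m x n y)"
  shows "eval_fterm f m s = eval_fterm f m t"
  using assms
  by (induction rule: feq.induct)
    (simp_all add: cbilinear_def Vector_Spaces.linear_iff scaleC_add_right scaleC_add_left
      scaleC_scaleC scaleC_one add_ac)

theorem free_alg_universal:
  fixes f :: "'v::complex_vector \<Rightarrow> 'w::complex_vector"
  assumes f: "clinear f" and m: "\<And>n. cbilinear (\<lambda>x y. m x n y)"
  shows "\<exists>!\<phi>. clinear \<phi> \<and> (\<forall>v. \<phi> (gen v) = f v) \<and> (\<forall>x n y. \<phi> (x \<star>\<^bsub>n\<^esub> y) = m (\<phi> x) n (\<phi> y))"
proof (rule ex_ex1I)
  define \<phi> where "\<phi> x = eval_fterm f m (rep_free_alg x)" for x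
  have abs: "\<phi> (abs_free_alg t) = eval_fterm f m t" for t
    unfolding \<phi>_def
    by (rule eval_fterm_feq[OF _ f m]) (rule rep_abs_rsp_left[OF Quotient3_free_alg feq.refl])
  have "\<phi> (x + y) = \<phi> x + \<phi> y" for x y
    by (induct x rule: free_alg.abs_induct, induct y rule: free_alg.abs_induct)
      (simp only: abs plus_free_alg.abs_eq eval_fterm.simps)
  moreover have "\<phi> (c *\<^sub>C x) = c *\<^sub>C \<phi> x" for c x
    by (induct x rule: free_alg.abs_induct) (simp only: abs scaleC_free_alg.abs_eq eval_fterm.simps)
  moreover have "\<phi> (gen v) = f v" for v
    by (simp only: abs gen.abs_eq eval_fterm.simps)
  moreover have "\<phi> (x \<star>\<^bsub>n\<^esub> y) = m (\<phi> x) n (\<phi> y)" for x n y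
    by (induct x rule: free_alg.abs_induct, induct y rule: free_alg.abs_induct)
      (simp only: abs fmult.abs_eq eval_fterm.simps)
  ultimately show "\<exists>\<phi>. clinear \<phi> \<and> (\<forall>v. \<phi> (gen v) = f v) \<and>
      (\<forall>x n y. \<phi> (x \<star>\<^bsub>n\<^esub> y) = m (\<phi> x) n (\<phi> y))"
    by (intro exI[of _ \<phi>]) (simp add: Vector_Spaces.linear_iff cvec.vector_space_axioms)
next
  fix \<phi> \<psi>
  assume \<phi>: "clinear \<phi> \<and> (\<forall>v. \<phi> (gen v) = f v) \<and> (\<forall>x n y. \<phi> (x \<star>\<^bsub>n\<^esub> y) = m (\<phi> x) n (\<phi> y))"
    and \<psi>: "clinear \<psi> \<and> (\<forall>v. \<psi> (gen v) = f v) \<and> (\<forall>x n y. \<psi> (x \<star>\<^bsub>n\<^esub> y) = m (\<psi> x) n (\<psi> y))"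
  have lin: "\<phi> 0 = \<psi> 0" "\<phi> (x + y) = \<phi> x + \<phi> y" "\<psi> (x + y) = \<psi> x + \<psi> y"
    "\<phi> (c *\<^sub>C x) = c *\<^sub>C \<phi> x" "\<psi> (c *\<^sub>C x) = c *\<^sub>C \<psi> x" for x y c
    using \<phi> \<psi> clinear_zero[of \<phi>] clinear_zero[of \<psi>]
    by (simp_all add: Vector_Spaces.linear_iff)
  have "\<phi> (abs_free_alg t) = \<psi> (abs_free_alg t)" for t
    by (induction t)
      (simp_all only: lin \<phi> \<psi> gen.abs_eq[symmetric] zero_free_alg.abs_eq[symmetric]
        plus_free_alg.abs_eq[symmetric] scaleC_free_alg.abs_eq[symmetric] fmult.abs_eq[symmetric])
  then show "\<phi> = \<psi>"
    by (intro ext) (rule free_alg.abs_induct[where P = "\<lambda>x. \<phi> x = \<psi> x"], blast)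
qed

lemma inj_gen: "inj (gen :: 'v::complex_vector \<Rightarrow> 'v free_alg)"
proof -
  have "\<exists>!\<phi>::'v free_alg \<Rightarrow> 'v. clinear \<phi> \<and> (\<forall>v. \<phi> (gen v) = v) \<and> (\<forall>x n y. \<phi> (x \<star>\<^bsub>n\<^esub> y) = 0)"
    by (rule free_alg_universal)
      (simp_all add: cbilinear_def Vector_Spaces.linear_iff cvec.vector_space_axioms)
  then obtain \<phi> :: "'v free_alg \<Rightarrow> 'v" where "\<And>v. \<phi> (gen v) = v"
    by blast
  then show ?thesis
    by (rule inj_on_inverseI)
qed

text \<open>The grading of \<open>F(\<vv>)\<close> induced by a grading of \<open>\<vv>\<close>, with \<open>p(x\<^sub>ny) = p(x) + p(y)\<close>.\<close>

inductive has_parity :: "(bit \<Rightarrow> 'v::complex_vector set) \<Rightarrow> bit \<Rightarrow> 'v free_alg \<Rightarrow> bool"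
  for G :: "bit \<Rightarrow> 'v set" where
  gen: "v \<in> G p \<Longrightarrow> has_parity G p (gen v)"
| mult: "has_parity G p x \<Longrightarrow> has_parity G q y \<Longrightarrow> has_parity G (p + q) (x \<star>\<^bsub>n\<^esub> y)"
| zero: "has_parity G p 0"
| add: "has_parity G p x \<Longrightarrow> has_parity G p y \<Longrightarrow> has_parity G p (x + y)"
| scale: "has_parity G p x \<Longrightarrow> has_parity G p (c *\<^sub>C x)"

inductive is_monomial :: "'v::complex_vector free_alg \<Rightarrow> bool" where
  gen: "is_monomial (gen v)"
| mult: "is_monomial x \<Longrightarrow> is_monomial y \<Longrightarrow> is_monomial (x \<star>\<^bsub>n\<^esub> y)"


section \<open>Vertex algebra ideals\<close>

definition transl :: "'v::complex_vector \<Rightarrow> 'v free_alg \<Rightarrow> 'v free_alg" where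
  "transl e x = x \<star>\<^bsub>-2\<^esub> gen e"

text \<open>The indices that are \<open>-1\<close> or large, where large means at least \<open>M\<close>.\<close>

definition idx :: "int \<Rightarrow> int set" where
  "idx M = insert (-1) {M..}"

text \<open>The ideal generated by the relations of a vertex algebra and a further set \<open>R\<close> of generators.
  In \<open>skew\<close> and \<open>assoc\<close>, the sum over all \<open>k \<ge> 0\<close> may be truncated at \<open>K\<close> once the
  inner products \<open>y\<^sub>n\<^sub>+\<^sub>kx\<close>, respectively \<open>y\<^sub>n\<^sub>+\<^sub>kz\<close> and \<open>x\<^sub>kz\<close>, with \<open>k \<ge> K\<close>
  are already known to be in the ideal; the omitted terms are then in the ideal as well. These
  premises are positive, so the least such ideal exists.\<close>

inductive_set vertex_ideal ::
    "(bit \<Rightarrow> 'v::complex_vector set) \<Rightarrow> 'v \<Rightarrow> ('v \<Rightarrow> 'v \<Rightarrow> nat) \<Rightarrow> int \<Rightarrow> 'v free_alg set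
      \<Rightarrow> 'v free_alg set"
  for G :: "bit \<Rightarrow> 'v set" and e :: 'v and N :: "'v \<Rightarrow> 'v \<Rightarrow> nat" and M :: int
    and R :: "'v free_alg set" where
  zero: "0 \<in> vertex_ideal G e N M R"
| add: "x \<in> vertex_ideal G e N M R \<Longrightarrow> y \<in> vertex_ideal G e N M R \<Longrightarrow>
    x + y \<in> vertex_ideal G e N M R"
| scale: "x \<in> vertex_ideal G e N M R \<Longrightarrow> c *\<^sub>C x \<in> vertex_ideal G e N M R"
| mult_left: "x \<in> vertex_ideal G e N M R \<Longrightarrow> y \<star>\<^bsub>n\<^esub> x \<in> vertex_ideal G e N M R"
| mult_right: "x \<in> vertex_ideal G e N M R \<Longrightarrow> x \<star>\<^bsub>n\<^esub> y \<in> vertex_ideal G e N M R"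
| unit: "n \<in> idx M \<Longrightarrow> has_parity G p x \<Longrightarrow>
    gen e \<star>\<^bsub>n\<^esub> x - (if n = -1 then x else 0) \<in> vertex_ideal G e N M R"
| bound: "n \<ge> int (N u v) \<Longrightarrow> gen u \<star>\<^bsub>n\<^esub> gen v \<in> vertex_ideal G e N M R"
| transl_mult: "n \<in> idx M \<Longrightarrow> has_parity G p x \<Longrightarrow> has_parity G q y \<Longrightarrow>
    transl e (x \<star>\<^bsub>n\<^esub> y) - transl e x \<star>\<^bsub>n\<^esub> y - x \<star>\<^bsub>n\<^esub> transl e y \<in> vertex_ideal G e N M R"
| transl_left: "has_parity G p x \<Longrightarrow> has_parity G q y \<Longrightarrow>
    transl e x \<star>\<^bsub>n\<^esub> y + of_int n *\<^sub>C (x \<star>\<^bsub>n - 1\<^esub> y) \<in> vertex_ideal G e N M R"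
| skew: "n \<in> idx M \<Longrightarrow> has_parity G p x \<Longrightarrow> has_parity G q y \<Longrightarrow>
    (\<And>k. k \<ge> K \<Longrightarrow> y \<star>\<^bsub>n + int k\<^esub> x \<in> vertex_ideal G e N M R) \<Longrightarrow>
    x \<star>\<^bsub>n\<^esub> y + koszul p q *\<^sub>C
      (\<Sum>k<K. ((-1) powi (n + int k) / fact k) *\<^sub>C (transl e ^^ k) (y \<star>\<^bsub>n + int k\<^esub> x))
    \<in> vertex_ideal G e N M R"
| assoc: "m \<in> idx M \<Longrightarrow> n \<in> idx M \<Longrightarrow>
    has_parity G p x \<Longrightarrow> has_parity G q y \<Longrightarrow> has_parity G r z \<Longrightarrow>
    (\<And>k. k \<ge> K \<Longrightarrow> y \<star>\<^bsub>n + int k\<^esub> z \<in> vertex_ideal G e N M R) \<Longrightarrow>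
    (\<And>k. k \<ge> K \<Longrightarrow> x \<star>\<^bsub>int k\<^esub> z \<in> vertex_ideal G e N M R) \<Longrightarrow>
    (x \<star>\<^bsub>m\<^esub> y) \<star>\<^bsub>n\<^esub> z - (\<Sum>k<K. ((of_int m gchoose k) * (-1) ^ k) *\<^sub>C
      (x \<star>\<^bsub>m - int k\<^esub> (y \<star>\<^bsub>n + int k\<^esub> z)
       - ((-1) powi m * koszul p q) *\<^sub>C (y \<star>\<^bsub>m + n - int k\<^esub> (x \<star>\<^bsub>int k\<^esub> z))))
    \<in> vertex_ideal G e N M R"
| extra: "x \<in> R \<Longrightarrow> x \<in> vertex_ideal G e N M R"

definition souped_up_relations ::
  "('g::complex_vector, 'a::complex_vector) souped_up \<Rightarrow> ('g \<times> 'a) free_alg set" where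
  "souped_up_relations S =
     {gen s \<star>\<^bsub>0\<^esub> gen t - gen (s_br S s t) | s t. True} \<union>
     {gen (0, a) \<star>\<^bsub>-1\<^esub> gen s - gen (s_act S a s) | a s. True} \<union>
     {gen (0, a_mult S a b) \<star>\<^bsub>-1\<^esub> x - gen (0, a) \<star>\<^bsub>-1\<^esub> (gen (0, b) \<star>\<^bsub>-1\<^esub> x) | a b x. is_monomial x}"

definition souped_up_ideal ::
  "('g::complex_vector, 'a::complex_vector) souped_up \<Rightarrow> ('g \<times> 'a \<Rightarrow> 'g \<times> 'a \<Rightarrow> nat) \<Rightarrow> int
    \<Rightarrow> ('g \<times> 'a) free_alg set" where
  "souped_up_ideal S N M = vertex_ideal (s_part S) (s_one S) N M (souped_up_relations S)"

text \<open>The class of \<open>x\<close> in the quotient of \<open>F(\<vv>)\<close> by the subspace \<open>I\<close>.\<close>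

definition quot_class :: "'v::complex_vector free_alg set \<Rightarrow> 'v free_alg \<Rightarrow> 'v free_alg set" where
  "quot_class I x = {y. y - x \<in> I}"

end

theory Submission
  imports Defs "HOL-Library.Function_Algebras" "HOL-Library.Groups_Big_Fun"
begin

text \<open>
  The ideal vanishes on \<open>\<ss>\<close> because \<open>F(\<ss>)\<close> maps to a vertex algebra into which \<open>\<ss>\<close>
  injects: the vertex algebra of the current algebra \<open>\<gg>[t, t\<^sup>-\<^sup>1]\<close> at level zero. There
  \<open>x \<in> \<gg>\<close> acts as a current with modes \<open>x\<^sub>n = x t\<^sup>n\<close> satisfying
  \<open>[x\<^sub>m, y\<^sub>n] = [x, y]\<^sub>m\<^sub>+\<^sub>n\<close>, which says exactly that \<open>x\<^sub>0y = [x, y]\<close> and \<open>x\<^sub>ny = 0\<close>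
  for \<open>n \<ge> 1\<close>. Two things have to be shown.

  The first is that such a module exists in which \<open>x\<close> can be recovered from the action of \<open>x\<^sub>-\<^sub>1\<close> on
  the vacuum. It is generated by one functional on words in the \<open>x\<^sub>n\<close> that respects all relations,
  the correlation function, and this has an explicit recursion (\<open>correlator\<close>, with \<open>correlator_laws\<close>): at level
  zero a mode \<open>x\<^sub>n\<close> with \<open>n \<ge> 0\<close> acts on the rest of the word as the derivation \<open>ad (x t\<^sup>n)\<close>, since it
  kills the vacuum, and a mode with \<open>n < 0\<close> contributes only in the one-letter word \<open>x\<^sub>-\<^sub>1\<close>. The
  functional takes values in \<open>\<gg> \<oplus> \<complex>\<close>, its value at \<open>x\<^sub>-\<^sub>1\<close> is \<open>x\<close>, and its value at the empty word
  is \<open>1\<close>. Its right translates by words span the module (\<open>vacuum_module\<close>).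

  The second is that the mutually local fields on such a module form a vertex algebra. Fields are
  multiplied by the usual \<open>n\<close>-th product, and \<open>F(\<ss>)\<close> is mapped to fields by its universal
  property. Everything rests on the family \<open>ope\<close> of residues of \<open>(x - y)\<^sup>n\<close> times the commutator of two fields, expanded in the two
  domains \<open>|x| > |y|\<close> and \<open>|y| > |x|\<close>: locality is its vanishing for large \<open>n\<close>, the \<open>n\<close>-th product
  is its value at \<open>p = 0\<close>, and raising \<open>n\<close> is a difference operator. Dong's lemma
  (\<open>dongs_lemma\<close>) keeps all images of homogeneous elements mutually local. Skew symmetry then holds as
  an identity of modes. The associativity relation is reduced to the vacuum, on which a field
  that is local to the currents vanishes only if it vanishes on \<open>vacuum_module\<close>
  (\<open>annihilates_vacuum_module\<close>); applied to the vacuum, the mode \<open>-1\<close> of the relation is the definition of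
  the product, and the derivation \<open>D\<close> yields the other modes (\<open>associator_vacuum\<close>).
\<close>

section \<open>Expanding powers of a difference\<close>

lemmas clinear_iff = Vector_Spaces.linear_iff

lemma clinearI:
  fixes f :: "'a::complex_vector \<Rightarrow> 'b::complex_vector"
  assumes "\<And>x y. f (x + y) = f x + f y" "\<And>c x. f (c *\<^sub>C x) = c *\<^sub>C f x"
  shows "clinear f"
  using assms by (simp add: clinear_iff cvec.vector_space_axioms)

text \<open>The coefficients of \<open>(x - y)\<^sup>n = \<Sum>\<^sub>j alt_binomial n j x\<^sup>n\<^sup>-\<^sup>j y\<^sup>j\<close>.\<close>

definition alt_binomial :: "int \<Rightarrow> nat \<Rightarrow> complex" where
  "alt_binomial n j = (of_int n gchoose j) * (-1) ^ j"

lemma alt_binomial_0 [simp]: "alt_binomial n 0 = 1"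
  by (simp add: alt_binomial_def)

lemma alt_binomial_0_left: "alt_binomial 0 j = (if j = 0 then 1 else 0)"
  by (simp add: alt_binomial_def gbinomial_0_left)

lemma alt_binomial_Suc: "alt_binomial (n + 1) (Suc j) = alt_binomial n (Suc j) - alt_binomial n j"
  using gbinomial_Suc_Suc[of "of_int n :: complex" j]
  by (simp add: alt_binomial_def algebra_simps)

lemma alt_binomial_absorb: "of_nat (Suc j) * alt_binomial n (Suc j) = - (of_int n * alt_binomial (n - 1) j)"
proof -
  have "of_nat (Suc j) * alt_binomial n (Suc j) = - (of_nat (Suc j) * (of_int n gchoose Suc j)) * (-1) ^ j"
    by (simp add: alt_binomial_def)
  then show ?thesis unfolding gbinomial_absorption by (simp add: alt_binomial_def)
qed

lemma alt_binomial_absorb_comp: "(of_int n - of_nat j) * alt_binomial n j = of_int n * alt_binomial (n - 1) j"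
proof -
  have "(of_int n - of_nat j) * alt_binomial n j = ((of_int n - of_nat j) * (of_int n gchoose j)) * (-1) ^ j"
    by (simp add: alt_binomial_def)
  then show ?thesis unfolding gbinomial_absorb_comp by (simp add: alt_binomial_def)
qed

lemma alt_binomial_nonneg_eq_0: "0 \<le> n \<Longrightarrow> n < int j \<Longrightarrow> alt_binomial n j = 0"
  using binomial_gbinomial[of "nat n" j, where 'a = complex]
  by (simp add: alt_binomial_def binomial_eq_0 nat_less_iff)

lemma alt_binomial_minus_1: "alt_binomial (-1) j = 1"
proof (induction j)
  case (Suc j)
  then show ?case using alt_binomial_Suc[of "-1" j] by (simp add: alt_binomial_0_left)
qed simp

lemma alt_binomial_minus_2: "alt_binomial (-2) j = of_nat (Suc j)"
proof (induction j)
  case (Suc j)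
  then show ?case using alt_binomial_Suc[of "-2" j] by (simp add: alt_binomial_minus_1 algebra_simps)
qed simp

text \<open>Two-variable families that vanish once the second index is large, whatever the first is. This
  uniformity makes the expansions below finite sums, and products of modes applied to a fixed
  vector have it.\<close>

definition upper_bounded :: "(int \<Rightarrow> int \<Rightarrow> 'v::zero) \<Rightarrow> bool" where
  "upper_bounded f \<longleftrightarrow> (\<exists>Q. \<forall>p. \<forall>q\<ge>Q. f p q = 0)"

text \<open>If \<open>f p q\<close> is the residue of \<open>x\<^sup>p y\<^sup>q\<close> times a formal distribution in \<open>x\<close> and \<open>y\<close>, then \<open>diffpow n f\<close>
  is the family of residues of its product with \<open>(x - y)\<^sup>n\<close>, expanded in the domain \<open>|x| > |y|\<close>.
  In this convention the modes of a field are \<open>a\<^sub>p = Res x\<^sup>p a(x)\<close>.\<close>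

definition diffpow :: "int \<Rightarrow> (int \<Rightarrow> int \<Rightarrow> 'v::complex_vector) \<Rightarrow> int \<Rightarrow> int \<Rightarrow> 'v" where
  "diffpow n f p q = Sum_any (\<lambda>j. alt_binomial n j *\<^sub>C f (p + n - int j) (q + int j))"

lemma Sum_any_eq_sum:
  assumes "\<And>j::nat. j \<ge> K \<Longrightarrow> g j = 0"
  shows "Sum_any g = (\<Sum>j<K. g j)"
proof (rule Sum_any.expand_superset)
  show "{j. g j \<noteq> 0} \<subseteq> {..<K}"
  proof
    fix j assume "j \<in> {j. g j \<noteq> 0}"
    then have "\<not> K \<le> j" using assms[of j] by blast
    then show "j \<in> {..<K}" by simp
  qed
qed simp

lemma diffpow_eq_sum:
  assumes "\<And>p' q'. q + int K \<le> q' \<Longrightarrow> f p' q' = 0"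
  shows "diffpow n f p q = (\<Sum>j<K. alt_binomial n j *\<^sub>C f (p + n - int j) (q + int j))"
  unfolding diffpow_def by (rule Sum_any_eq_sum) (simp add: assms)

lemma upper_boundedE:
  assumes "upper_bounded f"
  obtains K where "\<And>p' q'. q' \<ge> q + int K \<Longrightarrow> f p' q' = 0"
proof -
  obtain Q where Q: "\<forall>p. \<forall>q\<ge>Q. f p q = 0"
    using assms unfolding upper_bounded_def by blast
  show thesis
  proof (rule that[of "nat (Q - q)"])
    fix p' q' assume "q + int (nat (Q - q)) \<le> q'"
    then have "Q \<le> q'" by linarith
    then show "f p' q' = 0" using Q by blast
  qed
qed

text \<open>Multiplication of \<open>(x - y)\<^sup>n\<close> by \<open>x - y\<close>: Pascal's rule, for negative \<open>n\<close> as well.\<close>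

lemma diffpow_step:
  assumes "upper_bounded f"
  shows "diffpow n f (p + 1) q - diffpow n f p (q + 1) = diffpow (n + 1) f p q"
proof -
  obtain K where K: "\<And>p' q'. q' \<ge> q + int K \<Longrightarrow> f p' q' = 0"
    by (rule upper_boundedE[OF assms, of q]) blast
  have 1: "diffpow n f (p + 1) q = (\<Sum>j<Suc K. alt_binomial n j *\<^sub>C f (p + 1 + n - int j) (q + int j))"
    by (rule diffpow_eq_sum) (simp add: K)
  have 2: "diffpow n f p (q + 1) = (\<Sum>j<K. alt_binomial n j *\<^sub>C f (p + n - int j) (q + 1 + int j))"
    by (rule diffpow_eq_sum) (simp add: K)
  have 3: "diffpow (n + 1) f p q = (\<Sum>j<Suc K. alt_binomial (n + 1) j *\<^sub>C f (p + (n + 1) - int j) (q + int j))"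
    by (rule diffpow_eq_sum) (simp add: K)
  show ?thesis
    unfolding 1 2 3 sum.lessThan_Suc_shift
    by (simp add: alt_binomial_Suc alt_binomial_Suc[of n, unfolded add.commute[of n]] cvec.scale_left_diff_distrib
        sum_subtractf algebra_simps)
qed

lemma diffpow_0 [simp]: "diffpow 0 f p q = f p q"
proof -
  have "diffpow 0 f p q = (\<Sum>j<1. alt_binomial 0 j *\<^sub>C f (p + 0 - int j) (q + int j))"
    unfolding diffpow_def by (rule Sum_any_eq_sum) (simp add: alt_binomial_0_left)
  then show ?thesis by (simp add: scaleC_one)
qed

lemma diffpow_additive:
  assumes "upper_bounded f" "upper_bounded g"
  shows "diffpow n (\<lambda>p q. f p q + g p q) p q = diffpow n f p q + diffpow n g p q"
proof -
  obtain K where K: "\<And>p' q'. q' \<ge> q + int K \<Longrightarrow> f p' q' = 0"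
    by (rule upper_boundedE[OF assms(1), of q]) blast
  obtain L where L: "\<And>p' q'. q' \<ge> q + int L \<Longrightarrow> g p' q' = 0"
    by (rule upper_boundedE[OF assms(2), of q]) blast
  have 1: "diffpow n f p q = (\<Sum>j<max K L. alt_binomial n j *\<^sub>C f (p + n - int j) (q + int j))"
    by (rule diffpow_eq_sum) (simp add: K)
  have 2: "diffpow n g p q = (\<Sum>j<max K L. alt_binomial n j *\<^sub>C g (p + n - int j) (q + int j))"
    by (rule diffpow_eq_sum) (simp add: L)
  have 3: "diffpow n (\<lambda>p q. f p q + g p q) p q =
      (\<Sum>j<max K L. alt_binomial n j *\<^sub>C (f (p + n - int j) (q + int j) + g (p + n - int j) (q + int j)))"
    by (rule diffpow_eq_sum) (simp add: K L)
  show ?thesis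
    unfolding 1 2 3 by (simp add: scaleC_add_right sum.distrib)
qed

lemma diffpow_linear:
  assumes "upper_bounded f" "clinear L"
  shows "L (diffpow n f p q) = diffpow n (\<lambda>p q. L (f p q)) p q"
proof -
  obtain K where K: "\<And>p' q'. q' \<ge> q + int K \<Longrightarrow> f p' q' = 0"
    by (rule upper_boundedE[OF assms(1), of q]) blast
  have 1: "diffpow n f p q = (\<Sum>j<K. alt_binomial n j *\<^sub>C f (p + n - int j) (q + int j))"
    by (rule diffpow_eq_sum) (simp add: K)
  have 2: "diffpow n (\<lambda>p q. L (f p q)) p q =
      (\<Sum>j<K. alt_binomial n j *\<^sub>C L (f (p + n - int j) (q + int j)))"
    by (rule diffpow_eq_sum) (simp add: K clinear_zero[OF assms(2)])
  interpret L: Vector_Spaces.linear scaleC scaleC L by fact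
  show ?thesis
    unfolding 1 2 by (simp add: L.sum L.scale)
qed

lemma clinear_scaleC: "clinear (\<lambda>x::'v::complex_vector. c *\<^sub>C x)"
  by (rule clinearI) (simp_all add: scaleC_add_right scaleC_scaleC mult.commute)

lemma diffpow_scale:
  assumes "upper_bounded f"
  shows "diffpow n (\<lambda>p q. c *\<^sub>C f p q) p q = c *\<^sub>C diffpow n f p q"
  using diffpow_linear[OF assms clinear_scaleC] by metis

lemma diffpow_zero [simp]: "diffpow n (\<lambda>p q. 0) p q = 0"
  unfolding diffpow_def by simp

lemma upper_bounded_add: "upper_bounded f \<Longrightarrow> upper_bounded g \<Longrightarrow> upper_bounded (\<lambda>p q. f p q + (g p q::'v::complex_vector))"
  unfolding upper_bounded_def
proof (elim exE)
  fix P Q assume "\<forall>p. \<forall>q\<ge>P. f p q = 0" "\<forall>p. \<forall>q\<ge>Q. g p q = 0"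
  then show "\<exists>Q. \<forall>p. \<forall>q\<ge>Q. f p q + g p q = 0"
    by (intro exI[of _ "max P Q"]) simp
qed

lemma upper_bounded_linear: "upper_bounded f \<Longrightarrow> (\<And>p q. L p q 0 = 0) \<Longrightarrow> upper_bounded (\<lambda>p q. L p q (f p q))"
  unfolding upper_bounded_def
proof (elim exE)
  fix Q assume *: "\<And>p q. L p q 0 = 0" "\<forall>p. \<forall>q\<ge>Q. f p q = 0"
  show "\<exists>Q. \<forall>p. \<forall>q\<ge>Q. L p q (f p q) = 0"
    by (intro exI[of _ Q] allI impI) (use * in simp)
qed

lemma upper_bounded_shift: "upper_bounded f \<Longrightarrow> upper_bounded (\<lambda>p q. f (p + i) (q + j))"
  unfolding upper_bounded_def
proof (elim exE)
  fix Q assume "\<forall>p. \<forall>q\<ge>Q. f p q = 0"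
  then show "\<exists>Q. \<forall>p. \<forall>q\<ge>Q. f (p + i) (q + j) = 0"
    by (intro exI[of _ "Q - j"]) simp
qed

lemma upper_bounded_diff:
  "upper_bounded f \<Longrightarrow> upper_bounded g \<Longrightarrow> upper_bounded (\<lambda>p q. f p q - (g p q::'v::complex_vector))"
  using upper_bounded_add[of f "\<lambda>p q. - g p q"] upper_bounded_linear[of g "\<lambda>p q x. - x"] by simp

lemma diffpow_diff:
  assumes "upper_bounded f" "upper_bounded g"
  shows "diffpow n (\<lambda>p q. f p q - g p q) p q = diffpow n f p q - diffpow n g p q"
  using diffpow_additive[OF assms(1) upper_bounded_linear[OF assms(2), of "\<lambda>p q x. (-1) *\<^sub>C x"]]
    diffpow_scale[OF assms(2), of n "-1"] by simp

lemma diffpow_shift: "diffpow n f (p + i) (q + j) = diffpow n (\<lambda>p q. f (p + i) (q + j)) p q"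
  by (simp add: diffpow_def algebra_simps)

lemma diffpow_single:
  assumes "\<And>j. j \<noteq> i \<Longrightarrow> f (p + n - int j) (q + int j) = 0"
  shows "diffpow n f p q = alt_binomial n i *\<^sub>C f (p + n - int i) (q + int i)"
proof -
  have "diffpow n f p q = (\<Sum>j\<in>{i}. alt_binomial n j *\<^sub>C f (p + n - int j) (q + int j))"
    unfolding diffpow_def by (rule Sum_any.expand_superset) (use assms in auto)
  then show ?thesis by simp
qed

lemma diffpow_vanish:
  assumes "\<And>j. f (p + n - int j) (q + int j) = 0"
  shows "diffpow n f p q = 0"
  unfolding diffpow_def by (simp add: assms)

lemma diffpow_in_subspace:
  assumes "cvec.subspace W" "\<And>p q. f p q \<in> W"
  shows "diffpow n f p q \<in> W"
  unfolding diffpow_def Sum_any.expand_set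
  by (intro cvec.subspace_sum cvec.subspace_scale assms)

text \<open>The Leibniz rule for \<open>\<partial>\<^sub>x\<close> on \<open>(x - y)\<^sup>n f\<close>, up to sign. Together with the rule for \<open>\<partial>\<^sub>y\<close> below it says that
  \<open>\<partial>\<^sub>x + \<partial>\<^sub>y\<close> commutes with \<open>(x - y)\<^sup>n\<close>, because the two terms with \<open>n - 1\<close> cancel.\<close>

lemma diffpow_deriv_left:
  assumes "upper_bounded f"
  shows "diffpow n (\<lambda>p q. of_int p *\<^sub>C f (p - 1) q) p q =
    of_int p *\<^sub>C diffpow n f (p - 1) q + of_int n *\<^sub>C diffpow (n - 1) f p q"
proof -
  obtain K where K: "\<And>p' q'. q' \<ge> q + int K \<Longrightarrow> f p' q' = 0"
    by (rule upper_boundedE[OF assms, of q]) blast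
  have 1: "diffpow n (\<lambda>p q. of_int p *\<^sub>C f (p - 1) q) p q =
     (\<Sum>j<K. alt_binomial n j *\<^sub>C of_int (p + n - int j) *\<^sub>C f (p + n - int j - 1) (q + int j))"
    by (rule diffpow_eq_sum) (simp add: K)
  have 2: "diffpow n f (p - 1) q = (\<Sum>j<K. alt_binomial n j *\<^sub>C f (p - 1 + n - int j) (q + int j))"
    by (rule diffpow_eq_sum) (simp add: K)
  have 3: "diffpow (n - 1) f p q = (\<Sum>j<K. alt_binomial (n - 1) j *\<^sub>C f (p + (n - 1) - int j) (q + int j))"
    by (rule diffpow_eq_sum) (simp add: K)
  have c: "alt_binomial n j * of_int (p + n - int j) = of_int p * alt_binomial n j + of_int n * alt_binomial (n - 1) j" for j
    using alt_binomial_absorb_comp[of n j] by (simp add: algebra_simps)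
  show ?thesis
    unfolding 1 2 3 cvec.scale_sum_right sum.distrib[symmetric]
  proof (rule sum.cong[OF HOL.refl])
    fix j
    have "p - 1 + n - int j = p + n - int j - 1" "p + (n - 1) - int j = p + n - int j - 1"
      by simp_all
    then show "alt_binomial n j *\<^sub>C of_int (p + n - int j) *\<^sub>C f (p + n - int j - 1) (q + int j) =
        of_int p *\<^sub>C alt_binomial n j *\<^sub>C f (p - 1 + n - int j) (q + int j) +
        of_int n *\<^sub>C alt_binomial (n - 1) j *\<^sub>C f (p + (n - 1) - int j) (q + int j)"
      by (simp only: scaleC_scaleC c scaleC_add_left)
  qed
qed

lemma diffpow_deriv_right:
  assumes "upper_bounded f"
  shows "diffpow n (\<lambda>p q. of_int q *\<^sub>C f p (q - 1)) p q =
    of_int q *\<^sub>C diffpow n f p (q - 1) - of_int n *\<^sub>C diffpow (n - 1) f p q"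
proof -
  obtain K where K: "\<And>p' q'. q' \<ge> (q - 1) + int K \<Longrightarrow> f p' q' = 0"
    by (rule upper_boundedE[OF assms, of "q - 1"]) blast
  have 1: "diffpow n (\<lambda>p q. of_int q *\<^sub>C f p (q - 1)) p q =
     (\<Sum>j<Suc K. alt_binomial n j *\<^sub>C of_int (q + int j) *\<^sub>C f (p + n - int j) (q + int j - 1))"
    by (rule diffpow_eq_sum) (simp add: K)
  have 2: "diffpow n f p (q - 1) = (\<Sum>j<Suc K. alt_binomial n j *\<^sub>C f (p + n - int j) (q - 1 + int j))"
    by (rule diffpow_eq_sum) (simp add: K)
  have 3: "diffpow (n - 1) f p q = (\<Sum>j<K. alt_binomial (n - 1) j *\<^sub>C f (p + (n - 1) - int j) (q + int j))"
    by (rule diffpow_eq_sum) (simp add: K)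
  have "(\<Sum>j<Suc K. (of_nat j * alt_binomial n j) *\<^sub>C f (p + n - int j) (q + int j - 1)) =
      (\<Sum>j<K. (of_nat (Suc j) * alt_binomial n (Suc j)) *\<^sub>C f (p + n - int (Suc j)) (q + int (Suc j) - 1))"
    unfolding sum.lessThan_Suc_shift by simp
  also have "\<dots> = - (of_int n *\<^sub>C diffpow (n - 1) f p q)"
    unfolding 3 cvec.scale_sum_right sum_negf[symmetric] alt_binomial_absorb
  proof (rule sum.cong[OF HOL.refl])
    fix j
    have "p + n - int (Suc j) = p + (n - 1) - int j" "q + int (Suc j) - 1 = q + int j"
      by simp_all
    then show "- (of_int n * alt_binomial (n - 1) j) *\<^sub>C f (p + n - int (Suc j)) (q + int (Suc j) - 1) =
        - (of_int n *\<^sub>C alt_binomial (n - 1) j *\<^sub>C f (p + (n - 1) - int j) (q + int j))"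
      by (simp only: scaleC_scaleC cvec.scale_minus_left)
  qed
  finally have 4: "(\<Sum>j<Suc K. (of_nat j * alt_binomial n j) *\<^sub>C f (p + n - int j) (q + int j - 1)) = \<dots>" .
  have "diffpow n (\<lambda>p q. of_int q *\<^sub>C f p (q - 1)) p q = of_int q *\<^sub>C diffpow n f p (q - 1) +
      (\<Sum>j<Suc K. (of_nat j * alt_binomial n j) *\<^sub>C f (p + n - int j) (q + int j - 1))"
    unfolding 1 2 cvec.scale_sum_right sum.distrib[symmetric]
  proof (rule sum.cong[OF HOL.refl])
    fix j
    have "q - 1 + int j = q + int j - 1"
      and "alt_binomial n j * of_int (q + int j) = of_int q * alt_binomial n j + of_nat j * alt_binomial n j"
      by (simp_all add: algebra_simps)
    then show "alt_binomial n j *\<^sub>C of_int (q + int j) *\<^sub>C f (p + n - int j) (q + int j - 1) =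
        of_int q *\<^sub>C alt_binomial n j *\<^sub>C f (p + n - int j) (q - 1 + int j) +
        (of_nat j * alt_binomial n j) *\<^sub>C f (p + n - int j) (q + int j - 1)"
      by (simp only: scaleC_scaleC scaleC_add_left)
  qed
  then show ?thesis unfolding 4 by simp
qed

section \<open>Fields and their products\<close>

text \<open>A field is given by its modes. Being a type, fields form a complex vector space on which the
  products are bilinear everywhere, as the universal property of the free algebra requires.\<close>

typedef (overloaded) 'v vfield =
  "{a :: int \<Rightarrow> 'v \<Rightarrow> 'v::complex_vector. (\<forall>n. clinear (a n)) \<and> (\<forall>v. \<exists>N. \<forall>n\<ge>N. a n v = 0)}"
  morphisms mode Abs_vfield
  by (rule exI[of _ "\<lambda>n v. 0"]) (simp add: clinear_iff cvec.vector_space_axioms)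

setup_lifting type_definition_vfield

lemma clinear_mode [simp]: "clinear (mode a n)"
  using mode[of a] by simp

lemma mode_bounded: "\<exists>N. \<forall>n\<ge>N. mode a n v = 0"
  using mode[of a] by simp

lemma mode_add [simp]: "mode a n (u + v) = mode a n u + mode a n v"
  using clinear_mode[of a n] by (simp add: clinear_iff del: clinear_mode)

lemma mode_scale [simp]: "mode a n (c *\<^sub>C v) = c *\<^sub>C mode a n v"
  using clinear_mode[of a n] by (simp add: clinear_iff del: clinear_mode)

lemma mode_zero [simp]: "mode a n 0 = 0"
  by (simp add: clinear_zero)

lemma mode_diff [simp]: "mode a n (u - v) = mode a n u - mode a n v"
  by (metis add_diff_cancel diff_add_cancel mode_add)

lemma mode_minus [simp]: "mode a n (- v) = - mode a n v"
  by (metis diff_0 mode_diff mode_zero)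

lemma vfield_eqI: "(\<And>n v. mode a n v = mode b n v) \<Longrightarrow> a = b"
  by (simp add: mode_inject[symmetric] fun_eq_iff)

instantiation vfield :: (complex_vector) complex_vector
begin
lift_definition zero_vfield :: "'a vfield" is "\<lambda>n v. 0"
  by (simp add: clinear_iff cvec.vector_space_axioms)
lift_definition plus_vfield :: "'a vfield \<Rightarrow> 'a vfield \<Rightarrow> 'a vfield" is "\<lambda>a b n v. a n v + b n v"
proof (safe, goal_cases)
  case (1 a b n)
  then show ?case by (simp add: clinear_iff scaleC_add_right)
next
  case (2 a b v)
  then obtain M N where "\<forall>n\<ge>M. a n v = 0" "\<forall>n\<ge>N. b n v = 0" by meson
  then show ?case by (intro exI[of _ "max M N"]) simp
qed
lift_definition scaleC_vfield :: "complex \<Rightarrow> 'a vfield \<Rightarrow> 'a vfield" is "\<lambda>c a n v. c *\<^sub>C a n v"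
proof (safe, goal_cases)
  case (1 c a n)
  then show ?case by (simp add: clinear_iff scaleC_add_right scaleC_scaleC mult.commute)
next
  case (2 c a v)
  then show ?case by (metis cvec.scale_zero_right)
qed
definition uminus_vfield :: "'a vfield \<Rightarrow> 'a vfield" where
  "uminus_vfield a = (-1) *\<^sub>C a"
definition minus_vfield :: "'a vfield \<Rightarrow> 'a vfield \<Rightarrow> 'a vfield" where
  "minus_vfield a b = a + (-1) *\<^sub>C b"
instance
  by standard
    (simp_all add: uminus_vfield_def minus_vfield_def mode_inject[symmetric] fun_eq_iff
      zero_vfield.rep_eq plus_vfield.rep_eq scaleC_vfield.rep_eq
      scaleC_add_right scaleC_add_left scaleC_scaleC scaleC_one)
end

lemma mode_zero_field [simp]: "mode 0 n v = 0"
  by (simp add: zero_vfield.rep_eq)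

lemma mode_add_field [simp]: "mode (a + b) n v = mode a n v + mode b n v"
  by (simp add: plus_vfield.rep_eq)

lemma mode_scale_field [simp]: "mode (c *\<^sub>C a) n v = c *\<^sub>C mode a n v"
  by (simp add: scaleC_vfield.rep_eq)

lemma mode_diff_field [simp]: "mode (a - b) n v = mode a n v - mode b n v"
  by (metis add_diff_cancel diff_add_cancel mode_add_field)

lemma mode_minus_field [simp]: "mode (- a) n v = - mode a n v"
  by (metis diff_0 mode_diff_field mode_zero_field)

lemma mode_sum_field [simp]: "mode (sum a A) n v = (\<Sum>i\<in>A. mode (a i) n v)"
  by (induction A rule: infinite_finite_induct) simp_all

lift_definition id_field :: "'v::complex_vector vfield" is "\<lambda>n v. if n = -1 then v else 0"
proof (safe, goal_cases)
  case (1 n)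
  then show ?case by (simp add: clinear_iff cvec.vector_space_axioms)
next
  case (2 v)
  then show ?case by (intro exI[of _ 0]) simp
qed

lift_definition deriv_field :: "'v::complex_vector vfield \<Rightarrow> 'v vfield"
  is "\<lambda>a n v. - (of_int n *\<^sub>C a (n - 1) v)"
proof (safe, goal_cases)
  case (1 a n)
  then show ?case by (simp add: clinear_iff scaleC_add_right scaleC_scaleC mult.commute)
next
  case (2 a v)
  then obtain N where "\<forall>n\<ge>N. a n v = 0" by meson
  then show ?case by (intro exI[of _ "N + 1"]) simp
qed

lemma mode_id [simp]: "mode id_field n v = (if n = -1 then v else 0)"
  by (simp add: id_field.rep_eq)

lemma mode_deriv [simp]: "mode (deriv_field a) n v = - (of_int n *\<^sub>C mode a (n - 1) v)"
  by (simp add: deriv_field.rep_eq)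

lemma deriv_linear:
  "deriv_field (a + b) = deriv_field a + deriv_field b"
  "deriv_field (a - b) = deriv_field a - deriv_field b"
  "deriv_field (c *\<^sub>C a) = c *\<^sub>C deriv_field a"
  by (rule vfield_eqI; simp add: scaleC_add_right cvec.scale_right_diff_distrib scaleC_scaleC mult.commute)+

lemma deriv_zero: "deriv_field 0 = 0"
  by (rule vfield_eqI) simp

lemma deriv_sum: "deriv_field (sum f A) = (\<Sum>i\<in>A. deriv_field (f i))"
  by (induction A rule: infinite_finite_induct) (simp_all add: deriv_linear deriv_zero)

lemma upper_bounded_modes [simp]: "upper_bounded (\<lambda>p q. mode a p (mode b q v))"
  using mode_bounded[of b v] unfolding upper_bounded_def by (metis mode_zero)

text \<open>The residue of \<open>x\<^sup>p y\<^sup>q (x - y)\<^sup>n\<close> times the commutator of \<open>a(x)\<close> and \<open>b(y)\<close>, where the two terms of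
  the commutator are expanded in the domains in which they make sense. The sign \<open>\<kappa>\<close> is that of the
  parities of \<open>a\<close> and \<open>b\<close>. It is a parameter, so that fields on an ungraded space can carry
  parities as formal labels.\<close>

definition ope :: "complex \<Rightarrow> 'v::complex_vector vfield \<Rightarrow> 'v vfield \<Rightarrow> int \<Rightarrow> int \<Rightarrow> int \<Rightarrow> 'v \<Rightarrow> 'v" where
  "ope \<kappa> a b n p q v = diffpow n (\<lambda>p q. mode a p (mode b q v)) p q
     - (\<kappa> * (-1) powi n) *\<^sub>C diffpow n (\<lambda>q p. mode b q (mode a p v)) q p"

lemma sgn_powi_add1: "(-1::complex) powi (n + 1) = - ((-1) powi n)"
  by (simp add: power_int_add)

lemma sgn_powi_diff1: "(-1::complex) powi (n - 1) = - ((-1) powi n)"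
  by (simp add: power_int_diff)

lemma sgn_powi_square: "(-1::complex) powi n * (-1) powi n = 1"
  by (metis mult_minus1_right power_int_minus_one_mult_self)

lemma ope_step: "ope \<kappa> a b n (p + 1) q v - ope \<kappa> a b n p (q + 1) v = ope \<kappa> a b (n + 1) p q v"
proof -
  have *: "diffpow (n + 1) (\<lambda>q p. mode b q (mode a p v)) q p =
     diffpow n (\<lambda>q p. mode b q (mode a p v)) (q + 1) p - diffpow n (\<lambda>q p. mode b q (mode a p v)) q (p + 1)"
    by (simp add: diffpow_step)
  show ?thesis
    unfolding ope_def * diffpow_step[OF upper_bounded_modes, symmetric] sgn_powi_add1
    by (simp add: algebra_simps)
qed

lemma ope_0: "ope \<kappa> a b 0 p q v = mode a p (mode b q v) - \<kappa> *\<^sub>C mode b q (mode a p v)"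
  by (simp add: ope_def)

text \<open>By \<open>ope_step\<close> vanishing at one exponent propagates upwards.\<close>

lemma ope_eq_0_above:
  assumes "\<And>p q v. ope \<kappa> a b N p q v = 0" "N \<le> n"
  shows "ope \<kappa> a b n p q v = 0"
proof -
  have "ope \<kappa> a b (N + int k) p q v = 0" for k
  proof (induction k arbitrary: p q)
    case (Suc k)
    then show ?case
      using ope_step[of \<kappa> a b "N + int k" p q v] by (simp add: algebra_simps)
  qed (simp add: assms)
  then show ?thesis
    using assms(2) by (auto simp: zle_iff_zadd)
qed

lemma clinear_ope: "clinear (ope \<kappa> a b n p q)"
  unfolding ope_def
  by (rule clinearI)
    (simp_all add: diffpow_additive diffpow_scale scaleC_add_right cvec.scale_right_diff_distrib scaleC_scaleC mult_ac)

text \<open>Only finitely many \<open>j\<close> contribute to the second term of a product, so one bound serves for all.\<close>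

lemma mode_compose_bounded: "\<exists>N. \<forall>n\<ge>N. \<forall>j<K::nat. mode b n (mode a (int j) v) = 0"
proof (induction K)
  case (Suc K)
  then obtain N where N: "\<forall>n\<ge>N. \<forall>j<K. mode b n (mode a (int j) v) = 0" by blast
  obtain N' where N': "\<forall>n\<ge>N'. mode b n (mode a (int K) v) = 0"
    using mode_bounded by blast
  show ?case
    by (rule exI[of _ "max N N'"]) (use N N' in \<open>auto simp: less_Suc_eq\<close>)
qed simp

text \<open>The residue in \<open>x\<close> of the distribution described by \<open>ope\<close>, that is, its value at \<open>p = 0\<close>.\<close>

lift_definition nprod :: "complex \<Rightarrow> 'v::complex_vector vfield \<Rightarrow> int \<Rightarrow> 'v vfield \<Rightarrow> 'v vfield"
  is "\<lambda>\<kappa> a n b m v. ope \<kappa> (Abs_vfield a) (Abs_vfield b) n 0 m v"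
proof (intro CollectI conjI allI)
  fix \<kappa> n v and a0 b0 :: "int \<Rightarrow> 'v \<Rightarrow> 'v" and m
  define a b where "a = Abs_vfield a0" and "b = Abs_vfield b0"
  show "clinear (ope \<kappa> (Abs_vfield a0) (Abs_vfield b0) n 0 m)"
    by (rule clinear_ope)
  obtain K where K: "\<And>p' q'. q' \<ge> (0::int) + int K \<Longrightarrow> mode b p' (mode a q' v) = 0"
    using upper_boundedE[OF upper_bounded_modes] by metis
  obtain L where L: "\<And>p' q'. q' \<ge> (0::int) + int L \<Longrightarrow> mode a p' (mode b q' v) = 0"
    using upper_boundedE[OF upper_bounded_modes] by metis
  obtain N where N: "\<forall>n\<ge>N. \<forall>j<K. mode b n (mode a (int j) v) = 0"
    using mode_compose_bounded by blast
  have "ope \<kappa> a b n 0 m v = 0" if "m \<ge> max (int L) (N - n + int K)" for m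
  proof -
    have "diffpow n (\<lambda>p q. mode a p (mode b q v)) 0 m = (\<Sum>j<0. alt_binomial n j *\<^sub>C mode a (0 + n - int j) (mode b (m + int j) v))"
      by (rule diffpow_eq_sum) (use that L in simp)
    moreover have "diffpow n (\<lambda>q p. mode b q (mode a p v)) m 0 = (\<Sum>j<K. alt_binomial n j *\<^sub>C mode b (m + n - int j) (mode a (0 + int j) v))"
      by (rule diffpow_eq_sum) (use K in simp)
    moreover have "mode b (m + n - int j) (mode a (0 + int j) v) = 0" if "j < K" for j
      using N that \<open>m \<ge> _\<close> by simp
    ultimately show ?thesis by (simp add: ope_def)
  qed
  then show "\<exists>N. \<forall>m\<ge>N. ope \<kappa> (Abs_vfield a0) (Abs_vfield b0) n 0 m v = 0"
    unfolding a_def b_def by blast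
qed

lemma mode_nprod: "mode (nprod \<kappa> a n b) m v = ope \<kappa> a b n 0 m v"
  by (simp add: nprod.rep_eq mode_inverse)

lemma ope_add_left: "ope \<kappa> (a + a') b n p q v = ope \<kappa> a b n p q v + ope \<kappa> a' b n p q v"
  by (simp add: ope_def diffpow_additive scaleC_add_right)

lemma ope_add_right: "ope \<kappa> a (b + b') n p q v = ope \<kappa> a b n p q v + ope \<kappa> a b' n p q v"
  by (simp add: ope_def diffpow_additive scaleC_add_right)

lemma ope_scale_left: "ope \<kappa> (c *\<^sub>C a) b n p q v = c *\<^sub>C ope \<kappa> a b n p q v"
  by (simp add: ope_def diffpow_scale cvec.scale_right_diff_distrib scaleC_scaleC mult_ac)

lemma ope_scale_right: "ope \<kappa> a (c *\<^sub>C b) n p q v = c *\<^sub>C ope \<kappa> a b n p q v"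
  by (simp add: ope_def diffpow_scale cvec.scale_right_diff_distrib scaleC_scaleC mult_ac)

lemma cbilinear_nprod: "cbilinear (\<lambda>a b. nprod \<kappa> a n b)"
  unfolding cbilinear_def
  by (intro conjI allI; rule clinearI; rule vfield_eqI)
    (simp_all add: mode_nprod ope_add_left ope_add_right ope_scale_left ope_scale_right)

lemma nprod_linear:
  "nprod \<kappa> (a + a') n b = nprod \<kappa> a n b + nprod \<kappa> a' n b"
  "nprod \<kappa> a n (b + b') = nprod \<kappa> a n b + nprod \<kappa> a n b'"
  "nprod \<kappa> (s *\<^sub>C a) n b = s *\<^sub>C nprod \<kappa> a n b"
  "nprod \<kappa> a n (s *\<^sub>C b) = s *\<^sub>C nprod \<kappa> a n b"
  using cbilinear_nprod[of \<kappa> n] unfolding cbilinear_def clinear_iff by blast+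

lemma nprod_zero [simp]: "nprod \<kappa> 0 n b = 0" "nprod \<kappa> a n 0 = 0"
  by (rule vfield_eqI, simp add: mode_nprod ope_def)+

lemma ope_deriv_left:
  "ope \<kappa> (deriv_field a) b n p q v =
    - (of_int p *\<^sub>C ope \<kappa> a b n (p - 1) q v) - of_int n *\<^sub>C ope \<kappa> a b (n - 1) p q v"
proof -
  define f where "f = (\<lambda>p q. mode a p (mode b q v))"
  define g where "g = (\<lambda>q p. mode b q (mode a p v))"
  have b: "upper_bounded f" "upper_bounded g" by (simp_all add: f_def g_def)
  have 1: "diffpow n (\<lambda>p q. mode (deriv_field a) p (mode b q v)) p q =
      - diffpow n (\<lambda>p q. of_int p *\<^sub>C f (p - 1) q) p q"
    using diffpow_scale[of "\<lambda>p q. of_int p *\<^sub>C f (p - 1) q" n "-1" p q]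
      upper_bounded_linear[OF upper_bounded_shift[OF b(1), of "-1" 0], of "\<lambda>p q x. of_int p *\<^sub>C x"]
    by (simp add: f_def)
  have 2: "diffpow n (\<lambda>q p. mode b q (mode (deriv_field a) p v)) q p =
      - diffpow n (\<lambda>q p. of_int p *\<^sub>C g q (p - 1)) q p"
    using diffpow_scale[of "\<lambda>q p. of_int p *\<^sub>C g q (p - 1)" n "-1" q p]
      upper_bounded_linear[OF upper_bounded_shift[OF b(2), of 0 "-1"], of "\<lambda>q p x. of_int p *\<^sub>C x"]
    by (simp add: g_def)
  show ?thesis
    unfolding ope_def 1 2 diffpow_deriv_left[OF b(1)] diffpow_deriv_right[OF b(2)]
      f_def[symmetric] g_def[symmetric] sgn_powi_diff1
    by (simp add: cvec.scale_right_diff_distrib scaleC_add_right scaleC_scaleC mult_ac)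
qed

lemma ope_deriv_right:
  "ope \<kappa> a (deriv_field b) n p q v =
    - (of_int q *\<^sub>C ope \<kappa> a b n p (q - 1) v) + of_int n *\<^sub>C ope \<kappa> a b (n - 1) p q v"
proof -
  define f where "f = (\<lambda>p q. mode a p (mode b q v))"
  define g where "g = (\<lambda>q p. mode b q (mode a p v))"
  have b: "upper_bounded f" "upper_bounded g" by (simp_all add: f_def g_def)
  have 1: "diffpow n (\<lambda>p q. mode a p (mode (deriv_field b) q v)) p q =
      - diffpow n (\<lambda>p q. of_int q *\<^sub>C f p (q - 1)) p q"
    using diffpow_scale[of "\<lambda>p q. of_int q *\<^sub>C f p (q - 1)" n "-1" p q]
      upper_bounded_linear[OF upper_bounded_shift[OF b(1), of 0 "-1"], of "\<lambda>p q x. of_int q *\<^sub>C x"]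
    by (simp add: f_def)
  have 2: "diffpow n (\<lambda>q p. mode (deriv_field b) q (mode a p v)) q p =
      - diffpow n (\<lambda>q p. of_int q *\<^sub>C g (q - 1) p) q p"
    using diffpow_scale[of "\<lambda>q p. of_int q *\<^sub>C g (q - 1) p" n "-1" q p]
      upper_bounded_linear[OF upper_bounded_shift[OF b(2), of "-1" 0], of "\<lambda>q p x. of_int q *\<^sub>C x"]
    by (simp add: g_def)
  show ?thesis
    unfolding ope_def 1 2 diffpow_deriv_right[OF b(1)] diffpow_deriv_left[OF b(2)]
      f_def[symmetric] g_def[symmetric] sgn_powi_diff1
    by (simp add: cvec.scale_right_diff_distrib scaleC_add_right scaleC_scaleC mult_ac)
qed

lemma deriv_nprod:
  "deriv_field (nprod \<kappa> a n b) = nprod \<kappa> (deriv_field a) n b + nprod \<kappa> a n (deriv_field b)"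
  by (rule vfield_eqI) (simp add: mode_nprod ope_deriv_left ope_deriv_right)

lemma nprod_deriv_left: "nprod \<kappa> (deriv_field a) n b = - (of_int n *\<^sub>C nprod \<kappa> a (n - 1) b)"
  by (rule vfield_eqI) (simp add: mode_nprod ope_deriv_left)

lemma nprod_id_left: "nprod \<kappa> id_field n a = (if n = -1 then a else 0)"
proof (rule vfield_eqI)
  fix m v
  have 1: "diffpow n (\<lambda>q p. mode a q (mode id_field p v)) m 0 = 0"
    by (rule diffpow_vanish) simp
  have 2: "diffpow n (\<lambda>p q. mode id_field p (mode a q v)) 0 m = (if n = -1 then mode a m v else 0)"
  proof (cases "n \<ge> -1")
    case True
    then have "diffpow n (\<lambda>p q. mode id_field p (mode a q v)) 0 m =
        alt_binomial n (nat (n + 1)) *\<^sub>C mode id_field (0 + n - int (nat (n + 1))) (mode a (m + int (nat (n + 1))) v)"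
      by (intro diffpow_single) auto
    then show ?thesis
      using True by (cases "n = -1") (simp_all add: alt_binomial_nonneg_eq_0 scaleC_one)
  next
    case False
    then show ?thesis by (subst diffpow_vanish) auto
  qed
  show "mode (nprod \<kappa> id_field n a) m v = mode (if n = - 1 then a else 0) m v"
    unfolding mode_nprod ope_def 1 2 by simp
qed

text \<open>Here \<open>\<one>\<close> is the identity field, so \<open>D\<close> is differentiation of fields.\<close>

lemma nprod_id_right: "nprod 1 a (-2) id_field = deriv_field a"
proof (rule vfield_eqI)
  fix m v
  have 1: "diffpow (-2) (\<lambda>p q. mode a p (mode id_field q v)) 0 m = (if m \<le> -1 then - (of_int m *\<^sub>C mode a (m - 1) v) else 0)"
  proof (cases "m \<le> -1")
    case True
    then have "diffpow (-2) (\<lambda>p q. mode a p (mode id_field q v)) 0 m =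
       alt_binomial (-2) (nat (-1 - m)) *\<^sub>C mode a (0 + (-2) - int (nat (-1 - m))) (mode id_field (m + int (nat (-1 - m))) v)"
      by (intro diffpow_single) auto
    also have "\<dots> = - (of_int m *\<^sub>C mode a (m - 1) v)"
      using True by (simp add: alt_binomial_minus_2 cvec.scale_minus_left[symmetric] del: cvec.scale_minus_left)
    finally show ?thesis using True by simp
  next
    case False
    then show ?thesis by (subst diffpow_vanish) auto
  qed
  have 2: "diffpow (-2) (\<lambda>q p. mode id_field q (mode a p v)) m 0 = (if m \<ge> 1 then of_int m *\<^sub>C mode a (m - 1) v else 0)"
  proof (cases "m \<ge> 1")
    case True
    then have "diffpow (-2) (\<lambda>q p. mode id_field q (mode a p v)) m 0 =
       alt_binomial (-2) (nat (m - 1)) *\<^sub>C mode id_field (m + (-2) - int (nat (m - 1))) (mode a (0 + int (nat (m - 1))) v)"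
      by (intro diffpow_single) auto
    also have "\<dots> = of_int m *\<^sub>C mode a (m - 1) v"
      using True by (simp add: alt_binomial_minus_2)
    finally show ?thesis using True by simp
  next
    case False
    then show ?thesis by (subst diffpow_vanish) auto
  qed
  show "mode (nprod 1 a (-2) id_field) m v = mode (deriv_field a) m v"
    unfolding mode_nprod ope_def 1 2 by (auto simp: scaleC_one)
qed

lemma nprod_id_right_nonneg: "0 \<le> n \<Longrightarrow> nprod 1 a n id_field = 0"
  by (rule vfield_eqI) (simp add: mode_nprod ope_eq_0_above[of _ _ _ 0] ope_0)

section \<open>Locality\<close>

text \<open>Locality \<open>(x - y)\<^sup>N [a(x), b(y)] = 0\<close>. For \<open>n \<ge> 0\<close> the two expansions of \<open>(x - y)\<^sup>n\<close> agree, so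
  the family \<open>ope\<close> expresses it without further notions.\<close>

definition mutually_local :: "complex \<Rightarrow> 'v::complex_vector vfield \<Rightarrow> 'v vfield \<Rightarrow> bool" where
  "mutually_local \<kappa> a b \<longleftrightarrow> (\<exists>N. \<forall>n\<ge>N. \<forall>p q v. ope \<kappa> a b n p q v = 0)"

text \<open>Exchanging the fields exchanges the two domains of expansion.\<close>

lemma ope_swap:
  assumes "\<kappa> * \<kappa> = 1"
  shows "ope \<kappa> b a n q p v = - ((\<kappa> * (-1) powi n) *\<^sub>C ope \<kappa> a b n p q v)"
proof -
  have "(\<kappa> * (-1) powi n) * (\<kappa> * (-1) powi n) = 1"
    using assms sgn_powi_square[of n] by (metis mult.assoc mult.left_commute mult_1)
  then show ?thesis
    by (simp add: ope_def cvec.scale_right_diff_distrib scaleC_scaleC scaleC_one)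
qed

lemma local_sym:
  assumes "\<kappa> * \<kappa> = 1" "mutually_local \<kappa> a b"
  shows "mutually_local \<kappa> b a"
proof -
  obtain N where N: "\<And>n p q v. n \<ge> N \<Longrightarrow> ope \<kappa> a b n p q v = 0"
    using assms(2) unfolding mutually_local_def by blast
  show ?thesis
    unfolding mutually_local_def
    by (intro exI[of _ N] allI impI) (simp add: ope_swap[OF assms(1), of b a] N)
qed

lemma local_add:
  assumes "mutually_local \<kappa> a b" "mutually_local \<kappa> a' b"
  shows "mutually_local \<kappa> (a + a') b"
proof -
  obtain M N where "\<forall>n\<ge>M. \<forall>p q v. ope \<kappa> a b n p q v = 0" "\<forall>n\<ge>N. \<forall>p q v. ope \<kappa> a' b n p q v = 0"
    using assms unfolding mutually_local_def by blast
  then show ?thesis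
    unfolding mutually_local_def by (intro exI[of _ "max M N"]) (simp add: ope_add_left)
qed

lemma local_scale: "mutually_local \<kappa> a b \<Longrightarrow> mutually_local \<kappa> (c *\<^sub>C a) b"
  unfolding mutually_local_def by (elim exE, rule exI) (auto simp: ope_scale_left)

lemma local_zero: "mutually_local \<kappa> 0 b"
  unfolding mutually_local_def by (simp add: ope_def)

lemma local_of_step: "(\<And>p q v. ope \<kappa> a b N p q v = 0) \<Longrightarrow> mutually_local \<kappa> a b"
  unfolding mutually_local_def using ope_eq_0_above by blast

lemma local_id: "mutually_local 1 id_field a"
  by (rule local_of_step[of _ _ _ 0]) (simp add: ope_0)

section \<open>Dong's lemma\<close>

text \<open>In the binomial expansion of \<open>(P - Q)\<^sup>i\<^sup>+\<^sup>j\<close> every term contains \<open>P\<^sup>i\<close> or \<open>Q\<^sup>j\<close>.\<close>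

lemma commuting_difference_nilpotent:
  fixes P Q :: "'a::ab_group_add \<Rightarrow> 'a"
  assumes add: "\<And>x y. P (x - y) = P x - P y" "\<And>x y. Q (x - y) = Q x - Q y"
    and comm: "\<And>x. P (Q x) = Q (P x)"
    and "(P ^^ i) x = 0" "(Q ^^ j) x = 0"
  shows "((\<lambda>x. P x - Q x) ^^ (i + j)) x = 0"
proof -
  define R where "R = (\<lambda>x. P x - Q x)"
  have z: "P 0 = 0" "Q 0 = 0" using add[of 0 0] by simp_all
  have Rz: "(R ^^ k) 0 = 0" for k by (induction k) (simp_all add: R_def z)
  have Rd: "(R ^^ k) (x - y) = (R ^^ k) x - (R ^^ k) y" for k x y
    by (induction k) (simp_all add: R_def add)
  have Pn: "(P ^^ k) (Q x) = Q ((P ^^ k) x)" "(Q ^^ k) (P x) = P ((Q ^^ k) x)" for k x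
    by (induction k) (simp_all add: comm)
  have "(R ^^ n) x = 0" if "n = i + j" "(P ^^ i) x = 0" "(Q ^^ j) x = 0" for n
    using that
  proof (induction n arbitrary: i j x)
    case (Suc n)
    have P: "(R ^^ n) (P x) = 0"
    proof (cases i)
      case 0
      then show ?thesis using Suc.prems by (simp add: z Rz)
    next
      case (Suc i')
      then show ?thesis
        using Suc.prems by (intro Suc.IH[of i' j]) (simp_all add: Pn z funpow_swap1)
    qed
    have Q: "(R ^^ n) (Q x) = 0"
    proof (cases j)
      case 0
      then show ?thesis using Suc.prems by (simp add: z Rz)
    next
      case (Suc j')
      then show ?thesis
        using Suc.prems by (intro Suc.IH[of i j']) (simp_all add: Pn z funpow_swap1)
    qed
    have "(R ^^ Suc n) x = (R ^^ n) (R x)"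
      by (simp add: funpow_swap1)
    also have "\<dots> = (R ^^ n) (P x - Q x)"
      by (simp add: R_def)
    finally have "(R ^^ Suc n) x = (R ^^ n) (P x - Q x)" .
    then show ?case by (simp add: Rd P Q)
  qed simp
  then show ?thesis using assms(4,5) unfolding R_def by blast
qed

type_synonym 'v threefold = "int \<Rightarrow> int \<Rightarrow> int \<Rightarrow> 'v"

text \<open>Three-variable families, with multiplication by \<open>x - y\<close>, \<open>x - z\<close>, and \<open>y - z\<close>.\<close>

definition shift12 :: "'v::ab_group_add threefold \<Rightarrow> 'v threefold" where
  "shift12 f = (\<lambda>p q r. f (p + 1) q r - f p (q + 1) r)"

definition shift13 :: "'v::ab_group_add threefold \<Rightarrow> 'v threefold" where
  "shift13 f = (\<lambda>p q r. f (p + 1) q r - f p q (r + 1))"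

definition shift23 :: "'v::ab_group_add threefold \<Rightarrow> 'v threefold" where
  "shift23 f = (\<lambda>p q r. f p (q + 1) r - f p q (r + 1))"

lemmas shift_defs = shift12_def shift13_def shift23_def

lemma shift_diff:
  "shift12 (f - g) = shift12 f - shift12 g"
  "shift13 (f - g) = shift13 f - shift13 g"
  "shift23 (f - g) = shift23 f - shift23 g"
  by (simp_all add: shift_defs fun_eq_iff)

lemma shift_comm:
  "shift13 (shift12 f) = shift12 (shift13 f)"
  "shift23 (shift12 f) = shift12 (shift23 f)"
  "shift23 (shift13 f) = shift13 (shift23 f)"
  by (simp_all add: shift_defs fun_eq_iff)

lemma shift_split: "shift13 f - shift12 f = shift23 f"
  by (simp add: shift_defs fun_eq_iff)

lemma shift_pow_zero: "(shift12 ^^ k) 0 = 0" "(shift13 ^^ k) 0 = 0" "(shift23 ^^ k) 0 = 0"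
  by (induction k) (simp_all add: shift_defs fun_eq_iff)

lemma shift12_shift23_pow_comm: "(shift12 ^^ i) ((shift23 ^^ j) f) = (shift23 ^^ j) ((shift12 ^^ i) f)"
proof -
  have "shift12 ((shift23 ^^ j) f) = (shift23 ^^ j) (shift12 f)" for f :: "'a threefold"
    by (induction j) (simp_all add: shift_comm[symmetric])
  then show ?thesis by (induction i) simp_all
qed

text \<open>The engine of Dong's lemma: a power of \<open>y - z = (x - z) - (x - y)\<close> kills whatever is killed by
  powers of the two other differences.\<close>

lemma threefold_nilpotent:
  assumes "(shift12 ^^ i) f = 0" "(shift13 ^^ j) ((shift23 ^^ k) f) = 0"
  shows "(shift23 ^^ (j + i + k)) f = 0"
proof -
  have "((\<lambda>f. shift13 f - shift12 f) ^^ (j + i)) ((shift23 ^^ k) f) = 0"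
    by (rule commuting_difference_nilpotent)
      (simp_all add: shift_diff shift_comm assms shift12_shift23_pow_comm shift_pow_zero)
  then show ?thesis by (simp add: shift_split funpow_add)
qed

definition bounded12 :: "'v::zero threefold \<Rightarrow> bool" where
  "bounded12 f \<longleftrightarrow> (\<forall>r. upper_bounded (\<lambda>p q. f p q r))"

definition diffpow3 :: "int \<Rightarrow> 'v::complex_vector threefold \<Rightarrow> 'v threefold" where
  "diffpow3 n f = (\<lambda>p q r. diffpow n (\<lambda>p q. f p q r) p q)"

definition swap12 :: "'v threefold \<Rightarrow> 'v threefold" where
  "swap12 f = (\<lambda>p q r. f q p r)"

lemma bounded12_shift:
  fixes f :: "'v::complex_vector threefold"
  assumes "bounded12 f"
  shows "bounded12 (shift13 f)" "bounded12 (shift23 f)"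
proof -
  have f: "upper_bounded (\<lambda>p q. f p q r)" for r
    using assms by (simp add: bounded12_def)
  have "upper_bounded (\<lambda>p q. f (p + 1) q r)" "upper_bounded (\<lambda>p q. f p (q + 1) r)" for r
    using upper_bounded_shift[OF f[of r], of 1 0] upper_bounded_shift[OF f[of r], of 0 1] by simp_all
  then show "bounded12 (shift13 f)" "bounded12 (shift23 f)"
    unfolding bounded12_def shift_defs by (auto intro!: upper_bounded_diff f)
qed

lemma diffpow3_shift:
  assumes "bounded12 f"
  shows "shift13 (diffpow3 n f) = diffpow3 n (shift13 f)" "shift23 (diffpow3 n f) = diffpow3 n (shift23 f)"
proof -
  have f: "upper_bounded (\<lambda>p q. f p q r)" for r
    using assms by (simp add: bounded12_def)
  have b: "upper_bounded (\<lambda>p q. f (p + 1) q r)" "upper_bounded (\<lambda>p q. f p (q + 1) r)" for r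
    using upper_bounded_shift[OF f[of r], of 1 0] upper_bounded_shift[OF f[of r], of 0 1] by simp_all
  show "shift13 (diffpow3 n f) = diffpow3 n (shift13 f)"
    using diffpow_shift[of n _ _ 1 _ 0]
    by (intro ext) (simp add: shift13_def diffpow3_def diffpow_diff b f)
  show "shift23 (diffpow3 n f) = diffpow3 n (shift23 f)"
    using diffpow_shift[of n _ _ 0 _ 1]
    by (intro ext) (simp add: shift23_def diffpow3_def diffpow_diff b f)
qed

text \<open>Multiplication by \<open>x - z\<close> and \<open>y - z\<close> commutes with the expansion of \<open>(x - y)\<^sup>n\<close>.\<close>

lemma diffpow3_kill:
  assumes "bounded12 f" "(shift13 ^^ j) ((shift23 ^^ k) f) = 0"
  shows "(shift13 ^^ j) ((shift23 ^^ k) (diffpow3 n f)) = 0"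
proof -
  have 1: "(shift23 ^^ k) (diffpow3 n f) = diffpow3 n ((shift23 ^^ k) f) \<and> bounded12 ((shift23 ^^ k) f)"
    by (induction k) (simp_all add: assms(1) diffpow3_shift bounded12_shift)
  have 2: "(shift13 ^^ j) (diffpow3 n g) = diffpow3 n ((shift13 ^^ j) g) \<and> bounded12 ((shift13 ^^ j) g)"
    if "bounded12 g" for g :: "'a threefold"
    by (induction j) (simp_all add: that diffpow3_shift bounded12_shift)
  have "(shift13 ^^ j) ((shift23 ^^ k) (diffpow3 n f)) = diffpow3 n 0"
    using 1 2[of "(shift23 ^^ k) f"] assms(2) by metis
  then show ?thesis by (simp add: diffpow3_def fun_eq_iff)
qed

lemma shift_pow_add:
  "(shift13 ^^ j) (f + g) = (shift13 ^^ j) f + (shift13 ^^ j) g"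
  "(shift23 ^^ j) (f + g) = (shift23 ^^ j) f + (shift23 ^^ j) g"
  "(shift13 ^^ j) (f - g) = (shift13 ^^ j) f - (shift13 ^^ j) g"
  "(shift23 ^^ j) (f - g) = (shift23 ^^ j) f - (shift23 ^^ j) g"
proof -
  have *: "shift13 (f + g) = shift13 f + shift13 g" "shift23 (f + g) = shift23 f + shift23 g" for f g :: "'a threefold"
    by (simp_all add: shift_defs fun_eq_iff)
  show "(shift13 ^^ j) (f + g) = (shift13 ^^ j) f + (shift13 ^^ j) g"
    by (induction j) (simp_all only: funpow.simps comp_apply id_apply *)
  show "(shift23 ^^ j) (f + g) = (shift23 ^^ j) f + (shift23 ^^ j) g"
    by (induction j) (simp_all only: funpow.simps comp_apply id_apply *)
  show "(shift13 ^^ j) (f - g) = (shift13 ^^ j) f - (shift13 ^^ j) g"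
    by (induction j) (simp_all only: funpow.simps comp_apply id_apply shift_diff)
  show "(shift23 ^^ j) (f - g) = (shift23 ^^ j) f - (shift23 ^^ j) g"
    by (induction j) (simp_all only: funpow.simps comp_apply id_apply shift_diff)
qed

lemma shift13_shift23_pow_comm: "(shift13 ^^ j) ((shift23 ^^ k) f) = (shift23 ^^ k) ((shift13 ^^ j) f)"
proof -
  have "shift13 ((shift23 ^^ j) f) = (shift23 ^^ j) (shift13 f)" for f :: "'a threefold" and j
    by (induction j) (simp_all add: shift_comm[symmetric])
  then show ?thesis by (induction j) simp_all
qed

definition triple :: "complex \<Rightarrow> 'v::complex_vector vfield \<Rightarrow> 'v vfield \<Rightarrow> 'v vfield \<Rightarrow> 'v \<Rightarrow> 'v threefold" where
  "triple \<kappa> a b c v = (\<lambda>p q r. mode a p (mode b q (mode c r v)) - \<kappa> *\<^sub>C mode c r (mode a p (mode b q v)))"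

lemma bounded12_triple: "bounded12 (triple \<kappa> a b c v)"
  unfolding bounded12_def triple_def
proof (intro allI upper_bounded_diff upper_bounded_modes)
  fix r
  show "upper_bounded (\<lambda>p q. \<kappa> *\<^sub>C mode c r (mode a p (mode b q v)))"
    by (rule upper_bounded_linear[OF upper_bounded_modes, where L = "\<lambda>p q x. \<kappa> *\<^sub>C mode c r x"]) simp
qed

text \<open>Commuting \<open>c\<close> past \<open>a b\<close> means commuting it past \<open>b\<close> and then past \<open>a\<close>. Powers of \<open>y - z\<close> and
  \<open>x - z\<close> kill the two commutators.\<close>

lemma triple_kill:
  assumes "\<And>p r v. ope \<kappa>' a c (int j) p r v = 0" "\<And>q r v. ope \<kappa> b c (int k) q r v = 0"
  shows "(shift13 ^^ j) ((shift23 ^^ k) (triple (\<kappa>' * \<kappa>) a b c v)) = 0"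
proof -
  define A where "A k = (\<lambda>p q r. mode a p (ope \<kappa> b c (int k) q r v))" for k
  define B where "B j = (\<lambda>p q r. \<kappa> *\<^sub>C ope \<kappa>' a c (int j) p r (mode b q v))" for j
  have "triple (\<kappa>' * \<kappa>) a b c v = A 0 + B 0"
    by (simp add: triple_def A_def B_def fun_eq_iff ope_0 cvec.scale_right_diff_distrib scaleC_scaleC mult_ac)
  moreover have "(shift23 ^^ k) (A 0) = A k" for k
  proof (induction k)
    case (Suc k)
    have "shift23 (A k) = A (Suc k)"
      using ope_step[of \<kappa> b c "int k"] by (simp add: A_def shift23_def fun_eq_iff mode_diff[symmetric] add.commute del: mode_diff)
    then show ?case using Suc by simp
  qed simp
  moreover have "(shift13 ^^ j) (B 0) = B j" for j
  proof (induction j)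
    case (Suc j)
    have "shift13 (B j) = B (Suc j)"
      using ope_step[of \<kappa>' a c "int j"]
      by (simp add: B_def shift13_def fun_eq_iff cvec.scale_right_diff_distrib[symmetric] add.commute)
    then show ?case using Suc by simp
  qed simp
  moreover have "A k = 0" "B j = 0"
    by (simp_all add: A_def B_def assms fun_eq_iff)
  ultimately show ?thesis
    by (simp add: shift_pow_add shift_pow_zero shift13_shift23_pow_comm)
qed

lemma swap12_shift_pow:
  "(shift13 ^^ j) (swap12 f) = swap12 ((shift23 ^^ j) f)"
  "(shift23 ^^ j) (swap12 f) = swap12 ((shift13 ^^ j) f)"
  by (induction j) (simp_all add: swap12_def shift_defs)

text \<open>With \<open>f\<close> the commutator of \<open>(x - y)\<^sup>n [a(x), b(y)]\<close> and \<open>c(z)\<close>, locality of \<open>a\<close> and \<open>b\<close> makes a power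
  of \<open>x - y\<close> kill \<open>f\<close>, and locality with \<open>c\<close> makes powers of \<open>x - z\<close> and \<open>y - z\<close> kill it. Hence a
  power of \<open>y - z\<close> alone does, and this survives taking the residue in \<open>x\<close>.\<close>

lemma dongs_lemma:
  assumes "mutually_local \<kappa> a b" "mutually_local \<kappa>1 a c" "mutually_local \<kappa>2 b c"
  shows "mutually_local (\<kappa>1 * \<kappa>2) (nprod \<kappa> a n b) c"
proof -
  obtain Nab where ab: "\<And>n p q v. n \<ge> Nab \<Longrightarrow> ope \<kappa> a b n p q v = 0"
    using assms(1) unfolding mutually_local_def by blast
  obtain Nac where ac: "\<And>n p q v. n \<ge> Nac \<Longrightarrow> ope \<kappa>1 a c n p q v = 0"
    using assms(2) unfolding mutually_local_def by blast
  obtain Nbc where bc: "\<And>n p q v. n \<ge> Nbc \<Longrightarrow> ope \<kappa>2 b c n p q v = 0"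
    using assms(3) unfolding mutually_local_def by blast
  \<comment> \<open>The exponents with which \<open>x - y\<close>, \<open>x - z\<close>, and \<open>y - z\<close> act as zero.\<close>
  define i j k where "i = nat (Nab - n)" and "j = nat Nac" and "k = nat Nbc"
  define f where "f m v = (\<lambda>p q r. ope \<kappa> a b m p q (mode c r v) - (\<kappa>1 * \<kappa>2) *\<^sub>C mode c r (ope \<kappa> a b m p q v))" for m v
  have f12: "(shift12 ^^ i) (f n v) = f (n + int i) v" for i v
  proof (induction i)
    case (Suc i)
    have "shift12 (f m v) = f (m + 1) v" for m
      unfolding f_def shift12_def
      by (simp add: fun_eq_iff ope_step[symmetric] cvec.scale_right_diff_distrib)
    then show ?case using Suc by (simp add: add_ac)
  qed simp
  have "n + int i \<ge> Nab" by (simp add: i_def)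
  then have k12: "(shift12 ^^ i) (f n v) = 0" for v
    unfolding f12 by (simp add: f_def ab fun_eq_iff)
  define A where "A v = diffpow3 n (triple (\<kappa>1 * \<kappa>2) a b c v)" for v
  define B where "B v = diffpow3 n (triple (\<kappa>2 * \<kappa>1) b a c v)" for v
  define s where "s = \<kappa> * (-1) powi n"
  have f_split: "f n v = A v - (\<lambda>p q r. s *\<^sub>C swap12 (B v) p q r)" for v
  proof (intro ext)
    fix p q r
    note u = upper_bounded_linear[OF upper_bounded_modes, where L = "\<lambda>p q x. K *\<^sub>C mode c r x" for K]
    have d: "K *\<^sub>C mode c r (diffpow n f p q) = diffpow n (\<lambda>p q. K *\<^sub>C mode c r (f p q)) p q"
      if "upper_bounded f" for K f p q
      by (rule diffpow_linear[OF that]) (rule clinearI, simp_all add: scaleC_add_right scaleC_scaleC mult.commute)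
    have "A v p q r = diffpow n (\<lambda>p q. mode a p (mode b q (mode c r v))) p q -
        (\<kappa>1 * \<kappa>2) *\<^sub>C mode c r (diffpow n (\<lambda>p q. mode a p (mode b q v)) p q)"
      unfolding d[OF upper_bounded_modes] by (simp add: A_def diffpow3_def triple_def diffpow_diff u)
    moreover have "B v q p r = diffpow n (\<lambda>q p. mode b q (mode a p (mode c r v))) q p -
        (\<kappa>1 * \<kappa>2) *\<^sub>C mode c r (diffpow n (\<lambda>q p. mode b q (mode a p v)) q p)"
      unfolding d[OF upper_bounded_modes] by (simp add: B_def diffpow3_def triple_def diffpow_diff u mult.commute)
    ultimately show "f n v p q r = (A v - (\<lambda>p q r. s *\<^sub>C swap12 (B v) p q r)) p q r"
      unfolding f_def ope_def s_def[symmetric]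
      by (simp add: swap12_def cvec.scale_right_diff_distrib scaleC_scaleC mult_ac)
  qed
  have kA: "(shift13 ^^ j) ((shift23 ^^ k) (A v)) = 0" for v
    unfolding A_def
    by (intro diffpow3_kill bounded12_triple triple_kill) (simp_all add: ac bc j_def k_def)
  have kB: "(shift13 ^^ k) ((shift23 ^^ j) (B v)) = 0" for v
    unfolding B_def
    by (intro diffpow3_kill bounded12_triple triple_kill) (simp_all add: ac bc j_def k_def)
  have sc: "(shift13 ^^ j) (\<lambda>p q r. s *\<^sub>C g p q r) = (\<lambda>p q r. s *\<^sub>C (shift13 ^^ j) g p q r)"
    "(shift23 ^^ j) (\<lambda>p q r. s *\<^sub>C g p q r) = (\<lambda>p q r. s *\<^sub>C (shift23 ^^ j) g p q r)" for j and g :: "'a threefold"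
    by (induction j) (simp_all add: shift_defs cvec.scale_right_diff_distrib)
  have kill: "(shift13 ^^ j) ((shift23 ^^ k) (f n v)) = 0" for v
    unfolding f_split shift_pow_add sc swap12_shift_pow kA shift13_shift23_pow_comm[symmetric] kB
    by (simp add: swap12_def fun_eq_iff)
  have "(shift23 ^^ (j + i + k)) (f n v) = 0" for v
    by (rule threefold_nilpotent[OF k12 kill])
  moreover have "ope (\<kappa>1 * \<kappa>2) (nprod \<kappa> a n b) c (int m) q r v = (shift23 ^^ m) (f n v) 0 q r" for m q r v
  proof (induction m arbitrary: q r)
    case 0
    then show ?case by (simp add: f_def ope_0 mode_nprod)
  next
    case (Suc m)
    then show ?case
      using ope_step[of "\<kappa>1 * \<kappa>2" "nprod \<kappa> a n b" c "int m" q r v]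
      by (simp add: shift23_def add.commute)
  qed
  ultimately have "ope (\<kappa>1 * \<kappa>2) (nprod \<kappa> a n b) c (int (j + i + k)) q r v = 0" for q r v
    by (simp only: zero_fun_apply)
  then show ?thesis by (rule local_of_step)
qed

section \<open>Skew symmetry\<close>

text \<open>The commutator formula and its extension to all powers of \<open>x - y\<close>. Both sides obey the recursion
  \<open>ope_step\<close>, agree at \<open>p = 0\<close>, and vanish for large \<open>n\<close>. This determines them: descend in \<open>n\<close>, and
  for each \<open>n\<close> move away from \<open>p = 0\<close> in both directions.\<close>

lemma ope_expansion:
  assumes "mutually_local \<kappa> a b"
  shows "ope \<kappa> a b n p q v =
    Sum_any (\<lambda>i. (of_int p gchoose i) *\<^sub>C mode (nprod \<kappa> a (n + int i) b) (p + q - int i) v)"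
proof -
  obtain N where N: "\<And>n p q v. n \<ge> N \<Longrightarrow> ope \<kappa> a b n p q v = 0"
    using assms unfolding mutually_local_def by blast
  define T where "T n p q i = (of_int p gchoose i) *\<^sub>C mode (nprod \<kappa> a (n + int i) b) (p + q - int i) v"
    for n p q i
  have fin: "Sum_any (T n p q) = (\<Sum>i<K. T n p q i)" if "n + int K \<ge> N" for n p q K
    by (rule Sum_any_eq_sum) (use that in \<open>simp add: T_def mode_nprod N\<close>)
  have step: "Sum_any (T n (p + 1) q) = Sum_any (T n p (q + 1)) + Sum_any (T (n + 1) p q)" for n p q
  proof -
    define K where "K = nat (N - n)"
    have "Sum_any (T n (p + 1) q) = (\<Sum>i<Suc K. T n (p + 1) q i)"
      "Sum_any (T n p (q + 1)) = (\<Sum>i<Suc K. T n p (q + 1) i)"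
      "Sum_any (T (n + 1) p q) = (\<Sum>i<K. T (n + 1) p q i)"
      by (rule fin; simp add: K_def)+
    moreover have "T n (p + 1) q (Suc i) = T n p (q + 1) (Suc i) + T (n + 1) p q i" for i
    proof -
      have *: "n + int (Suc i) = n + 1 + int i" "p + 1 + q - int (Suc i) = p + q - int i"
        "p + (q + 1) - int (Suc i) = p + q - int i"
        by simp_all
      show ?thesis
        using gbinomial_Suc_Suc[of "of_int p :: complex" i]
        unfolding T_def * by (simp add: scaleC_add_left)
    qed
    moreover have "T n (p + 1) q 0 = T n p (q + 1) 0"
      by (simp add: T_def algebra_simps)
    ultimately show ?thesis
      by (simp add: sum.lessThan_Suc_shift sum.distrib del: sum.lessThan_Suc)
  qed
  have "ope \<kappa> a b n p q v = Sum_any (T n p q)" if "n + int d \<ge> N" for d n p q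
    using that
  proof (induction d arbitrary: n p q)
    case 0
    then show ?case using fin[of n 0 p q] by (simp add: N)
  next
    case (Suc d)
    then have IH: "ope \<kappa> a b (n + 1) p q v = Sum_any (T (n + 1) p q)" for p q
      by simp
    show ?case
    proof (induction p arbitrary: q rule: int_induct[where k = 0])
      case base
      have "Sum_any (T n 0 q) = (\<Sum>i<Suc 0. T n 0 q i)"
        by (rule Sum_any_eq_sum) (simp add: T_def gbinomial_0_left)
      then show ?case by (simp add: T_def mode_nprod scaleC_one)
    next
      case (step1 p)
      then show ?case
        using ope_step[of \<kappa> a b n p q v] IH[of p q] step[of n p q] by (simp add: algebra_simps)
    next
      case (step2 p)
      then show ?case
        using ope_step[of \<kappa> a b n "p - 1" "q - 1" v] IH[of "p - 1" "q - 1"] step[of n "p - 1" "q - 1"] by simp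
    qed
  qed
  from this[of n "nat (N - n)"] show ?thesis by (simp add: T_def)
qed

lemma mode_deriv_pow:
  "mode ((deriv_field ^^ k) a) m v = ((-1) ^ k * fact k * (of_int m gchoose k)) *\<^sub>C mode a (m - int k) v"
proof (induction k arbitrary: m)
  case (Suc k)
  have g: "of_nat (Suc k) * (of_int m gchoose Suc k) = of_int m * ((of_int m - 1 :: complex) gchoose k)"
    by (rule gbinomial_absorption)
  have "mode ((deriv_field ^^ Suc k) a) m v =
      - ((of_int m * ((-1) ^ k * fact k * ((of_int m - 1) gchoose k))) *\<^sub>C mode a (m - 1 - int k) v)"
    by (simp add: Suc scaleC_scaleC)
  also have "of_int m * ((-1) ^ k * fact k * ((of_int m - 1) gchoose k)) =
     (-1) ^ k * fact k * (of_nat (Suc k) * (of_int m gchoose Suc k) :: complex)"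
    unfolding g by simp
  finally show ?case by (simp add: algebra_simps)
qed (simp add: scaleC_one)

text \<open>Up to the sign \<open>(-1)\<^sup>n\<close>, the modes of the sum over \<open>k\<close> are the expansion of \<open>ope\<close> at \<open>q = 0\<close> for the
  exchanged pair. The vector \<open>v\<close> is fixed because the products are only known to vanish on a subspace.\<close>

lemma skew_symmetry:
  assumes "\<kappa> * \<kappa> = 1" "mutually_local \<kappa> b a" "\<And>k m. k \<ge> K \<Longrightarrow> mode (nprod \<kappa> b (n + int k) a) m v = 0"
  shows "mode (nprod \<kappa> a n b + \<kappa> *\<^sub>C (\<Sum>k<K. ((-1) powi (n + int k) / fact k) *\<^sub>C
      (deriv_field ^^ k) (nprod \<kappa> b (n + int k) a))) m v = 0"
proof -
  have "ope \<kappa> b a n m 0 v = (\<Sum>k<K. (of_int m gchoose k) *\<^sub>C mode (nprod \<kappa> b (n + int k) a) (m - int k) v)"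
    unfolding ope_expansion[OF assms(2)] by (subst Sum_any_eq_sum[of K]) (simp_all add: assms(3))
  moreover have "((-1) powi (n + int k) / fact k) *\<^sub>C mode ((deriv_field ^^ k) (nprod \<kappa> b (n + int k) a)) m v =
     (-1) powi n *\<^sub>C (of_int m gchoose k) *\<^sub>C mode (nprod \<kappa> b (n + int k) a) (m - int k) v" for k
  proof -
    have "((-1::complex) ^ k * (-1) ^ k) = 1" by (simp flip: power_mult_distrib)
    then have "((-1) powi (n + int k) / fact k) * ((-1) ^ k * fact k * (of_int m gchoose k)) = (-1) powi n * (of_int m gchoose k :: complex)"
      by (simp add: power_int_add)
    then show ?thesis by (simp add: mode_deriv_pow scaleC_scaleC)
  qed
  ultimately show ?thesis
    by (simp add: mode_nprod[of _ a] ope_swap[OF assms(1), of a b n 0 m] cvec.scale_sum_right[symmetric]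
        scaleC_scaleC[symmetric] del: cvec.scale_scale)
qed

section \<open>Uniqueness and associativity on the vacuum\<close>

text \<open>A family annihilated by \<open>x - y\<close> is constant along the antidiagonals, hence zero if it vanishes for
  large \<open>q\<close>.\<close>

lemma diffpow_eq_0D:
  assumes "upper_bounded f" "\<And>p q. diffpow (int N) f p q = 0"
  shows "f p q = 0"
proof -
  obtain Q where Q: "\<And>p q. q \<ge> Q \<Longrightarrow> f p q = 0"
    using assms(1) unfolding upper_bounded_def by blast
  have "\<forall>p q. diffpow (int N) f p q = 0 \<Longrightarrow> \<forall>p q. diffpow 0 f p q = 0"
  proof (induction N)
    case (Suc N)
    note prems = Suc.prems
    have eq: "diffpow (int N) f p q = diffpow (int N) f (p - int k) (q + int k)" for p q k
    proof (induction k)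
      case (Suc k)
      have "diffpow (int N + 1) f (p - int k - 1) (q + int k) = 0" using prems by (simp add: add.commute)
      then show ?case
        using Suc diffpow_step[OF assms(1), of "int N" "p - int k - 1" "q + int k"] by (simp add: algebra_simps)
    qed simp
    have "diffpow (int N) f p q = 0" for p q
    proof -
      have "diffpow (int N) f (p - int (nat (Q - q))) (q + int (nat (Q - q))) = 0"
        by (rule diffpow_vanish) (simp add: Q)
      then show ?thesis using eq[of p q "nat (Q - q)"] by simp
    qed
    then show ?case using Suc.IH by blast
  qed simp
  then show ?thesis using assms(2) by simp
qed

text \<open>Up to a power of \<open>x - y\<close>, the product \<open>c(x) x(y) u\<close> equals \<open>x(y) c(x) u = 0\<close>, and that power
  can be cancelled.\<close>

lemma local_annihilates:
  assumes "mutually_local \<kappa> c x" "\<And>p. mode c p u = 0"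
  shows "mode c p (mode x q u) = 0"
proof -
  obtain N where N: "\<And>n p q v. n \<ge> N \<Longrightarrow> ope \<kappa> c x n p q v = 0"
    using assms(1) unfolding mutually_local_def by blast
  have "diffpow (int (nat N)) (\<lambda>p q. mode c p (mode x q u)) p q = 0" for p q
    using N[of "int (nat N)" p q u] by (simp add: ope_def assms(2))
  then show ?thesis by (rule diffpow_eq_0D[OF upper_bounded_modes])
qed

text \<open>The condition \<open>a(z) e \<in> W[[z]]\<close> on a vacuum vector \<open>e\<close> of the space \<open>W\<close>.\<close>

definition creative :: "'v::complex_vector \<Rightarrow> 'v vfield \<Rightarrow> bool" where
  "creative e a \<longleftrightarrow> (\<forall>n\<ge>0. mode a n e = 0)"

lemma creative_nprod:
  assumes "creative e a" "creative e b"
  shows "creative e (nprod \<kappa> a n b)"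
  using assms by (simp add: creative_def mode_nprod ope_def diffpow_vanish)

text \<open>The product of fields corresponds to the action of modes on the states \<open>b\<^sub>-\<^sub>1 e\<close>.\<close>

lemma mode_nprod_vacuum:
  assumes "creative e a" "creative e b"
  shows "mode (nprod \<kappa> a n b) (-1) e = mode a n (mode b (-1) e)"
proof -
  have "diffpow n (\<lambda>p q. mode a p (mode b q e)) 0 (-1) =
      alt_binomial n 0 *\<^sub>C mode a (0 + n - int 0) (mode b (-1 + int 0) e)"
    by (rule diffpow_single) (use assms in \<open>simp add: creative_def\<close>)
  moreover have "diffpow n (\<lambda>q p. mode b q (mode a p e)) (-1) 0 = 0"
    by (rule diffpow_vanish) (use assms in \<open>simp add: creative_def\<close>)
  ultimately show ?thesis by (simp add: mode_nprod ope_def scaleC_one)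
qed

lemma creative_deriv: "creative e a \<Longrightarrow> creative e (deriv_field a)"
  unfolding creative_def
proof (intro allI impI)
  fix n :: int assume "\<forall>n\<ge>0. mode a n e = 0" "0 \<le> n"
  then show "mode (deriv_field a) n e = 0" by (cases "n = 0") simp_all
qed

text \<open>The associativity relation, truncated at \<open>K\<close>, as a field. The signs are those of three parities,
  and \<open>\<kappa>ac * \<kappa>bc\<close> is the sign of the pair \<open>(a b, c)\<close>.\<close>

definition associator :: "complex \<Rightarrow> complex \<Rightarrow> complex \<Rightarrow> int \<Rightarrow> int \<Rightarrow> nat \<Rightarrow>
    'v::complex_vector vfield \<Rightarrow> 'v vfield \<Rightarrow> 'v vfield \<Rightarrow> 'v vfield" where
  "associator \<kappa>ab \<kappa>ac \<kappa>bc m n K a b c =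
     nprod (\<kappa>ac * \<kappa>bc) (nprod \<kappa>ab a m b) n c -
     (\<Sum>k<K. alt_binomial m k *\<^sub>C (nprod (\<kappa>ab * \<kappa>ac) a (m - int k) (nprod \<kappa>bc b (n + int k) c)
       - ((-1) powi m * \<kappa>ab) *\<^sub>C nprod (\<kappa>ab * \<kappa>bc) b (m + n - int k) (nprod \<kappa>ac a (int k) c)))"

lemma deriv_associator:
  "deriv_field (associator \<kappa>ab \<kappa>ac \<kappa>bc m n K a b c) =
    associator \<kappa>ab \<kappa>ac \<kappa>bc m n K (deriv_field a) b c +
    associator \<kappa>ab \<kappa>ac \<kappa>bc m n K a (deriv_field b) c +
    associator \<kappa>ab \<kappa>ac \<kappa>bc m n K a b (deriv_field c)"
  unfolding associator_def deriv_linear deriv_sum deriv_nprod nprod_linear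
    scaleC_add_right cvec.scale_right_diff_distrib sum.distrib sum_subtractf
  by simp

text \<open>At the mode \<open>-1\<close> all products become actions of modes on the state \<open>c\<^sub>-\<^sub>1 e\<close>, and the relation turns
  into the definition of the modes of \<open>nprod \<kappa>ab a m b\<close>. The lower modes follow by induction:
  differentiating the associator yields three associators with one argument differentiated, and
  the mode \<open>-2 - j\<close> is a nonzero multiple of the mode \<open>-1 - j\<close> of the derivative. Nonnegative
  modes kill the vacuum.\<close>

lemma associator_vacuum:
  fixes a b c :: "'v::complex_vector vfield"
  assumes "creative e a" "creative e b" "creative e c"
    and "\<And>k p. k \<ge> K \<Longrightarrow> mode (nprod \<kappa>bc b (n + int k) c) p e = 0"
    and "\<And>k p. k \<ge> K \<Longrightarrow> mode (nprod \<kappa>ac a (int k) c) p e = 0"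
  shows "mode (associator \<kappa>ab \<kappa>ac \<kappa>bc m n K a b c) p e = 0"
proof -
  have neg: "mode (associator \<kappa>ab \<kappa>ac \<kappa>bc m n K a b c) (-1 - int j) e = 0"
    if "creative e a" "creative e b" "creative e c"
      "\<And>k p. k \<ge> K \<Longrightarrow> mode (nprod \<kappa>bc b (n + int k) c) p e = 0"
      "\<And>k p. k \<ge> K \<Longrightarrow> mode (nprod \<kappa>ac a (int k) c) p e = 0"
    for j K and a b c :: "'v vfield"
    using that
  proof (induction j arbitrary: K a b c)
    case 0
    note cr = 0(1-3)
    define u where "u = mode c (-1) e"
    have b: "mode b (n + int k) u = 0" if "k \<ge> K" for k
      using 0(4)[OF that, of "-1"] by (simp add: mode_nprod_vacuum cr u_def)
    have a: "mode a (int k) u = 0" if "k \<ge> K" for k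
      using 0(5)[OF that, of "-1"] by (simp add: mode_nprod_vacuum cr u_def)
    have "diffpow m (\<lambda>p q. mode a p (mode b q u)) 0 n =
        (\<Sum>k<K. alt_binomial m k *\<^sub>C mode a (m - int k) (mode b (n + int k) u))"
      unfolding diffpow_def by (subst Sum_any_eq_sum[of K]) (simp_all add: b)
    moreover have "diffpow m (\<lambda>q p. mode b q (mode a p u)) n 0 =
        (\<Sum>k<K. alt_binomial m k *\<^sub>C mode b (m + n - int k) (mode a (int k) u))"
      unfolding diffpow_def by (subst Sum_any_eq_sum[of K]) (simp_all add: a add.commute)
    ultimately show ?case
      by (simp add: associator_def mode_nprod_vacuum creative_nprod cr u_def[symmetric] mode_nprod[of _ a m b] ope_def
          cvec.scale_right_diff_distrib sum_subtractf cvec.scale_sum_right scaleC_scaleC mult_ac)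
  next
    case (Suc j)
    let ?Q = "associator \<kappa>ab \<kappa>ac \<kappa>bc m n"
    note cr = Suc.prems(1-3)
    have bc: "mode (nprod \<kappa>bc b (n + int k) c) p e = 0" if "k \<ge> K" for k p
      using Suc.prems(4) that .
    have ac: "mode (nprod \<kappa>ac a (int k) c) p e = 0" if "k \<ge> K" for k p
      using Suc.prems(5) that .
    have bc': "mode (nprod \<kappa>bc (deriv_field b) (n + int k) c) p e = 0" if "k \<ge> Suc K" for k p
      using bc[of "k - 1"] that by (simp add: nprod_deriv_left of_nat_diff algebra_simps)
    have ac': "mode (nprod \<kappa>ac (deriv_field a) (int k) c) p e = 0" if "k \<ge> Suc K" for k p
      using ac[of "k - 1"] that by (simp add: nprod_deriv_left of_nat_diff algebra_simps)
    have bc'': "mode (nprod \<kappa>bc b (n + int k) (deriv_field c)) p e = 0" if "k \<ge> Suc K" for k p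
    proof -
      have "mode (deriv_field (nprod \<kappa>bc b (n + int k) c)) p e = 0"
        using that by (simp add: bc)
      then show ?thesis using bc'[OF that] by (simp add: deriv_nprod)
    qed
    have ac'': "mode (nprod \<kappa>ac a (int k) (deriv_field c)) p e = 0" if "k \<ge> Suc K" for k p
    proof -
      have "mode (deriv_field (nprod \<kappa>ac a (int k) c)) p e = 0"
        using that by (simp add: ac)
      then show ?thesis using ac'[OF that] by (simp add: deriv_nprod)
    qed
    \<comment> \<open>Differentiation raises the truncation bound by one. The term that is added vanishes.\<close>
    have vanish: "mode (nprod \<kappa> a i (nprod \<kappa>bc b (n + int K) c)) p e = 0"
      "mode (nprod \<kappa> b i (nprod \<kappa>ac a (int K) c)) p e = 0" for \<kappa> i p
      using cr by (simp_all add: mode_nprod[of _ a i] mode_nprod[of _ b i] ope_def bc ac diffpow_vanish creative_def)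
    have "mode (?Q K a b c) (-1 - int (Suc j)) e = mode (?Q (Suc K) a b c) (-1 - int (Suc j)) e"
      by (simp add: associator_def vanish)
    moreover have D: "mode (deriv_field (?Q (Suc K) a b c)) (-1 - int j) e = 0"
      unfolding deriv_associator mode_add_field
      using Suc.IH[of "deriv_field a" b c "Suc K"] Suc.IH[of a "deriv_field b" c "Suc K"]
        Suc.IH[of a b "deriv_field c" "Suc K"]
      by (simp add: cr creative_deriv bc ac bc' ac' bc'' ac'')
    have "of_int (-1 - int j) \<noteq> (0::complex)"
      by (subst of_int_eq_0_iff) linarith
    then have "mode (?Q (Suc K) a b c) (-1 - int j - 1) e = 0"
      using D unfolding mode_deriv neg_equal_0_iff_equal cvec.scale_eq_0_iff by blast
    moreover have "-1 - int (Suc j) = -1 - int j - 1"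
      by simp
    ultimately show ?case by (simp only:)
  qed
  show ?thesis
  proof (cases "p \<ge> 0")
    case True
    then show ?thesis
      using assms(1-3) creative_nprod[of e] by (simp add: associator_def creative_def)
  next
    case False
    then have "p = -1 - int (nat (-1 - p))" by simp
    moreover have "mode (associator \<kappa>ab \<kappa>ac \<kappa>bc m n K a b c) (-1 - int j) e = 0" for j
      by (rule neg) (fact assms)+
    ultimately show ?thesis by metis
  qed
qed

section \<open>Parity\<close>

text \<open>Sums of parities must stay sums, so that the signs below can be computed by rewriting.\<close>

declare add_bit_eq_xor [simp del]

lemma koszul_square: "koszul p q * koszul p q = 1"
  by (simp add: koszul_def)

lemma koszul_commute: "koszul p q = koszul q p"
  by (simp add: koszul_def)

lemma koszul_add: "koszul (p + q) r = koszul p r * koszul q r"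
  by (cases p; cases q) (simp_all add: koszul_def add_bit_eq_xor)

lemma koszul_0 [simp]: "koszul 0 q = 1" "koszul p 0 = 1"
  by (simp_all add: koszul_def)

text \<open>A pair of fields consists of an even and an odd one, the parity being a label that is independent
  of the space on which the fields act.\<close>

definition homog :: "bit \<Rightarrow> 'v::complex_vector vfield \<Rightarrow> 'v vfield \<times> 'v vfield" where
  "homog p a = (if p = 0 then (a, 0) else (0, a))"

definition super_prod :: "'v::complex_vector vfield \<times> 'v vfield \<Rightarrow> int \<Rightarrow> 'v vfield \<times> 'v vfield \<Rightarrow> 'v vfield \<times> 'v vfield" where
  "super_prod a n b =
     (nprod 1 (fst a) n (fst b) + nprod (-1) (snd a) n (snd b),
      nprod 1 (fst a) n (snd b) + nprod 1 (snd a) n (fst b))"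

definition super_deriv :: "'v::complex_vector vfield \<times> 'v vfield \<Rightarrow> 'v vfield \<times> 'v vfield" where
  "super_deriv a = (deriv_field (fst a), deriv_field (snd a))"

lemma cbilinear_super_prod: "cbilinear (\<lambda>a b. super_prod a n b)"
  unfolding cbilinear_def
  by (intro conjI allI; rule clinearI)
    (simp_all add: super_prod_def nprod_linear scaleC_prod_def scaleC_add_right)

lemma super_prod_homog: "super_prod (homog p a) n (homog q b) = homog (p + q) (nprod (koszul p q) a n b)"
  by (cases p; cases q) (simp_all add: super_prod_def homog_def koszul_def)

lemma homog_linear: "homog p (a + b) = homog p a + homog p b" "homog p (c *\<^sub>C a) = c *\<^sub>C homog p a" "homog p 0 = 0"
  by (simp_all add: homog_def scaleC_prod_def zero_prod_def)

lemma homog_diff: "homog p (a - b) = homog p a - homog p b"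
  by (simp add: homog_def)

lemma homog_sum: "homog p (sum f A) = (\<Sum>i\<in>A. homog p (f i))"
  by (induction A rule: infinite_finite_induct) (simp_all add: homog_linear)

lemma homog_inj: "homog p a = homog p b \<longleftrightarrow> a = b"
  by (simp add: homog_def)

lemma super_deriv_homog: "(super_deriv ^^ k) (homog p a) = homog p ((deriv_field ^^ k) a)"
  by (induction k) (simp_all add: super_deriv_def homog_def deriv_zero)

lemma super_prod_unit_left: "super_prod (id_field, 0) n a = (if n = -1 then a else 0)"
  by (simp add: super_prod_def nprod_id_left zero_prod_def)

lemma super_prod_unit_right: "super_prod a (-2) (id_field, 0) = super_deriv a"
  by (simp add: super_prod_def super_deriv_def nprod_id_right)

lemma super_deriv_prod:
  "super_deriv (super_prod a n b) = super_prod (super_deriv a) n b + super_prod a n (super_deriv b)"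
  by (simp add: super_deriv_def super_prod_def deriv_linear deriv_nprod)

lemma super_prod_deriv_left: "super_prod (super_deriv a) n b = - (of_int n *\<^sub>C super_prod a (n - 1) b)"
  by (simp add: super_deriv_def super_prod_def nprod_deriv_left scaleC_prod_def scaleC_add_right)

definition pairwise_local :: "(bit \<times> 'v::complex_vector vfield) set \<Rightarrow> bool" where
  "pairwise_local S \<longleftrightarrow> (\<forall>(p, a)\<in>S. \<forall>(q, b)\<in>S. mutually_local (koszul p q) a b)"

lemma local_koszul_sym: "mutually_local (koszul p q) a b \<Longrightarrow> mutually_local (koszul q p) b a"
  using local_sym[OF koszul_square] by (simp add: koszul_commute)

text \<open>To enlarge a pairwise local set by \<open>d\<close> it is enough that any \<open>c\<close> local to the set is local to
  \<open>d\<close>. Applying this twice, by symmetry, also makes \<open>d\<close> local to itself.\<close>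

lemma pairwise_local_insert:
  assumes S: "pairwise_local S"
    and closure: "\<And>r c. (\<And>p a. (p, a) \<in> S \<Longrightarrow> mutually_local (koszul p r) a c) \<Longrightarrow> mutually_local (koszul s r) d c"
  shows "pairwise_local (insert (s, d) S)"
proof -
  have 1: "mutually_local (koszul s r) d c" if "(r, c) \<in> S" for r c
    by (rule closure) (use S that in \<open>auto simp: pairwise_local_def\<close>)
  then have 2: "mutually_local (koszul r s) c d" if "(r, c) \<in> S" for r c
    using that local_koszul_sym by blast
  then have "mutually_local (koszul s s) d d"
    by (rule closure)
  with 1 2 S show ?thesis by (auto simp: pairwise_local_def)
qed

lemma free_alg_induct [case_names gen zero add scale mult]:
  assumes "\<And>v. P (gen v)" "P 0" "\<And>x y. P x \<Longrightarrow> P y \<Longrightarrow> P (x + y)" "\<And>c x. P x \<Longrightarrow> P (c *\<^sub>C x)"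
    "\<And>x n y. P x \<Longrightarrow> P y \<Longrightarrow> P (x \<star>\<^bsub>n\<^esub> y)"
  shows "P x"
proof (induct x rule: free_alg.abs_induct)
  case (1 t)
  show ?case
    by (induction t)
      (simp_all only: assms gen.abs_eq[symmetric] zero_free_alg.abs_eq[symmetric]
        plus_free_alg.abs_eq[symmetric] scaleC_free_alg.abs_eq[symmetric] fmult.abs_eq[symmetric])
qed

lemma has_parity_diff: "has_parity G p x \<Longrightarrow> has_parity G p y \<Longrightarrow> has_parity G p (x - y)"
  unfolding minus_free_alg_def by (intro has_parity.intros)

lemma has_parity_sum: "(\<And>i. i \<in> A \<Longrightarrow> has_parity G p (f i)) \<Longrightarrow> has_parity G p (sum f A)"
  by (induction A rule: infinite_finite_induct) (auto intro: has_parity.intros)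

instantiation "fun" :: (type, complex_vector) complex_vector
begin
definition scaleC_fun :: "complex \<Rightarrow> ('a \<Rightarrow> 'b) \<Rightarrow> 'a \<Rightarrow> 'b" where
  "scaleC_fun c f = (\<lambda>x. c *\<^sub>C f x)"
instance
  by standard (simp_all add: scaleC_fun_def fun_eq_iff scaleC_add_right scaleC_add_left scaleC_scaleC scaleC_one)
end

lemma scaleC_fun_apply [simp]: "(c *\<^sub>C f) x = c *\<^sub>C f x"
  by (simp add: scaleC_fun_def)

text \<open>The letter \<open>(p, x, n)\<close> stands for \<open>x t\<^sup>n\<close> with \<open>x\<close> of parity \<open>p\<close>. Carrying the parity in the letter
  gives signs a definite value without decomposing \<open>x\<close>.\<close>

type_synonym 'g word = "(bit \<times> 'g \<times> int) list"

section \<open>Correlation functions at level zero\<close>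

context lie_superalgebra
begin

lemma G_subspace: "cvec.subspace (G p)"
  using grading by (simp add: super_grading_def)

lemma G_closed [simp]:
  "0 \<in> G p" "x \<in> G p \<Longrightarrow> y \<in> G p \<Longrightarrow> x + y \<in> G p" "x \<in> G p \<Longrightarrow> c *\<^sub>C x \<in> G p"
  using G_subspace[of p] by (auto simp: cvec.subspace_def)

lemma br_closed [simp]: "x \<in> G p \<Longrightarrow> y \<in> G q \<Longrightarrow> br x y \<in> G (p + q)"
  using even by (auto simp: even_map_def)

lemma br_linear:
  "br (x + y) z = br x z + br y z" "br z (x + y) = br z x + br z y"
  "br (c *\<^sub>C x) z = c *\<^sub>C br x z" "br z (c *\<^sub>C x) = c *\<^sub>C br z x"
  using bilinear unfolding cbilinear_def clinear_iff by blast+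

definition valid :: "'g word \<Rightarrow> bool" where
  "valid w \<longleftrightarrow> (\<forall>(p, x, n) \<in> set w. x \<in> G p)"

lemma valid_simps [simp]:
  "valid []" "valid ((p, x, n) # w) \<longleftrightarrow> x \<in> G p \<and> valid w" "valid (u @ w) \<longleftrightarrow> valid u \<and> valid w"
  by (simp_all add: valid_def ball_Un)

text \<open>The next three properties of a functional on words express that it comes from
  \<open>U(\<gg>[t, t\<^sup>-\<^sup>1])\<close> modulo the left ideal generated by \<open>\<gg>[t]\<close>. They are restricted to words of
  bounded length because the functional of interest is built by recursion on the length.\<close>

definition multilinear :: "nat \<Rightarrow> ('g word \<Rightarrow> 'c::complex_vector) \<Rightarrow> bool" where
  "multilinear L f \<longleftrightarrow> (\<forall>u q m w. valid u \<longrightarrow> valid w \<longrightarrow> length u + length w < L \<longrightarrow>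
     (\<forall>x\<in>G q. \<forall>y\<in>G q. f (u @ (q, x + y, m) # w) = f (u @ (q, x, m) # w) + f (u @ (q, y, m) # w)) \<and>
     (\<forall>x\<in>G q. \<forall>c. f (u @ (q, c *\<^sub>C x, m) # w) = c *\<^sub>C f (u @ (q, x, m) # w)))"

definition commutation :: "nat \<Rightarrow> ('g word \<Rightarrow> 'c::complex_vector) \<Rightarrow> bool" where
  "commutation L f \<longleftrightarrow> (\<forall>u p m q n w. valid u \<longrightarrow> valid w \<longrightarrow> length u + length w + 2 \<le> L \<longrightarrow>
     (\<forall>x\<in>G p. \<forall>y\<in>G q. f (u @ (p, x, m) # (q, y, n) # w) =
        koszul p q *\<^sub>C f (u @ (q, y, n) # (p, x, m) # w) + f (u @ (p + q, br x y, m + n) # w)))"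

definition kills_vacuum :: "nat \<Rightarrow> ('g word \<Rightarrow> 'c::complex_vector) \<Rightarrow> bool" where
  "kills_vacuum L f \<longleftrightarrow> (\<forall>u p n. valid u \<longrightarrow> length u < L \<longrightarrow> 0 \<le> n \<longrightarrow> (\<forall>x\<in>G p. f (u @ [(p, x, n)]) = 0))"

text \<open>The functional \<open>f\<close> composed with the derivation \<open>ad (x t\<^sup>n)\<close> of words. Composing functionals
  avoids formal linear combinations of words. The sign of passing a letter is put into that letter.\<close>

fun der :: "bit \<Rightarrow> 'g \<Rightarrow> int \<Rightarrow> ('g word \<Rightarrow> 'c::complex_vector) \<Rightarrow> 'g word \<Rightarrow> 'c" where
  "der p x n f [] = 0"
| "der p x n f ((q, y, m) # w) =
     f ((p + q, br x y, m + n) # w) + der p x n (\<lambda>u. f ((q, koszul p q *\<^sub>C y, m) # u)) w"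

lemma der_cong [fundef_cong]:
  "w = w' \<Longrightarrow> (\<And>u. length u = length w' \<Longrightarrow> f u = g u) \<Longrightarrow> der p x n f w = der p x n g w'"
proof (induction w arbitrary: w' f g)
  case (Cons l w)
  obtain q y m where l: "l = (q, y, m)" by (cases l)
  show ?case
    unfolding Cons.prems(1)[symmetric] l der.simps
    by (rule arg_cong2[where f = "(+)"]) (use Cons.prems l in \<open>auto intro!: Cons.IH\<close>)
qed auto

lemma der_cong_valid:
  "valid w \<Longrightarrow> x \<in> G p \<Longrightarrow> (\<And>u. valid u \<Longrightarrow> length u = length w \<Longrightarrow> f u = g u) \<Longrightarrow>
    der p x n f w = der p x n g w"
proof (induction w arbitrary: f g)
  case (Cons l w)
  obtain q y m where l: "l = (q, y, m)" by (cases l)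
  show ?case
    unfolding l der.simps
  proof (rule arg_cong2[where f = "(+)"])
    have "y \<in> G q" "valid w" using Cons.prems l by simp_all
    then show "f ((p + q, br x y, m + n) # w) = g ((p + q, br x y, m + n) # w)"
      using Cons.prems(2,3) l by simp
    show "der p x n (\<lambda>u. f ((q, koszul p q *\<^sub>C y, m) # u)) w = der p x n (\<lambda>u. g ((q, koszul p q *\<^sub>C y, m) # u)) w"
      by (rule Cons.IH) (use \<open>y \<in> G q\<close> \<open>valid w\<close> Cons.prems(2,3) l in simp_all)
  qed
qed simp

lemma der_add_fun: "der p x n (\<lambda>u. f u + g u) w = der p x n f w + der p x n g w"
  by (induction p x n f w arbitrary: g rule: der.induct) simp_all

lemma der_scale_fun: "der p x n (\<lambda>u. c *\<^sub>C f u) w = c *\<^sub>C der p x n f w"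
  by (induction p x n f w rule: der.induct) (simp_all add: scaleC_add_right)

lemma der_zero_fun: "(\<And>u. length u = length w \<Longrightarrow> f u = 0) \<Longrightarrow> der p x n f w = 0"
proof -
  assume "\<And>u. length u = length w \<Longrightarrow> f u = 0"
  then have "der p x n f w = der p x n (\<lambda>u. 0 *\<^sub>C f u) w"
    by (intro der_cong) simp_all
  then show ?thesis unfolding der_scale_fun by simp
qed

lemma multilinear_add:
  "multilinear L f \<Longrightarrow> valid u \<Longrightarrow> valid w \<Longrightarrow> length u + length w < L \<Longrightarrow> x \<in> G q \<Longrightarrow> y \<in> G q \<Longrightarrow>
    f (u @ (q, x + y, m) # w) = f (u @ (q, x, m) # w) + f (u @ (q, y, m) # w)"
  by (simp add: multilinear_def)

lemma multilinear_scale: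
  "multilinear L f \<Longrightarrow> valid u \<Longrightarrow> valid w \<Longrightarrow> length u + length w < L \<Longrightarrow> x \<in> G q \<Longrightarrow>
    f (u @ (q, c *\<^sub>C x, m) # w) = c *\<^sub>C f (u @ (q, x, m) # w)"
  by (simp add: multilinear_def)

lemma commutationD:
  "commutation L f \<Longrightarrow> valid u \<Longrightarrow> valid w \<Longrightarrow> length u + length w + 2 \<le> L \<Longrightarrow> x \<in> G p \<Longrightarrow> y \<in> G q \<Longrightarrow>
    f (u @ (p, x, m) # (q, y, n) # w) =
      koszul p q *\<^sub>C f (u @ (q, y, n) # (p, x, m) # w) + f (u @ (p + q, br x y, m + n) # w)"
  unfolding commutation_def by blast

lemma kills_vacuumD:
  "kills_vacuum L f \<Longrightarrow> valid u \<Longrightarrow> length u < L \<Longrightarrow> 0 \<le> n \<Longrightarrow> x \<in> G p \<Longrightarrow> f (u @ [(p, x, n)]) = 0"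
  by (simp add: kills_vacuum_def)

lemma multilinear_tail:
  assumes "multilinear (Suc L) f" "y \<in> G q"
  shows "multilinear L (\<lambda>u. f ((q, y, m) # u))"
  unfolding multilinear_def
  using multilinear_add[OF assms(1), of "(q, y, m) # u" for u]
    multilinear_scale[OF assms(1), of "(q, y, m) # u" for u] assms(2)
  by simp

lemma commutation_tail:
  assumes "commutation (Suc L) f" "y \<in> G q"
  shows "commutation L (\<lambda>u. f ((q, y, m) # u))"
  unfolding commutation_def
proof (intro allI impI ballI)
  fix u w :: "'g word" and p r i j x z
  assume "valid u" "valid w" "length u + length w + 2 \<le> L" "x \<in> G p" "z \<in> G r"
  then show "f ((q, y, m) # u @ (p, x, i) # (r, z, j) # w) =
      koszul p r *\<^sub>C f ((q, y, m) # u @ (r, z, j) # (p, x, i) # w) + f ((q, y, m) # u @ (p + r, br x z, i + j) # w)"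
    using commutationD[OF assms(1), of "(q, y, m) # u" w x p z r i j] assms(2) by auto
qed

lemma kills_vacuum_tail:
  assumes "kills_vacuum (Suc L) f" "y \<in> G q"
  shows "kills_vacuum L (\<lambda>u. f ((q, y, m) # u))"
  unfolding kills_vacuum_def
  using kills_vacuumD[OF assms(1), of "(q, y, m) # u" for u] assms(2) by simp

lemma der_Cons:
  assumes "multilinear L f" "y \<in> G q" "valid w" "length w < L" "x \<in> G p"
  shows "der p x n f ((q, y, m) # w) =
    f ((p + q, br x y, m + n) # w) + koszul p q *\<^sub>C der p x n (\<lambda>u. f ((q, y, m) # u)) w"
proof -
  have "der p x n (\<lambda>u. f ((q, koszul p q *\<^sub>C y, m) # u)) w = der p x n (\<lambda>u. koszul p q *\<^sub>C f ((q, y, m) # u)) w"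
    using assms multilinear_scale[OF assms(1), of "[]"] by (intro der_cong_valid) simp_all
  then show ?thesis by (simp add: der_scale_fun)
qed

declare der.simps(2) [simp del]

lemma der_add:
  assumes "multilinear L f" "valid w" "length w \<le> L" "x \<in> G p" "y \<in> G p"
  shows "der p (x + y) n f w = der p x n f w + der p y n f w"
  using assms
proof (induction w arbitrary: L f)
  case (Cons l w)
  obtain q z m where l: "l = (q, z, m)" by (cases l)
  from Cons.prems obtain L' where L: "L = Suc L'" by (cases L) auto
  have "der p (x + y) n (\<lambda>u. f (l # u)) w = der p x n (\<lambda>u. f (l # u)) w + der p y n (\<lambda>u. f (l # u)) w"
    by (rule Cons.IH[of L']) (use Cons.prems multilinear_tail[of L' f z q m] L l in simp_all)
  then show ?case
    using Cons.prems l der_Cons[OF Cons.prems(1)] multilinear_add[OF Cons.prems(1), of "[]"]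
    by (simp add: br_linear scaleC_add_right)
qed simp

lemma der_scale:
  assumes "multilinear L f" "valid w" "length w \<le> L" "x \<in> G p"
  shows "der p (c *\<^sub>C x) n f w = c *\<^sub>C der p x n f w"
  using assms
proof (induction w arbitrary: L f)
  case (Cons l w)
  obtain q z m where l: "l = (q, z, m)" by (cases l)
  from Cons.prems obtain L' where L: "L = Suc L'" by (cases L) auto
  have "der p (c *\<^sub>C x) n (\<lambda>u. f (l # u)) w = c *\<^sub>C der p x n (\<lambda>u. f (l # u)) w"
    by (rule Cons.IH[of L']) (use Cons.prems multilinear_tail[of L' f z q m] L l in simp_all)
  then show ?case
    using Cons.prems l der_Cons[OF Cons.prems(1)] multilinear_scale[OF Cons.prems(1), of "[]"]
    by (simp add: br_linear scaleC_add_right scaleC_scaleC mult.commute)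
qed simp

lemma der_multilinear:
  assumes "multilinear L f" "x \<in> G p"
  shows "multilinear L (der p x n f)"
proof -
  have "der p x n f (u @ (q, y + z, m) # w) = der p x n f (u @ (q, y, m) # w) + der p x n f (u @ (q, z, m) # w) \<and>
     der p x n f (u @ (q, c *\<^sub>C y, m) # w) = c *\<^sub>C der p x n f (u @ (q, y, m) # w)"
    if "multilinear L f" "valid u" "valid w" "length u + length w < L" "y \<in> G q" "z \<in> G q" for u q m w y z c L f
    using that
  proof (induction u arbitrary: L f)
    case Nil
    note ml = Nil.prems(1)
    have "der p x n (\<lambda>u. f ((q, y + z, m) # u)) w = der p x n (\<lambda>u. f ((q, y, m) # u) + f ((q, z, m) # u)) w"
      using Nil assms(2) multilinear_add[OF ml, of "[]"] by (intro der_cong_valid) simp_all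
    moreover have "der p x n (\<lambda>u. f ((q, c *\<^sub>C y, m) # u)) w = der p x n (\<lambda>u. c *\<^sub>C f ((q, y, m) # u)) w"
      using Nil assms(2) multilinear_scale[OF ml, of "[]"] by (intro der_cong_valid) simp_all
    ultimately show ?case
      using Nil assms(2) multilinear_add[OF ml, of "[]"] multilinear_scale[OF ml, of "[]"]
      by (simp add: der_Cons[OF ml] der_add_fun der_scale_fun br_linear scaleC_add_right scaleC_scaleC mult.commute)
  next
    case (Cons l u)
    note ml = Cons.prems(1)
    obtain r t k where l: "l = (r, t, k)" by (cases l)
    from Cons.prems obtain L' where L: "L = Suc L'" by (cases L) auto
    have "multilinear L' (\<lambda>u. f (l # u))"
      using Cons.prems multilinear_tail[of L' f t r k] L l by simp
    then show ?case
      using Cons.IH[of L' "\<lambda>u. f (l # u)"] Cons.prems assms(2) L l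
        multilinear_add[OF ml, of "(p + r, br x t, k + n) # u" for u]
        multilinear_scale[OF ml, of "(p + r, br x t, k + n) # u" for u]
      by (simp add: der_Cons[OF ml] scaleC_add_right scaleC_scaleC mult.commute)
  qed
  from this[OF assms(1)] show ?thesis
    unfolding multilinear_def by blast
qed

text \<open>The derivation turns a last letter \<open>y t\<^sup>n\<close> into \<open>[x, y] t\<^sup>n\<^sup>+\<^sup>k\<close>, and \<open>n + k \<ge> 0\<close>.\<close>

lemma der_kills_vacuum:
  assumes "multilinear L f" "kills_vacuum L f" "x \<in> G p" "0 \<le> k"
  shows "kills_vacuum L (der p x k f)"
proof -
  have "der p x k f (u @ [(q, y, n)]) = 0"
    if "multilinear L f" "kills_vacuum L f" "valid u" "length u < L" "0 \<le> n" "y \<in> G q" for u q y n L f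
    using that
  proof (induction u arbitrary: L f)
    case Nil
    have "f ([] @ [(p + q, br x y, n + k)]) = 0"
      using Nil assms(3,4) by (intro kills_vacuumD) simp_all
    then show ?case by (simp add: der.simps(2))
  next
    case (Cons l u)
    obtain r t m where l: "l = (r, t, m)" by (cases l)
    from Cons.prems obtain L' where L: "L = Suc L'" by (cases L) auto
    have "der p x k (\<lambda>u. f (l # u)) (u @ [(q, y, n)]) = 0"
      using Cons.prems L l multilinear_tail[of L' f t r m] kills_vacuum_tail[of L' f t r m] by (intro Cons.IH[of L']) simp_all
    moreover have "f (((p + r, br x t, m + k) # u) @ [(q, y, n)]) = 0"
      using Cons.prems l assms(3) by (intro kills_vacuumD) simp_all
    ultimately show ?case
      using Cons.prems l assms(3) by (simp add: der_Cons[OF Cons.prems(1)])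
  qed
  from this[OF assms(1,2)] show ?thesis
    unfolding kills_vacuum_def by blast
qed

text \<open>Words form a module over \<open>\<gg>[t, t\<^sup>-\<^sup>1]\<close>. The order is reversed because functionals are composed.
  On a letter this is the Jacobi identity, and the mixed terms cancel.\<close>

lemma der_der:
  assumes "multilinear L f" "valid w" "length w \<le> L" "x \<in> G p" "y \<in> G q"
  shows "der q y n (der p x m f) w =
    koszul p q *\<^sub>C der p x m (der q y n f) w + der (p + q) (br x y) (m + n) f w"
  using assms
proof (induction w arbitrary: L f)
  case (Cons l w)
  note ml = Cons.prems(1) and xy = Cons.prems(4,5)
  obtain r z k where l: "l = (r, z, k)" by (cases l)
  from Cons.prems obtain L' where L: "L = Suc L'" by (cases L) auto
  have z: "z \<in> G r" and w: "valid w" "length w < L" using Cons.prems l by simp_all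
  have IH: "der q y n (der p x m (\<lambda>u. f (l # u))) w =
     koszul p q *\<^sub>C der p x m (der q y n (\<lambda>u. f (l # u))) w + der (p + q) (br x y) (m + n) (\<lambda>u. f (l # u)) w"
    by (rule Cons.IH[of L']) (use Cons.prems multilinear_tail[of L' f z r k] L l in simp_all)
  have expand: "der q' y' n' (der p' x' m' f) (l # w) =
      f ((p' + (q' + r), br x' (br y' z), (k + n') + m') # w)
      + koszul p' (q' + r) *\<^sub>C der p' x' m' (\<lambda>u. f ((q' + r, br y' z, k + n') # u)) w
      + koszul q' r *\<^sub>C der q' y' n' (\<lambda>u. f ((p' + r, br x' z, k + m') # u)) w
      + (koszul q' r * koszul p' r) *\<^sub>C der q' y' n' (der p' x' m' (\<lambda>u. f (l # u))) w"
    if "x' \<in> G p'" "y' \<in> G q'" for p' x' m' q' y' n'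
  proof -
    have "der q' y' n' (\<lambda>u. der p' x' m' f (l # u)) w =
        der q' y' n' (\<lambda>u. f ((p' + r, br x' z, k + m') # u) + koszul p' r *\<^sub>C der p' x' m' (\<lambda>u. f (l # u)) u) w"
      using that z w unfolding l by (intro der_cong_valid) (simp_all add: der_Cons[OF ml])
    then show ?thesis
      using that z w unfolding l
      by (simp add: der_Cons[OF der_multilinear[OF ml]] der_Cons[OF ml] der_add_fun der_scale_fun scaleC_add_right scaleC_scaleC add_ac)
  qed
  have J: "f ((p + (q + r), br x (br y z), i) # w) =
      f ((p + (q + r), br (br x y) z, i) # w) + koszul p q *\<^sub>C f ((p + (q + r), br y (br x z), i) # w)" for i
  proof -
    have "br (br x y) z \<in> G (p + (q + r))" "br y (br x z) \<in> G (p + (q + r))"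
      using br_closed[OF br_closed[OF xy] z] br_closed[OF xy(2) br_closed[OF xy(1) z]] by (simp_all add: add_ac)
    then show ?thesis
      using multilinear_add[OF ml, of "[]" w] multilinear_scale[OF ml, of "[]" w] w
      by (simp add: jacobi[OF xy z])
  qed
  have idx: "q + (p + r) = p + (q + r)" "k + m + n = k + n + m" by (simp_all add: add_ac)
  define a b c where "a = koszul p q" and "b = koszul p r" and "c = koszul q r"
  have k: "koszul p q = a" "koszul q p = a" "koszul p (q + r) = a * b" "koszul q (p + r) = a * c"
      "koszul p r = b" "koszul q r = c" "koszul (p + q) r = b * c"
    using koszul_commute[of p q] koszul_commute[of p "q + r"] koszul_commute[of q "p + r"]
      koszul_commute[of r p] koszul_commute[of r q]
    by (simp_all add: a_def b_def c_def koszul_add)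
  have sq: "a * (a * t) = t" for t
    using koszul_square[of p q] by (simp add: a_def flip: mult.assoc)
  show ?case
    unfolding expand[OF xy] expand[OF xy(2,1)] IH
    unfolding l der_Cons[OF ml z w br_closed[OF xy]] idx J k
    by (simp add: scaleC_add_right scaleC_scaleC sq mult_ac add_ac)
qed simp

text \<open>A derivation of the free algebra that extends \<open>ad\<close> preserves the commutation relations.\<close>

lemma der_commutation:
  assumes "multilinear L f" "commutation L f" "z \<in> G r"
  shows "commutation L (der r z n f)"
proof -
  have "der r z n f (u @ (p, x, i) # (q, y, j) # w) =
      koszul p q *\<^sub>C der r z n f (u @ (q, y, j) # (p, x, i) # w) + der r z n f (u @ (p + q, br x y, i + j) # w)"
    if "multilinear L f" "commutation L f" "valid u" "valid w" "length u + length w + 2 \<le> L" "x \<in> G p" "y \<in> G q"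
    for u p x i q y j w L f
    using that
  proof (induction u arbitrary: L f)
    case Nil
    note ml = Nil.prems(1) and cm = Nil.prems(2) and x = Nil.prems(6) and y = Nil.prems(7)
    from Nil.prems obtain L' where L: "L = Suc L'" by (cases L) auto
    have w: "valid w" "length w < L'" "length w < L" "Suc (length w) < L" "length w + 2 \<le> L"
      using Nil.prems L by simp_all
    have two: "der r z n f ((p, x, i) # (q, y, j) # w) =
        f ((r + p, br z x, i + n) # (q, y, j) # w) + koszul r p *\<^sub>C f ((p, x, i) # (r + q, br z y, j + n) # w)
        + (koszul r p * koszul r q) *\<^sub>C der r z n (\<lambda>u. f ((p, x, i) # (q, y, j) # u)) w"
      if "x \<in> G p" "y \<in> G q" for p x i q y j
      using that w der_Cons[OF ml, of x p "(q, y, j) # w" z r n i] assms(3)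
        der_Cons[OF multilinear_tail[OF ml[unfolded L] that(1), of i], of y q w z r n j]
      by (simp add: scaleC_add_right scaleC_scaleC)
    have one: "der r z n f ((p + q, br x y, i + j) # w) = f ((r + (p + q), br z (br x y), i + j + n) # w)
        + koszul r (p + q) *\<^sub>C der r z n (\<lambda>u. f ((p + q, br x y, i + j) # u)) w"
      using w assms(3) x y by (simp add: der_Cons[OF ml])
    have "der r z n (\<lambda>u. f ((p, x, i) # (q, y, j) # u)) w =
        der r z n (\<lambda>u. koszul p q *\<^sub>C f ((q, y, j) # (p, x, i) # u) + f ((p + q, br x y, i + j) # u)) w"
      using w assms(3) x y commutationD[OF cm, of "[]" _ x p y q i j]
      by (intro der_cong_valid) simp_all
    then have inner: "der r z n (\<lambda>u. f ((p, x, i) # (q, y, j) # u)) w =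
        koszul p q *\<^sub>C der r z n (\<lambda>u. f ((q, y, j) # (p, x, i) # u)) w + der r z n (\<lambda>u. f ((p + q, br x y, i + j) # u)) w"
      by (simp add: der_add_fun der_scale_fun)
    have zx: "f ((r + p, br z x, i + n) # (q, y, j) # w) =
        koszul (r + p) q *\<^sub>C f ((q, y, j) # (r + p, br z x, i + n) # w) + f (((r + p) + q, br (br z x) y, i + n + j) # w)"
      using commutationD[OF cm, of "[]" w "br z x" "r + p" y q "i + n" j] w x y assms(3) by simp
    have zy: "f ((p, x, i) # (r + q, br z y, j + n) # w) =
        koszul p (r + q) *\<^sub>C f ((r + q, br z y, j + n) # (p, x, i) # w) + f ((p + (r + q), br x (br z y), i + (j + n)) # w)"
      using commutationD[OF cm, of "[]" w x p "br z y" "r + q" i "j + n"] w x y assms(3) by simp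
    have J: "f ((r + (p + q), br z (br x y), i + j + n) # w) =
        f (((r + p) + q, br (br z x) y, i + n + j) # w) + koszul r p *\<^sub>C f ((p + (r + q), br x (br z y), i + (j + n)) # w)"
    proof -
      have idx: "(r + p) + q = r + (p + q)" "p + (r + q) = r + (p + q)" "i + n + j = i + j + n" "i + (j + n) = i + j + n"
        by (simp_all add: add_ac)
      have "br (br z x) y \<in> G (r + (p + q))" "br x (br z y) \<in> G (r + (p + q))"
        using br_closed[OF br_closed[OF assms(3) x] y] br_closed[OF x br_closed[OF assms(3) y]] by (simp_all add: add_ac)
      then show ?thesis
        using multilinear_add[OF ml, of "[]" w] multilinear_scale[OF ml, of "[]" w] w
        unfolding idx by (simp add: jacobi[OF assms(3) x y])
    qed
    define a b c where "a = koszul r p" and "b = koszul r q" and "c = koszul p q"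
    have k: "koszul r p = a" "koszul r q = b" "koszul p q = c" "koszul (r + p) q = b * c"
        "koszul p (r + q) = a * c" "koszul r (p + q) = a * b"
      using koszul_commute[of p "r + q"] koszul_commute[of r "p + q"] koszul_commute[of q p]
        koszul_commute[of p r] koszul_commute[of q r]
      by (simp_all add: a_def b_def c_def koszul_add)
    have sq: "a * (a * t) = t" for t
      using koszul_square[of r p] by (simp add: a_def flip: mult.assoc)
    show ?case
      unfolding append_Nil two[OF x y] two[OF y x] one inner zx zy J k
      by (simp add: scaleC_add_right scaleC_scaleC sq mult_ac add_ac)
  next
    case (Cons l u)
    note ml = Cons.prems(1)
    obtain s t k where l: "l = (s, t, k)" by (cases l)
    from Cons.prems obtain L' where L: "L = Suc L'" by (cases L) auto
    have t: "t \<in> G s" and u: "valid u" using Cons.prems l by simp_all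
    have IH: "der r z n (\<lambda>u. f (l # u)) (u @ (p, x, i) # (q, y, j) # w) =
       koszul p q *\<^sub>C der r z n (\<lambda>u. f (l # u)) (u @ (q, y, j) # (p, x, i) # w) +
       der r z n (\<lambda>u. f (l # u)) (u @ (p + q, br x y, i + j) # w)"
      by (rule Cons.IH[of L'])
        (use Cons.prems multilinear_tail[of L' f t s k] commutation_tail[of L' f t s k] L l in simp_all)
    have head: "f ((r + s, br z t, k + n) # u @ (p, x, i) # (q, y, j) # w) =
        koszul p q *\<^sub>C f ((r + s, br z t, k + n) # u @ (q, y, j) # (p, x, i) # w) +
        f ((r + s, br z t, k + n) # u @ (p + q, br x y, i + j) # w)"
      using commutationD[OF Cons.prems(2), of "(r + s, br z t, k + n) # u" w x p y q i j] Cons.prems t u assms(3) by simp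
    show ?case
      using Cons.prems t assms(3) IH head unfolding l
      by (simp add: der_Cons[OF ml] scaleC_add_right scaleC_scaleC mult_ac add_ac)
  qed
  from this[OF assms(1,2)] show ?thesis
    unfolding commutation_def by blast
qed

text \<open>The matrix elements of words between the vacuum and the components of weight zero and one. A
  creation mode \<open>x\<^sub>-\<^sub>1\<close> on the left turns the functional of weight one into a multiple of the one of
  weight zero, which at level zero vanishes on nonempty words. An annihilation mode is commuted
  to the right, where it kills the vacuum. The value \<open>(x, 0)\<close> at the word \<open>x\<^sub>-\<^sub>1\<close> makes the currents independent.\<close>

function correlator :: "'g word \<Rightarrow> 'g \<times> complex" where
  "correlator [] = (0, 1)"
| "correlator ((p, x, n) # w) =
     (if n < 0 then if w = [] \<and> n = -1 then (x, 0) else 0 else der p x n correlator w)"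
  by pat_completeness auto

termination by (relation "measure length") auto

declare correlator.simps(2) [simp del]

lemma correlator_neg: "n < 0 \<Longrightarrow> w \<noteq> [] \<Longrightarrow> correlator ((p, x, n) # w) = 0"
  by (simp add: correlator.simps(2))

lemma correlator_nonneg: "0 \<le> n \<Longrightarrow> correlator ((p, x, n) # w) = der p x n correlator w"
  by (simp add: correlator.simps(2))

text \<open>Induction on the length. If the first letter takes no part in the relation, a creation mode gives
  zero on both sides, and an annihilation mode is a derivation, which preserves the relation for
  shorter words.\<close>

lemma correlator_laws: "multilinear L correlator \<and> commutation L correlator \<and> kills_vacuum L correlator"
proof (induction L)
  case 0
  then show ?case by (simp add: multilinear_def commutation_def kills_vacuum_def)
next
  case (Suc L)
  then have ml: "multilinear L correlator" and cm: "commutation L correlator" and kv: "kills_vacuum L correlator" by auto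
  have "multilinear (Suc L) correlator"
    unfolding multilinear_def
  proof (intro allI impI)
    fix u w :: "'g word" and q m
    assume A: "valid u" "valid w" "length u + length w < Suc L"
    show "(\<forall>x\<in>G q. \<forall>y\<in>G q. correlator (u @ (q, x + y, m) # w) = correlator (u @ (q, x, m) # w) + correlator (u @ (q, y, m) # w)) \<and>
          (\<forall>x\<in>G q. \<forall>c. correlator (u @ (q, c *\<^sub>C x, m) # w) = c *\<^sub>C correlator (u @ (q, x, m) # w))"
    proof (cases u)
      case Nil
      show ?thesis
      proof (cases "m < 0")
        case True
        then show ?thesis using Nil by (auto simp: correlator.simps(2) scaleC_prod_def zero_prod_def)
      next
        case False
        then show ?thesis using Nil A by (simp add: correlator_nonneg der_add[OF ml] der_scale[OF ml])
      qed
    next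
      case (Cons l u')
      obtain r t k where l: "l = (r, t, k)" by (cases l)
      show ?thesis
      proof (cases "k < 0")
        case True
        then show ?thesis using Cons l by (simp add: correlator_neg)
      next
        case False
        have "t \<in> G r" using A Cons l by simp
        then show ?thesis
          using Cons l False A multilinear_add[OF der_multilinear[OF ml], of t r u' w]
            multilinear_scale[OF der_multilinear[OF ml], of t r u' w] by (simp add: correlator_nonneg)
      qed
    qed
  qed
  moreover have "commutation (Suc L) correlator"
    unfolding commutation_def
  proof (intro allI impI ballI)
    fix u w :: "'g word" and p m q n x y
    assume A: "valid u" "valid w" "length u + length w + 2 \<le> Suc L" "x \<in> G p" "y \<in> G q"
    show "correlator (u @ (p, x, m) # (q, y, n) # w) =
      koszul p q *\<^sub>C correlator (u @ (q, y, n) # (p, x, m) # w) + correlator (u @ (p + q, br x y, m + n) # w)"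
    proof (cases u)
      case (Cons l u')
      obtain r t k where l: "l = (r, t, k)" by (cases l)
      show ?thesis
      proof (cases "k < 0")
        case True
        then show ?thesis using Cons l by (simp add: correlator_neg)
      next
        case False
        have "t \<in> G r" using A Cons l by simp
        then have "der r t k correlator (u' @ (p, x, m) # (q, y, n) # w) =
            koszul p q *\<^sub>C der r t k correlator (u' @ (q, y, n) # (p, x, m) # w) + der r t k correlator (u' @ (p + q, br x y, m + n) # w)"
          using Cons A l by (intro commutationD[OF der_commutation[OF ml cm]]) simp_all
        then show ?thesis using Cons l False by (simp add: correlator_nonneg)
      qed
    next
      case Nil
      have w: "valid w" "length w < L" "length w \<le> L" using A Nil by simp_all
      have sk: "correlator ((p + q, br x y, m + n) # w) = - (koszul p q *\<^sub>C correlator ((q + p, br y x, n + m) # w))" for m n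
      proof -
        have "br y x \<in> G (p + q)" using A br_closed[of y q x p] by (simp add: add.commute)
        moreover have "multilinear (Suc L) correlator" by fact
        ultimately show ?thesis
          using w A multilinear_scale[of "Suc L" correlator "[]" w "br y x" "p + q" "- koszul p q" "m + n"] skew[of x p y q]
          by (simp add: add.commute)
      qed
      have mixed: "correlator ((p, x, m) # (q, y, n) # w) = correlator ((p + q, br x y, m + n) # w)"
        if "0 \<le> m" "n < 0" "x \<in> G p" "y \<in> G q" for p x m q y n
      proof -
        have "der p x m (\<lambda>u. correlator ((q, y, n) # u)) w = 0"
        proof (cases w)
          case (Cons l w')
          show ?thesis
          proof (rule der_zero_fun)
            fix u :: "'g word" assume "length u = length w"
            with Cons have "u \<noteq> []" by auto
            then show "correlator ((q, y, n) # u) = 0" by (rule correlator_neg[OF that(2)])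
          qed
        qed simp
        then show ?thesis using that w by (simp add: correlator_nonneg der_Cons[OF ml] add.commute)
      qed
      \<comment> \<open>For two creation modes also \<open>[x, y]\<^sub>m\<^sub>+\<^sub>n\<close> gives zero, because \<open>m + n \<le> -2\<close>.\<close>
      consider "m < 0" "n < 0" | "m < 0" "0 \<le> n" | "0 \<le> m" "n < 0" | "0 \<le> m" "0 \<le> n" by linarith
      then show ?thesis
      proof cases
        case 1
        then show ?thesis using Nil by (simp add: correlator_neg) (simp add: correlator.simps(2))
      next
        case 2
        then show ?thesis
          using Nil sk[of m n] mixed[of n m y q x p] A by (simp add: correlator_neg)
      next
        case 3
        then show ?thesis using Nil mixed[of m n x p y q] A by (simp add: correlator_neg)
      next
        case 4
        have two: "correlator ((p, x, m) # (q, y, n) # w) = correlator ((p + q, br x y, m + n) # w) + koszul p q *\<^sub>C der p x m (der q y n correlator) w"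
          if "0 \<le> m" "0 \<le> n" "x \<in> G p" "y \<in> G q" for p x m q y n
          using that w by (simp add: correlator_nonneg der_Cons[OF ml] add.commute)
        \<comment> \<open>Two annihilation modes give \<open>2 [x, y] - [x, y]\<close>: each order of the letters yields one
          bracket, and the commutator of the derivations takes one back.\<close>
        have dd: "der q y n (der p x m correlator) w =
            koszul p q *\<^sub>C der p x m (der q y n correlator) w + correlator ((p + q, br x y, m + n) # w)"
          using der_der[OF ml w(1,3) A(4,5), of n m] 4 by (simp add: correlator_nonneg)
        have sq: "koszul p q * koszul p q = 1" by (rule koszul_square)
        show ?thesis
          unfolding Nil append_Nil two[OF 4 A(4,5)] two[OF 4(2,1) A(5,4)] koszul_commute[of q p] dd
          using sk[of m n] sq
          by (simp add: scaleC_add_right scaleC_scaleC scaleC_one)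
      qed
    qed
  qed
  moreover have "kills_vacuum (Suc L) correlator"
    unfolding kills_vacuum_def
  proof (intro allI impI ballI)
    fix u :: "'g word" and p x and n :: int
    assume A: "valid u" "length u < Suc L" "0 \<le> n" "x \<in> G p"
    show "correlator (u @ [(p, x, n)]) = 0"
    proof (cases u)
      case Nil
      then show ?thesis using A by (simp add: correlator_nonneg)
    next
      case (Cons l u')
      obtain r t k where l: "l = (r, t, k)" by (cases l)
      show ?thesis
      proof (cases "k < 0")
        case True
        then show ?thesis using Cons l by (simp add: correlator_neg)
      next
        case False
        have "t \<in> G r" using A Cons l by simp
        then have "der r t k correlator (u' @ [(p, x, n)]) = 0"
          using Cons A l False by (intro kills_vacuumD[OF der_kills_vacuum[OF ml kv]]) simp_all
        then show ?thesis using Cons l False by (simp add: correlator_nonneg)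
      qed
    qed
  qed
  ultimately show ?case by blast
qed

section \<open>The vacuum module and its currents\<close>

text \<open>An element of the module is represented by the function that sends a word \<open>u\<close> to the correlation
  function of \<open>u\<close> followed by the element. A letter then acts by appending it to \<open>u\<close>, which realizes
  the module inside a function space. Ill-formed words get the value zero, so that relations between
  modes hold as equalities of functions.\<close>

definition vac :: "'g word \<Rightarrow> 'g \<times> complex" where
  "vac u = (if valid u then correlator u else 0)"

definition act :: "bit \<Rightarrow> 'g \<Rightarrow> int \<Rightarrow> ('g word \<Rightarrow> 'g \<times> complex) \<Rightarrow> 'g word \<Rightarrow> 'g \<times> complex" where
  "act p x n F = (\<lambda>u. F (u @ [(p, x, n)]))"

text \<open>Only what is generated from the vacuum is allowed, as uniqueness of fields requires.\<close>

inductive_set vacuum_module :: "('g word \<Rightarrow> 'g \<times> complex) set" where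
  vac: "vac \<in> vacuum_module"
| zero: "0 \<in> vacuum_module"
| add: "F \<in> vacuum_module \<Longrightarrow> H \<in> vacuum_module \<Longrightarrow> F + H \<in> vacuum_module"
| scale: "F \<in> vacuum_module \<Longrightarrow> c *\<^sub>C F \<in> vacuum_module"
| act: "F \<in> vacuum_module \<Longrightarrow> x \<in> G p \<Longrightarrow> act p x n F \<in> vacuum_module"

lemma vacuum_module_subspace: "cvec.subspace vacuum_module"
  by (simp add: cvec.subspace_def vacuum_module.intros)

lemma act_linear:
  "act p x n (F + H) = act p x n F + act p x n H" "act p x n (c *\<^sub>C F) = c *\<^sub>C act p x n F" "act p x n 0 = 0"
  by (simp_all add: act_def fun_eq_iff)

lemma vacuum_module_invalid: "F \<in> vacuum_module \<Longrightarrow> \<not> valid u \<Longrightarrow> F u = 0"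
  by (induction arbitrary: u rule: vacuum_module.induct) (auto simp: vac_def act_def)

lemma vacuum_module_multilinear: "F \<in> vacuum_module \<Longrightarrow> multilinear L F"
proof (induction arbitrary: L rule: vacuum_module.induct)
  case vac
  then show ?case
    using correlator_laws[of L] by (simp add: multilinear_def vac_def)
next
  case (act F x p n)
  show ?case
    unfolding multilinear_def act_def
    using act.hyps multilinear_add[OF act.IH[of "Suc L"], of _ "w @ [(p, x, n)]" for w]
      multilinear_scale[OF act.IH[of "Suc L"], of _ "w @ [(p, x, n)]" for w]
    by simp
qed (simp_all add: multilinear_def scaleC_add_right add_ac scaleC_scaleC mult.commute)

lemma vacuum_module_commutation: "F \<in> vacuum_module \<Longrightarrow> commutation L F"
proof (induction arbitrary: L rule: vacuum_module.induct)
  case vac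
  show ?case
    unfolding commutation_def
  proof (intro allI impI ballI)
    fix u w :: "'g word" and p m q n x y
    assume "valid u" "valid w" "length u + length w + 2 \<le> L" "x \<in> G p" "y \<in> G q"
    then show "vac (u @ (p, x, m) # (q, y, n) # w) =
        koszul p q *\<^sub>C vac (u @ (q, y, n) # (p, x, m) # w) + vac (u @ (p + q, br x y, m + n) # w)"
      using commutationD[of L correlator u w x p y q m n] correlator_laws[of L] by (simp add: vac_def)
  qed
next
  case (act F z r k)
  show ?case
    unfolding commutation_def
  proof (intro allI impI ballI)
    fix u w :: "'g word" and p m q n x y
    assume "valid u" "valid w" "length u + length w + 2 \<le> L" "x \<in> G p" "y \<in> G q"
    then show "act r z k F (u @ (p, x, m) # (q, y, n) # w) =
        koszul p q *\<^sub>C act r z k F (u @ (q, y, n) # (p, x, m) # w) + act r z k F (u @ (p + q, br x y, m + n) # w)"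
      using commutationD[OF act.IH[of "Suc L"], of u "w @ [(r, z, k)]" x p y q m n] act.hyps by (simp add: act_def)
  qed
next
  case (add F H)
  show ?case
    unfolding commutation_def
  proof (intro allI impI ballI)
    fix u w :: "'g word" and p m q n x y
    assume "valid u" "valid w" "length u + length w + 2 \<le> L" "x \<in> G p" "y \<in> G q"
    then show "(F + H) (u @ (p, x, m) # (q, y, n) # w) =
        koszul p q *\<^sub>C (F + H) (u @ (q, y, n) # (p, x, m) # w) + (F + H) (u @ (p + q, br x y, m + n) # w)"
      using commutationD[OF add.IH(1)[of L], of u w x p y q m n] commutationD[OF add.IH(2)[of L], of u w x p y q m n]
      by (simp add: scaleC_add_right)
  qed
next
  case (scale F c)
  show ?case
    unfolding commutation_def
  proof (intro allI impI ballI)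
    fix u w :: "'g word" and p m q n x y
    assume "valid u" "valid w" "length u + length w + 2 \<le> L" "x \<in> G p" "y \<in> G q"
    then show "(c *\<^sub>C F) (u @ (p, x, m) # (q, y, n) # w) =
        koszul p q *\<^sub>C (c *\<^sub>C F) (u @ (q, y, n) # (p, x, m) # w) + (c *\<^sub>C F) (u @ (p + q, br x y, m + n) # w)"
      using commutationD[OF scale.IH[of L], of u w x p y q m n]
      by (simp add: scaleC_add_right scaleC_scaleC mult.commute)
  qed
qed (simp add: commutation_def)

lemma act_add: "F \<in> vacuum_module \<Longrightarrow> x \<in> G p \<Longrightarrow> y \<in> G p \<Longrightarrow> act p (x + y) n F = act p x n F + act p y n F"
proof
  fix u assume F: "F \<in> vacuum_module" "x \<in> G p" "y \<in> G p"
  show "act p (x + y) n F u = (act p x n F + act p y n F) u"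
  proof (cases "valid u")
    case True
    then show ?thesis
      using multilinear_add[OF vacuum_module_multilinear[OF F(1), of "Suc (length u)"], of u "[]"] F by (simp add: act_def)
  qed (simp add: act_def vacuum_module_invalid F)
qed

lemma act_scale: "F \<in> vacuum_module \<Longrightarrow> x \<in> G p \<Longrightarrow> act p (c *\<^sub>C x) n F = c *\<^sub>C act p x n F"
proof
  fix u assume F: "F \<in> vacuum_module" "x \<in> G p"
  show "act p (c *\<^sub>C x) n F u = (c *\<^sub>C act p x n F) u"
  proof (cases "valid u")
    case True
    then show ?thesis
      using multilinear_scale[OF vacuum_module_multilinear[OF F(1), of "Suc (length u)"], of u "[]"] F by (simp add: act_def)
  qed (simp add: act_def vacuum_module_invalid F)
qed

lemma act_commute:
  assumes "F \<in> vacuum_module" "x \<in> G p" "y \<in> G q"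
  shows "act p x m (act q y n F) = koszul p q *\<^sub>C act q y n (act p x m F) + act (p + q) (br x y) (m + n) F"
proof
  fix u
  show "act p x m (act q y n F) u = (koszul p q *\<^sub>C act q y n (act p x m F) + act (p + q) (br x y) (m + n) F) u"
  proof (cases "valid u")
    case True
    then show ?thesis
      using commutationD[OF vacuum_module_commutation[OF assms(1), of "length u + 2"], of u "[]" x p y q m n] assms by (simp add: act_def)
  qed (simp add: act_def vacuum_module_invalid assms)
qed

text \<open>Commuting a mode of high index to the right yields modes of high index only.\<close>

lemma act_bounded: "F \<in> vacuum_module \<Longrightarrow> \<exists>N. \<forall>n\<ge>N. \<forall>p. \<forall>x\<in>G p. act p x n F = 0"
proof (induction rule: vacuum_module.induct)
  case vac
  have "act p x n vac = 0" if "0 \<le> n" "x \<in> G p" for n p x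
  proof
    fix u
    show "act p x n vac u = 0 u"
      using that correlator_laws[of "Suc (length u)"] kills_vacuumD[of "Suc (length u)" correlator u n x p]
      by (simp add: act_def vac_def)
  qed
  then show ?case by blast
next
  case zero
  show ?case by (simp only: act_linear) simp
next
  case (add F H)
  then obtain M N where "\<forall>n\<ge>M. \<forall>p. \<forall>x\<in>G p. act p x n F = 0" "\<forall>n\<ge>N. \<forall>p. \<forall>x\<in>G p. act p x n H = 0" by blast
  then show ?case by (intro exI[of _ "max M N"]) (simp add: act_linear(1) del: plus_fun_apply)
next
  case (scale F c)
  then show ?case by (elim exE, intro exI) (auto simp: act_linear(2) simp del: scaleC_fun_apply zero_fun_apply)
next
  case (act F y q m)
  then obtain N where N: "\<And>n p x. n \<ge> N \<Longrightarrow> x \<in> G p \<Longrightarrow> act p x n F = 0" by blast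
  have "act p x n (act q y m F) = 0" if "n \<ge> max N (N - m)" "x \<in> G p" for n p x
    using that act.hyps N[of n x p] N[of "n + m" "br x y" "p + q"] by (simp add: act_commute act_linear)
  then show ?case by blast
qed

text \<open>The module depends on \<open>\<gg>\<close> and is therefore not a type. Composing with a linear projection onto it
  extends its operators to fields on the whole function space.\<close>

definition proj :: "('g word \<Rightarrow> 'g \<times> complex) \<Rightarrow> 'g word \<Rightarrow> 'g \<times> complex" where
  "proj = (SOME g. clinear g \<and> range g \<subseteq> vacuum_module \<and> (\<forall>F\<in>vacuum_module. g F = F))"

lemma proj: "clinear proj" "proj F \<in> vacuum_module" "F \<in> vacuum_module \<Longrightarrow> proj F = F"
proof -
  interpret vp: vector_space_pair
    "scaleC :: complex \<Rightarrow> ('g word \<Rightarrow> 'g \<times> complex) \<Rightarrow> _" "scaleC :: complex \<Rightarrow> ('g word \<Rightarrow> 'g \<times> complex) \<Rightarrow> _"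
    by unfold_locales
  have "clinear (\<lambda>F :: 'g word \<Rightarrow> 'g \<times> complex. F)" by (rule clinearI) simp_all
  from vp.linear_exists_left_inverse_on[OF this vacuum_module_subspace]
  have "\<exists>g :: ('g word \<Rightarrow> 'g \<times> complex) \<Rightarrow> _. clinear g \<and> range g \<subseteq> vacuum_module \<and> (\<forall>F\<in>vacuum_module. g F = F)" by auto
  from someI_ex[OF this] show "clinear proj" "proj F \<in> vacuum_module" "F \<in> vacuum_module \<Longrightarrow> proj F = F"
    unfolding proj_def[symmetric] by auto
qed

definition current :: "bit \<Rightarrow> 'g \<Rightarrow> ('g word \<Rightarrow> 'g \<times> complex) vfield" where
  "current p x = Abs_vfield (\<lambda>n F. act p x n (proj F))"

lemma mode_current: "x \<in> G p \<Longrightarrow> mode (current p x) n F = act p x n (proj F)"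
proof -
  assume x: "x \<in> G p"
  have "(\<lambda>n F. act p x n (proj F)) \<in> {a. (\<forall>n. clinear (a n)) \<and> (\<forall>v. \<exists>N. \<forall>n\<ge>N. a n v = 0)}"
  proof (safe)
    fix n
    show "clinear (\<lambda>F. act p x n (proj F))"
      using proj(1) by (intro clinearI) (simp_all add: clinear_iff act_linear)
  next
    fix F show "\<exists>N. \<forall>n\<ge>N. act p x n (proj F) = 0"
      using act_bounded[OF proj(2), of F] x by blast
  qed
  then show ?thesis by (simp add: current_def Abs_vfield_inverse)
qed

lemma current_linear:
  "x \<in> G p \<Longrightarrow> y \<in> G p \<Longrightarrow> current p (x + y) = current p x + current p y"
  "x \<in> G p \<Longrightarrow> current p (c *\<^sub>C x) = c *\<^sub>C current p x"
  by (rule vfield_eqI, simp add: mode_current act_add act_scale proj(2))+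

lemma current_zero [simp]: "current p 0 = 0"
  using current_linear(2)[of 0 p 0] by simp

lemma current_commutator:
  assumes "x \<in> G p" "y \<in> G q"
  shows "ope (koszul p q) (current p x) (current q y) 0 m n F = mode (current (p + q) (br x y)) (m + n) F"
  unfolding ope_0 mode_current[OF assms(1)] mode_current[OF assms(2)] mode_current[OF br_closed[OF assms]]
    proj(3)[OF vacuum_module.act[OF proj(2) assms(1)]] proj(3)[OF vacuum_module.act[OF proj(2) assms(2)]]
    act_commute[OF proj(2) assms] by (rule add_diff_cancel_left')

lemma current_ope:
  assumes "x \<in> G p" "y \<in> G q" "1 \<le> k"
  shows "ope (koszul p q) (current p x) (current q y) k m n F = 0"
proof (rule ope_eq_0_above[OF _ assms(3)])
  fix m n :: int and F
  have "m + 1 + n = m + (n + 1)" by simp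
  then show "ope (koszul p q) (current p x) (current q y) 1 m n F = 0"
    using ope_step[of "koszul p q" "current p x" "current q y" 0 m n F]
    by (simp only: current_commutator[OF assms(1,2)] add_0 diff_self)
qed

lemma current_local: "x \<in> G p \<Longrightarrow> y \<in> G q \<Longrightarrow> mutually_local (koszul p q) (current p x) (current q y)"
  unfolding mutually_local_def using current_ope by blast

lemma current_creative: "x \<in> G p \<Longrightarrow> creative vac (current p x)"
  using correlator_laws kills_vacuumD[of "Suc (length u)" correlator u n x p for u n]
  by (auto simp: creative_def mode_current proj vacuum_module.vac act_def vac_def fun_eq_iff)

lemma current_stable: "x \<in> G p \<Longrightarrow> mode (current p x) n F \<in> vacuum_module"
  by (simp add: mode_current vacuum_module.act proj(2))

text \<open>Goddard's uniqueness theorem: a field that is local to the currents and kills the vacuum kills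
  everything that the currents generate from it.\<close>

lemma annihilates_vacuum_module:
  assumes "\<And>x p. x \<in> G p \<Longrightarrow> mutually_local (koszul q p) c (current p x)" "\<And>n. mode c n vac = 0" "F \<in> vacuum_module"
  shows "mode c n F = 0"
  using assms(3)
proof (induction arbitrary: n rule: vacuum_module.induct)
  case (act F x p m)
  have "mode c n (mode (current p x) m F) = 0"
    by (rule local_annihilates[OF assms(1)]) (fact act)+
  then show ?case
    unfolding mode_current[OF act.hyps(2)] proj(3)[OF act.hyps(1)] .
qed (simp_all only: assms(2) mode_add mode_scale mode_zero cvec.scale_zero_right add_0)

section \<open>The map from the free algebra to fields\<close>

abbreviation S where "S \<equiv> souped_up_const G br"

definition even_part :: "'g \<Rightarrow> 'g" where
  "even_part x = (THE y. y \<in> G 0 \<and> x - y \<in> G 1)"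

lemma even_part: "even_part x \<in> G 0" "x - even_part x \<in> G 1"
  using theI'[of "\<lambda>y. y \<in> G 0 \<and> x - y \<in> G 1"] grading by (auto simp: super_grading_def even_part_def)

lemma even_part_eqI: "y \<in> G 0 \<Longrightarrow> x - y \<in> G 1 \<Longrightarrow> even_part x = y"
  using grading even_part[of x] unfolding super_grading_def by blast

lemma even_part_linear:
  "even_part (x + y) = even_part x + even_part y" "even_part (c *\<^sub>C x) = c *\<^sub>C even_part x"
proof -
  have "x + y - (even_part x + even_part y) = (x - even_part x) + (y - even_part y)" by simp
  then show "even_part (x + y) = even_part x + even_part y"
    using even_part[of x] even_part[of y] by (intro even_part_eqI) (simp_all only: G_closed)
  have "c *\<^sub>C x - c *\<^sub>C even_part x = c *\<^sub>C (x - even_part x)" by (simp add: cvec.scale_right_diff_distrib)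
  then show "even_part (c *\<^sub>C x) = c *\<^sub>C even_part x"
    using even_part[of x] by (intro even_part_eqI) (simp_all only: G_closed)
qed

lemma even_part_homogeneous: "x \<in> G 0 \<Longrightarrow> even_part x = x" "x \<in> G 1 \<Longrightarrow> even_part x = 0"
  by (rule even_part_eqI; simp)+

definition gen_field :: "'g \<times> complex \<Rightarrow> ('g word \<Rightarrow> 'g \<times> complex) vfield \<times> ('g word \<Rightarrow> 'g \<times> complex) vfield" where
  "gen_field s = (current 0 (even_part (fst s)) + snd s *\<^sub>C id_field, current 1 (fst s - even_part (fst s)))"

lemma clinear_gen_field: "clinear gen_field"
proof (rule clinearI)
  fix s t :: "'g \<times> complex" and c
  have "current 1 (fst s + fst t - (even_part (fst s) + even_part (fst t))) =
      current 1 ((fst s - even_part (fst s)) + (fst t - even_part (fst t)))" by (simp add: add_diff_add)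
  also have "\<dots> = current 1 (fst s - even_part (fst s)) + current 1 (fst t - even_part (fst t))"
    by (rule current_linear(1)) (rule even_part(2))+
  finally show "gen_field (s + t) = gen_field s + gen_field t"
    by (simp add: gen_field_def even_part_linear current_linear even_part scaleC_add_left)
  show "gen_field (c *\<^sub>C s) = c *\<^sub>C gen_field s"
    by (simp add: gen_field_def even_part_linear current_linear even_part scaleC_prod_def
        scaleC_add_right scaleC_scaleC cvec.scale_right_diff_distrib[symmetric] scaleC_complex_def)
qed

definition field_of :: "('g \<times> complex) free_alg \<Rightarrow> ('g word \<Rightarrow> 'g \<times> complex) vfield \<times> ('g word \<Rightarrow> 'g \<times> complex) vfield" where
  "field_of = (THE \<phi>. clinear \<phi> \<and> (\<forall>v. \<phi> (gen v) = gen_field v) \<and> (\<forall>x n y. \<phi> (x \<star>\<^bsub>n\<^esub> y) = super_prod (\<phi> x) n (\<phi> y)))"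

lemma field_of: "clinear field_of" "field_of (gen v) = gen_field v" "field_of (x \<star>\<^bsub>n\<^esub> y) = super_prod (field_of x) n (field_of y)"
  using theI'[OF free_alg_universal[where m = super_prod, OF clinear_gen_field cbilinear_super_prod]]
  unfolding field_of_def[symmetric] by blast+

lemma field_of_linear:
  "field_of (x + y) = field_of x + field_of y" "field_of (c *\<^sub>C x) = c *\<^sub>C field_of x" "field_of 0 = 0"
  "field_of (x - y) = field_of x - field_of y" "field_of (sum f A) = (\<Sum>i\<in>A. field_of (f i))"
proof -
  interpret Vector_Spaces.linear scaleC scaleC field_of by (rule field_of(1))
  show "field_of (x + y) = field_of x + field_of y" "field_of (c *\<^sub>C x) = c *\<^sub>C field_of x" "field_of 0 = 0"
    "field_of (x - y) = field_of x - field_of y" "field_of (sum f A) = (\<Sum>i\<in>A. field_of (f i))"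
    by (rule add scale zero diff sum)+
qed

lemma field_of_unit: "field_of (gen (0, c)) = (c *\<^sub>C id_field, 0)"
  by (simp add: field_of(2) gen_field_def even_part_homogeneous)

lemma field_of_transl: "field_of (transl (0, 1) x) = super_deriv (field_of x)"
  by (simp add: transl_def field_of(3) field_of_unit scaleC_one super_prod_unit_right)

lemma field_of_transl_pow: "field_of ((transl (0, 1) ^^ k) x) = (super_deriv ^^ k) (field_of x)"
  by (induction k) (simp_all add: field_of_transl)

lemma field_of_gen_homogeneous:
  assumes "x \<in> G p" "p = 0 \<or> c = 0"
  shows "field_of (gen (x, c)) = homog p (current p x + c *\<^sub>C id_field)"
  using assms by (cases p) (auto simp: field_of(2) gen_field_def even_part_homogeneous homog_def)

text \<open>Fields matter only through their action on the module: associativity is established there and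
  not on the rest of the function space.\<close>

definition kernel :: "('g \<times> complex) free_alg set" where
  "kernel = {x. \<forall>n. \<forall>v\<in>vacuum_module. mode (fst (field_of x)) n v = 0 \<and> mode (snd (field_of x)) n v = 0}"

lemma kernel_homog: "field_of x = homog p a \<Longrightarrow> x \<in> kernel \<longleftrightarrow> (\<forall>n. \<forall>v\<in>vacuum_module. mode a n v = 0)"
  by (simp add: kernel_def homog_def)

lemma kernelI: "field_of x = 0 \<Longrightarrow> x \<in> kernel"
  by (simp add: kernel_def)

definition stable :: "('g word \<Rightarrow> 'g \<times> complex) vfield \<Rightarrow> bool" where
  "stable a \<longleftrightarrow> (\<forall>n. \<forall>v\<in>vacuum_module. mode a n v \<in> vacuum_module)"

lemma stable_nprod:
  assumes "stable a" "stable b"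
  shows "stable (nprod \<kappa> a n b)"
  unfolding stable_def mode_nprod ope_def
  using assms
  by (intro allI ballI cvec.subspace_diff cvec.subspace_scale diffpow_in_subspace vacuum_module_subspace) (simp_all add: stable_def)

lemma stable_linear: "stable a \<Longrightarrow> stable b \<Longrightarrow> stable (a + b)" "stable a \<Longrightarrow> stable (c *\<^sub>C a)"
  unfolding stable_def mode_add_field mode_scale_field by (blast intro: vacuum_module.add vacuum_module.scale)+

lemma stable_basic: "stable 0" "stable id_field" "x \<in> G p \<Longrightarrow> stable (current p x)"
  unfolding stable_def mode_zero_field mode_id by (auto intro: vacuum_module.zero current_stable)

lemma stable_rep: "stable (fst (field_of x)) \<and> stable (snd (field_of x))"
  by (induction x rule: free_alg_induct)
    (simp_all add: field_of gen_field_def field_of_linear scaleC_prod_def super_prod_def stable_linear stable_nprod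
      stable_basic even_part)

lemma nprod_annihilates:
  assumes "v \<in> vacuum_module" "stable a" "\<And>n v. v \<in> vacuum_module \<Longrightarrow> mode b n v = 0"
  shows "mode (nprod \<kappa> a n b) m v = 0" "mode (nprod \<kappa> b n a) m v = 0"
  using assms by (simp_all add: mode_nprod ope_def stable_def)

lemma kernel_ideal:
  "x \<in> kernel \<Longrightarrow> y \<star>\<^bsub>n\<^esub> x \<in> kernel" "x \<in> kernel \<Longrightarrow> x \<star>\<^bsub>n\<^esub> y \<in> kernel"
  using stable_rep[of y] nprod_annihilates by (simp_all add: kernel_def field_of super_prod_def)

definition generators :: "(bit \<times> ('g word \<Rightarrow> 'g \<times> complex) vfield) set" where
  "generators = {(p, current p x + c *\<^sub>C id_field) | p x c. x \<in> G p \<and> (p = 0 \<or> c = 0)}"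

lemma current_generator: "x \<in> G p \<Longrightarrow> (p, current p x) \<in> generators"
  unfolding generators_def by (intro CollectI exI[of _ p] exI[of _ x] exI[of _ 0]) simp

lemma local_gen:
  assumes "x \<in> G p" "p = 0 \<or> c = 0" "mutually_local (koszul p q) (current p x) b"
  shows "mutually_local (koszul p q) (current p x + c *\<^sub>C id_field) b"
proof (rule local_add[OF assms(3)])
  show "mutually_local (koszul p q) (c *\<^sub>C id_field) b"
    using assms(2) local_scale[OF local_id] by (cases "c = 0") (auto simp: local_zero)
qed

lemma generators_local: "pairwise_local generators"
  unfolding pairwise_local_def generators_def
proof clarify
  fix p q x y and c d :: complex
  assume *: "x \<in> G p" "p = 0 \<or> c = 0" "y \<in> G q" "q = 0 \<or> d = 0"
  have "mutually_local (koszul q p) (current q y + d *\<^sub>C id_field) (current p x)"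
    by (intro local_gen current_local *)
  then have "mutually_local (koszul p q) (current p x) (current q y + d *\<^sub>C id_field)"
    by (rule local_koszul_sym)
  then show "mutually_local (koszul p q) (current p x + c *\<^sub>C id_field) (current q y + d *\<^sub>C id_field)"
    by (intro local_gen *)
qed

text \<open>Locality of arbitrary images cannot be shown for two elements at a time, since Dong's lemma
  for a product needs locality of its factors with each other. Quantifying over all pairwise local
  sets \<open>T\<close> makes the induction work: the factors are inserted one after the other, and then their
  product.\<close>

lemma field_of_homogeneous:
  assumes "has_parity (s_part S) p x"
  shows "\<exists>a. field_of x = homog p a \<and> creative vac a \<and>
    (\<forall>T. generators \<subseteq> T \<longrightarrow> pairwise_local T \<longrightarrow> pairwise_local (insert (p, a) T))"
  using assms
proof (induction rule: has_parity.induct)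
  case (gen v p)
  obtain x c where v: "v = (x, c)" by (cases v)
  with gen have x: "x \<in> G p" and c: "p = 0 \<or> c = 0"
    by (auto simp: s_part_def souped_up_const_def split: if_splits)
  have "(p, current p x + c *\<^sub>C id_field) \<in> generators"
    using x c by (auto simp: generators_def)
  then have "pairwise_local (insert (p, current p x + c *\<^sub>C id_field) T)"
    if "generators \<subseteq> T" "pairwise_local T" for T
    using that by (simp add: insert_absorb subsetD)
  moreover have "creative vac (current p x + c *\<^sub>C id_field)"
    using current_creative[OF x] by (simp add: creative_def del: plus_fun_apply)
  ultimately show ?case
    using field_of_gen_homogeneous[OF x c] v by blast
next
  case (mult p x q y n)
  then obtain a b where a: "field_of x = homog p a" "creative vac a"
      "\<And>T. generators \<subseteq> T \<Longrightarrow> pairwise_local T \<Longrightarrow> pairwise_local (insert (p, a) T)"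
    and b: "field_of y = homog q b" "creative vac b"
      "\<And>T. generators \<subseteq> T \<Longrightarrow> pairwise_local T \<Longrightarrow> pairwise_local (insert (q, b) T)" by blast
  let ?c = "nprod (koszul p q) a n b"
  have "pairwise_local (insert (p + q, ?c) T)" if T: "generators \<subseteq> T" "pairwise_local T" for T
  proof -
    have T2: "pairwise_local (insert (q, b) (insert (p, a) T))"
      using T by (intro a b) auto
    have "pairwise_local (insert (p + q, ?c) (insert (q, b) (insert (p, a) T)))"
    proof (rule pairwise_local_insert[OF T2])
      fix r c assume *: "\<And>p' a'. (p', a') \<in> insert (q, b) (insert (p, a) T) \<Longrightarrow> mutually_local (koszul p' r) a' c"
      have "mutually_local (koszul p q) a b" using T2 by (auto simp: pairwise_local_def)
      then show "mutually_local (koszul (p + q) r) ?c c"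
        unfolding koszul_add by (rule dongs_lemma) (rule *, simp)+
    qed
    then show ?thesis by (auto simp: pairwise_local_def)
  qed
  then show ?case
    using a(1,2) b(1,2) by (intro exI[of _ ?c]) (simp add: field_of super_prod_homog creative_nprod)
next
  case (zero p)
  have "pairwise_local (insert (p, 0) T)" if "pairwise_local T" for T :: "(bit \<times> ('g word \<Rightarrow> 'g \<times> complex) vfield) set"
    using that by (rule pairwise_local_insert) (rule local_zero)
  then show ?case by (intro exI[of _ 0]) (simp add: field_of_linear homog_linear creative_def)
next
  case (add p x y)
  then obtain a b where a: "field_of x = homog p a" "creative vac a"
      "\<And>T. generators \<subseteq> T \<Longrightarrow> pairwise_local T \<Longrightarrow> pairwise_local (insert (p, a) T)"
    and b: "field_of y = homog p b" "creative vac b"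
      "\<And>T. generators \<subseteq> T \<Longrightarrow> pairwise_local T \<Longrightarrow> pairwise_local (insert (p, b) T)" by blast
  have "pairwise_local (insert (p, a + b) T)" if T: "generators \<subseteq> T" "pairwise_local T" for T
  proof -
    have T2: "pairwise_local (insert (p, b) (insert (p, a) T))"
      using T by (intro a b) auto
    have "pairwise_local (insert (p, a + b) (insert (p, b) (insert (p, a) T)))"
      by (rule pairwise_local_insert[OF T2]) (simp add: local_add)
    then show ?thesis by (auto simp: pairwise_local_def)
  qed
  moreover have "creative vac (a + b)"
    using a(2) b(2) unfolding creative_def mode_add_field by (metis add_0)
  ultimately show ?case
    using a(1) b(1) by (intro exI[of _ "a + b"]) (simp add: field_of_linear homog_linear)
next
  case (scale p x c)
  then obtain a where a: "field_of x = homog p a" "creative vac a"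
      "\<And>T. generators \<subseteq> T \<Longrightarrow> pairwise_local T \<Longrightarrow> pairwise_local (insert (p, a) T)" by blast
  have "pairwise_local (insert (p, c *\<^sub>C a) T)" if T: "generators \<subseteq> T" "pairwise_local T" for T
  proof -
    have T2: "pairwise_local (insert (p, a) T)"
      using T by (intro a)
    have "pairwise_local (insert (p, c *\<^sub>C a) (insert (p, a) T))"
      by (rule pairwise_local_insert[OF T2]) (simp add: local_scale)
    then show ?thesis by (auto simp: pairwise_local_def)
  qed
  moreover have "creative vac (c *\<^sub>C a)"
    using a(2) unfolding creative_def mode_scale_field by (metis cvec.scale_zero_right)
  ultimately show ?case
    using a(1) by (intro exI[of _ "c *\<^sub>C a"]) (simp add: field_of_linear homog_linear)
qed

section \<open>The ideal acts by zero\<close>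

lemma local_current_of_has_parity:
  assumes "has_parity (s_part S) q x" "field_of x = homog q a" "y \<in> G p"
  shows "mutually_local (koszul q p) a (current p y)"
proof -
  obtain b where b: "field_of x = homog q b" "\<And>T. generators \<subseteq> T \<Longrightarrow> pairwise_local T \<Longrightarrow> pairwise_local (insert (q, b) T)"
    using field_of_homogeneous[OF assms(1)] by blast
  have "a = b" using b(1) assms(2) by (simp add: homog_inj)
  moreover have "pairwise_local (insert (q, b) generators)"
    by (rule b(2)) (simp_all add: generators_local)
  ultimately show ?thesis
    using current_generator[OF assms(3)] by (auto simp: pairwise_local_def)
qed

lemma unit_in_kernel: "gen (0, 1) \<star>\<^bsub>n\<^esub> x - (if n = -1 then x else 0) \<in> kernel"
  by (rule kernelI) (simp add: field_of_linear field_of field_of_unit[unfolded field_of(2)] scaleC_one super_prod_unit_left)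

lemma transl_mult_in_kernel:
  "transl (0, 1) (x \<star>\<^bsub>n\<^esub> y) - transl (0, 1) x \<star>\<^bsub>n\<^esub> y - x \<star>\<^bsub>n\<^esub> transl (0, 1) y \<in> kernel"
  by (rule kernelI) (simp add: field_of_linear field_of(3) field_of_transl super_deriv_prod)

lemma transl_left_in_kernel:
  "transl (0, 1) x \<star>\<^bsub>n\<^esub> y + of_int n *\<^sub>C (x \<star>\<^bsub>n - 1\<^esub> y) \<in> kernel"
  by (rule kernelI) (simp add: field_of_linear field_of(3) field_of_transl super_prod_deriv_left)

lemma skew_in_kernel:
  assumes "has_parity (s_part S) p x" "has_parity (s_part S) q y"
    and K: "\<And>k. k \<ge> K \<Longrightarrow> y \<star>\<^bsub>n + int k\<^esub> x \<in> kernel"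
  shows "x \<star>\<^bsub>n\<^esub> y + koszul p q *\<^sub>C
      (\<Sum>k<K. ((-1) powi (n + int k) / fact k) *\<^sub>C (transl (0, 1) ^^ k) (y \<star>\<^bsub>n + int k\<^esub> x)) \<in> kernel"
proof -
  obtain a where a: "field_of x = homog p a" "\<And>T. generators \<subseteq> T \<Longrightarrow> pairwise_local T \<Longrightarrow> pairwise_local (insert (p, a) T)"
    using field_of_homogeneous[OF assms(1)] by blast
  obtain b where b: "field_of y = homog q b" "\<And>T. generators \<subseteq> T \<Longrightarrow> pairwise_local T \<Longrightarrow> pairwise_local (insert (q, b) T)"
    using field_of_homogeneous[OF assms(2)] by blast
  have "pairwise_local (insert (q, b) (insert (p, a) generators))"
    by (intro a b) (auto simp: generators_local)
  then have loc: "mutually_local (koszul p q) b a"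
    using koszul_commute[of p q] by (auto simp: pairwise_local_def)
  have yx: "field_of (y \<star>\<^bsub>m\<^esub> x) = homog (p + q) (nprod (koszul p q) b m a)" for m
    by (simp add: field_of(3) a b super_prod_homog koszul_commute add.commute)
  have van: "mode (nprod (koszul p q) b (n + int k) a) m v = 0" if "k \<ge> K" "v \<in> vacuum_module" for k m v
    using K[OF that(1)] that(2) kernel_homog[OF yx] by blast
  have "field_of (x \<star>\<^bsub>n\<^esub> y + koszul p q *\<^sub>C
      (\<Sum>k<K. ((-1) powi (n + int k) / fact k) *\<^sub>C (transl (0, 1) ^^ k) (y \<star>\<^bsub>n + int k\<^esub> x))) =
    homog (p + q) (nprod (koszul p q) a n b + koszul p q *\<^sub>C
      (\<Sum>k<K. ((-1) powi (n + int k) / fact k) *\<^sub>C (deriv_field ^^ k) (nprod (koszul p q) b (n + int k) a)))"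
    by (simp add: field_of_linear field_of_transl_pow yx super_deriv_homog homog_linear homog_sum)
      (simp add: field_of(3) a b super_prod_homog)
  moreover have "mode (nprod (koszul p q) a n b + koszul p q *\<^sub>C
      (\<Sum>k<K. ((-1) powi (n + int k) / fact k) *\<^sub>C (deriv_field ^^ k) (nprod (koszul p q) b (n + int k) a))) m v = 0"
    if "v \<in> vacuum_module" for m v
    by (rule skew_symmetry[OF koszul_square loc]) (rule van[OF _ that])
  ultimately show ?thesis
    using kernel_homog by blast
qed

text \<open>The associator is the image of a homogeneous element, hence local to the currents, and it
  kills the vacuum.\<close>

lemma assoc_in_kernel:
  assumes xyz: "has_parity (s_part S) p x" "has_parity (s_part S) q y" "has_parity (s_part S) r z"
    and K: "\<And>k. k \<ge> K \<Longrightarrow> y \<star>\<^bsub>n + int k\<^esub> z \<in> kernel" "\<And>k. k \<ge> K \<Longrightarrow> x \<star>\<^bsub>int k\<^esub> z \<in> kernel"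
  shows "(x \<star>\<^bsub>m\<^esub> y) \<star>\<^bsub>n\<^esub> z - (\<Sum>k<K. ((of_int m gchoose k) * (-1) ^ k) *\<^sub>C
      (x \<star>\<^bsub>m - int k\<^esub> (y \<star>\<^bsub>n + int k\<^esub> z)
       - ((-1) powi m * koszul p q) *\<^sub>C (y \<star>\<^bsub>m + n - int k\<^esub> (x \<star>\<^bsub>int k\<^esub> z)))) \<in> kernel"
    (is "?t \<in> kernel")
proof -
  obtain a where a: "field_of x = homog p a" "creative vac a"
    using field_of_homogeneous[OF xyz(1)] by blast
  obtain b where b: "field_of y = homog q b" "creative vac b"
    using field_of_homogeneous[OF xyz(2)] by blast
  obtain c where c: "field_of z = homog r c" "creative vac c"
    using field_of_homogeneous[OF xyz(3)] by blast
  let ?A = "associator (koszul p q) (koszul p r) (koszul q r) m n K a b c"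
  have idx: "q + (p + r) = p + q + r" "p + (q + r) = p + q + r" by (simp_all add: add_ac)
  have kz: "koszul p (q + r) = koszul p q * koszul p r" "koszul q (p + r) = koszul p q * koszul q r"
    using koszul_commute[of p "q + r"] koszul_commute[of q "p + r"] koszul_commute[of p q]
      koszul_commute[of p r] koszul_commute[of q r] by (simp_all add: koszul_add)
  have field_of_t: "field_of ?t = homog (p + q + r) ?A"
    unfolding associator_def alt_binomial_def
    by (simp add: field_of_linear field_of(3) a b c super_prod_homog homog_linear homog_diff homog_sum koszul_add kz idx)
  have par: "has_parity (s_part S) (p + q + r) ?t"
  proof (intro has_parity_diff has_parity_sum has_parity.scale)
    show "has_parity (s_part S) (p + q + r) ((x \<star>\<^bsub>m\<^esub> y) \<star>\<^bsub>n\<^esub> z)"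
      by (intro has_parity.mult xyz)
    show "has_parity (s_part S) (p + q + r) (x \<star>\<^bsub>i\<^esub> (y \<star>\<^bsub>j\<^esub> z))" for i j
      unfolding idx[symmetric] by (metis has_parity.mult xyz idx)
    show "has_parity (s_part S) (p + q + r) (y \<star>\<^bsub>i\<^esub> (x \<star>\<^bsub>j\<^esub> z))" for i j
      by (metis has_parity.mult xyz idx)
  qed
  have yz: "field_of (y \<star>\<^bsub>j\<^esub> z) = homog (q + r) (nprod (koszul q r) b j c)"
    and xz: "field_of (x \<star>\<^bsub>j\<^esub> z) = homog (p + r) (nprod (koszul p r) a j c)" for j
    by (simp_all add: field_of(3) a b c super_prod_homog)
  have "mode ?A i vac = 0" for i
  proof (rule associator_vacuum[OF a(2) b(2) c(2)])
    show "mode (nprod (koszul q r) b (n + int k) c) j vac = 0" if "k \<ge> K" for k j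
      using K(1)[OF that] kernel_homog[OF yz] vacuum_module.vac by blast
    show "mode (nprod (koszul p r) a (int k) c) j vac = 0" if "k \<ge> K" for k j
      using K(2)[OF that] kernel_homog[OF xz] vacuum_module.vac by blast
  qed
  then have "mode ?A i v = 0" if "v \<in> vacuum_module" for i v
    using annihilates_vacuum_module[OF local_current_of_has_parity[OF par field_of_t] _ that] by blast
  then show ?thesis
    unfolding kernel_homog[OF field_of_t] by blast
qed

text \<open>The absence of a central term in the commutator makes the products with \<open>n \<ge> 1\<close> vanish, which
  is the bound \<open>N = 1\<close>.\<close>

lemma nprod_current:
  assumes "x \<in> G p" "y \<in> G q"
  shows "nprod (koszul p q) (current p x) 0 (current q y) = current (p + q) (br x y)"
    and "1 \<le> n \<Longrightarrow> nprod (koszul p q) (current p x) n (current q y) = 0"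
  by (rule vfield_eqI; simp add: mode_nprod current_commutator current_ope assms)+

lemma bracket_products:
  "gen s \<star>\<^bsub>0\<^esub> gen t - gen (s_br S s t) \<in> kernel"
  "1 \<le> n \<Longrightarrow> gen s \<star>\<^bsub>n\<^esub> gen t \<in> kernel"
proof -
  obtain x c where s: "s = (x, c)" by (cases s)
  obtain y d where t: "t = (y, d)" by (cases t)
  let ?x0 = "even_part x" and ?x1 = "x - even_part x" and ?y0 = "even_part y" and ?y1 = "y - even_part y"
  note parts = even_part[of x] even_part[of y]
  have prod: "field_of (gen s \<star>\<^bsub>n\<^esub> gen t) =
      (nprod 1 (current 0 ?x0) n (current 0 ?y0) + nprod (-1) (current 1 ?x1) n (current 1 ?y1),
       nprod 1 (current 0 ?x0) n (current 1 ?y1) + nprod 1 (current 1 ?x1) n (current 0 ?y0))" if "0 \<le> n" for n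
    using that by (simp add: field_of s t gen_field_def super_prod_def nprod_linear nprod_id_left nprod_id_right_nonneg)
  have zero: "field_of (gen s \<star>\<^bsub>n\<^esub> gen t) = 0" if "1 \<le> n" for n
    using that nprod_current(2)[OF parts(1) parts(3) that] nprod_current(2)[OF parts(1) parts(4) that]
      nprod_current(2)[OF parts(2) parts(3) that] nprod_current(2)[OF parts(2) parts(4) that]
    by (simp add: prod koszul_def zero_prod_def)
  show "1 \<le> n \<Longrightarrow> gen s \<star>\<^bsub>n\<^esub> gen t \<in> kernel"
    by (rule kernelI) (rule zero)
  have "br x y = br (?x0 + ?x1) (?y0 + ?y1)" by simp
  also have "\<dots> = (br ?x0 ?y0 + br ?x1 ?y1) + (br ?x0 ?y1 + br ?x1 ?y0)"
    unfolding br_linear by (simp only: add_ac)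
  finally have split: "br x y - (br ?x0 ?y0 + br ?x1 ?y1) = br ?x0 ?y1 + br ?x1 ?y0" by simp
  have closed: "br ?x0 ?y0 \<in> G 0" "br ?x1 ?y1 \<in> G 0" "br ?x0 ?y1 \<in> G 1" "br ?x1 ?y0 \<in> G 1"
    using br_closed[OF parts(1) parts(3)] br_closed[OF parts(2) parts(4)]
      br_closed[OF parts(1) parts(4)] br_closed[OF parts(2) parts(3)] by simp_all
  have ev: "even_part (br x y) = br ?x0 ?y0 + br ?x1 ?y1"
    by (rule even_part_eqI) (simp_all only: split G_closed closed)
  have "s_br S s t = (br x y, 0)"
    by (simp add: s_br_def a_br_g_def souped_up_const_def s t)
  then have "field_of (gen (s_br S s t)) =
      (current 0 (br ?x0 ?y0) + current 0 (br ?x1 ?y1), current 1 (br ?x0 ?y1) + current 1 (br ?x1 ?y0))"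
    by (simp only: field_of(2) gen_field_def fst_conv snd_conv ev split current_linear closed cvec.scale_zero_left add_0_right)
  moreover have "field_of (gen s \<star>\<^bsub>0\<^esub> gen t) =
      (current 0 (br ?x0 ?y0) + current 0 (br ?x1 ?y1), current 1 (br ?x0 ?y1) + current 1 (br ?x1 ?y0))"
    using nprod_current(1)[OF parts(1) parts(3)] nprod_current(1)[OF parts(1) parts(4)]
      nprod_current(1)[OF parts(2) parts(3)] nprod_current(1)[OF parts(2) parts(4)]
    by (simp add: prod koszul_def)
  ultimately show "gen s \<star>\<^bsub>0\<^esub> gen t - gen (s_br S s t) \<in> kernel"
    by (intro kernelI) (simp add: field_of_linear)
qed

lemma souped_up_relations_in_kernel: "souped_up_relations S \<subseteq> kernel"
proof -
  have scalar: "field_of (gen (0, a) \<star>\<^bsub>-1\<^esub> x) = a *\<^sub>C field_of x" for a x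
    by (simp add: field_of(3) field_of_unit super_prod_def nprod_linear nprod_id_left scaleC_prod_def)
  have "gen (0, a) \<star>\<^bsub>-1\<^esub> gen s - gen (s_act S a s) \<in> kernel" for a s
  proof (rule kernelI)
    have "s_act S a s = a *\<^sub>C s"
      by (simp add: s_act_def souped_up_const_def scaleC_prod_def scaleC_complex_def)
    moreover have "gen_field (a *\<^sub>C s) = a *\<^sub>C gen_field s"
      using clinear_gen_field unfolding clinear_iff by blast
    ultimately show "field_of (gen (0, a) \<star>\<^bsub>-1\<^esub> gen s - gen (s_act S a s)) = 0"
      by (simp add: field_of_linear scalar field_of(2))
  qed
  moreover have "gen (0, a_mult S a b) \<star>\<^bsub>-1\<^esub> x - gen (0, a) \<star>\<^bsub>-1\<^esub> (gen (0, b) \<star>\<^bsub>-1\<^esub> x) \<in> kernel" for a b x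
    by (rule kernelI) (simp add: field_of_linear scalar souped_up_const_def scaleC_scaleC)
  ultimately show ?thesis
    using bracket_products(1) by (auto simp: souped_up_relations_def)
qed

lemma souped_up_ideal_in_kernel: "x \<in> souped_up_ideal S (\<lambda>s t. 1) M \<Longrightarrow> x \<in> kernel"
proof -
  have one: "s_one S = (0, 1)"
    by (simp add: s_one_def souped_up_const_def)
  assume "x \<in> souped_up_ideal S (\<lambda>s t. 1) M"
  then show "x \<in> kernel"
    unfolding souped_up_ideal_def one
  proof (induction rule: vertex_ideal.induct)
    case zero
    show ?case by (rule kernelI) (rule field_of_linear)
  next
    case (add x y)
    then show ?case by (simp add: kernel_def field_of_linear)
  next
    case (scale x c)
    then show ?case by (simp add: kernel_def field_of_linear scaleC_prod_def)
  next
    case (bound n u v)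
    then show ?case by (intro bracket_products) simp
  next
    case (skew n p x q y K)
    then show ?case by (intro skew_in_kernel)
  next
    case (assoc m n p x q y r z K)
    then show ?case by (intro assoc_in_kernel)
  next
    case (extra x)
    then show ?case using souped_up_relations_in_kernel by blast
  qed (simp_all only: kernel_ideal unit_in_kernel transl_mult_in_kernel transl_left_in_kernel)
qed

text \<open>Apply the mode \<open>-1\<close> to the vacuum and evaluate at the empty word: the result is the
  pair of \<open>x\<close> and \<open>c\<close>.\<close>

lemma gen_in_kernel:
  assumes "gen s \<in> kernel"
  shows "s = 0"
proof -
  obtain x c where s: "s = (x, c)" by (cases s)
  have 0: "mode (current 0 (even_part x)) (-1) vac + c *\<^sub>C vac = 0" "mode (current 1 (x - even_part x)) (-1) vac = 0"
    using assms vacuum_module.vac by (auto simp: kernel_def field_of(2) gen_field_def s simp del: plus_fun_apply dest!: spec[of _ "-1"])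
  have ev: "mode (current p y) (-1) vac [] = (y, 0)" if "y \<in> G p" for p y
    using that by (simp add: mode_current proj(3) vacuum_module.vac act_def vac_def correlator.simps(2))
  have "vac [] = (0, 1)" by (simp add: vac_def)
  then have "even_part x = 0 \<and> c = 0"
    using fun_cong[OF 0(1), of "[]"] ev[OF even_part(1)] by (simp add: scaleC_prod_def zero_prod_def scaleC_complex_def)
  moreover have "x - even_part x = 0"
    using fun_cong[OF 0(2), of "[]"] ev[OF even_part(2)] by (simp add: zero_prod_def)
  ultimately show ?thesis by (simp add: s zero_prod_def)
qed

end

theorem theorem4p6:
  fixes G :: "bit \<Rightarrow> 'g::complex_vector set" and br :: "'g \<Rightarrow> 'g \<Rightarrow> 'g" and M :: int
  assumes "lie_superalgebra G br"
  shows "inj (\<lambda>s. quot_class (souped_up_ideal (souped_up_const G br) (\<lambda>s t. 1) M) (gen s))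
    \<and> souped_up_ideal (souped_up_const G br) (\<lambda>s t. 1) M \<inter> range gen = {0}"
proof -
  interpret lie_superalgebra G br by fact
  let ?I = "souped_up_ideal (souped_up_const G br) (\<lambda>s t. 1) M"
  have gen_I: "s = 0" if "gen s \<in> ?I" for s
    using gen_in_kernel souped_up_ideal_in_kernel that by blast
  have zero: "0 \<in> ?I"
    unfolding souped_up_ideal_def by (rule vertex_ideal.zero)
  interpret gen: Vector_Spaces.linear scaleC scaleC "gen :: 'g \<times> complex \<Rightarrow> _"
    by (rule clinear_gen)
  have "inj (\<lambda>s. quot_class ?I (gen s))"
  proof (rule injI)
    fix s t assume eq: "quot_class ?I (gen s) = quot_class ?I (gen t)"
    have "gen s \<in> quot_class ?I (gen s)" using zero by (simp add: quot_class_def)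
    then have "gen s \<in> quot_class ?I (gen t)" by (simp only: eq)
    then have "gen (s - t) \<in> ?I" by (simp add: quot_class_def gen.diff)
    then show "s = t" using gen_I[of "s - t"] by simp
  qed
  moreover have "?I \<inter> range gen = {0}"
  proof
    show "?I \<inter> range gen \<subseteq> {0}"
      using gen_I gen.zero by blast
    show "{0} \<subseteq> ?I \<inter> range gen"
      using zero rangeI[of "gen :: 'g \<times> complex \<Rightarrow> _" 0] unfolding gen.zero by blast
  qed
  ultimately show ?thesis by blast
qed

end
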